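(* Let $i\in\{1,2,3,4\}$ and $L,K\in\mathbb C^\times$. Let $\mathcal R^{(i)}_{LK}$ denote the restriction of the birational map $\mathcal R_{LK}\colon\mathcal B_L(D_N^{(1)})\times\mathcal B_K(D_N^{(1)})\to\mathcal B_K(D_N^{(1)})\times\mathcal B_L(D_N^{(1)})$ to $X_i^{(n,L)}\times X_i^{(n,K)}$, where $N=n+1,\,2n,\,n+2,\,2n+2$ for $i=1,2,3,4$ respectively. Then $\mathcal R^{(i)}_{LK}$ is a well-defined birational map $$X_i^{(n,L)}\times X_i^{(n,K)}\longrightarrow X_i^{(n,K)}\times X_i^{(n,L)}.$$
   Context: Throughout $n$ is such that $N\ge4$. **Variety $\mathcal B_L(D_N^{(1)})$.** For $L\in\mathbb C^\times$, $\mathcal B_L(D_N^{(1)})=\{l=(l_1,\dots,l_N,\overline l_{N-1},\dots,\overline l_1)\in(\mathbb C^\times)^{2N-1}: l_1\cdots l_N\overline l_{N-1}\cdots\overline l_1=L\}$. **M-matrix.** For $l\in\mathcal B_L(D_N^{(1)})$ and an indeterminate $z$, $M_L(l,z)=A+zB+z^2E_{1,2N}$ is the $2N\times2N$ matrix with $E_{1,2N}$ the matrix unit, and nonzero entries of $A=A(l)$: $A_{i,i}=l_i/\overline l_i$ and $A_{2N+1-i,2N+1-i}=\overline l_i/l_i$ $(1\le i\le N-1)$, $A_{N,N}=l_N$, $A_{N+1,N+1}=1/l_N$; for $1\le j<i\le N-1$: $A_{i,j}=l_j\cdots l_{i-1}(1+l_i/\overline l_i)$, $A_{2N+1-j,2N+1-i}=\overline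 l_j\cdots\overline l_{i-1}(1+\overline l_i/l_i)$; for $1\le j\le N-1$: $A_{N,j}=l_j\cdots l_N$, $A_{N+1,j}=l_j\cdots l_{N-1}$, $A_{2N+1-j,N}=\overline l_j\cdots\overline l_{N-1}l_N$, $A_{2N+1-j,N+1}=\overline l_j\cdots\overline l_{N-1}$; for $1\le i,j\le N-1$: $A_{2N+1-i,j}=(l_j\cdots l_N)(\overline l_i\cdots\overline l_{N-1})$. Finally $B_{i,j}=A_{i,1}A_{2N,j}-LA_{i,j}-\delta_{i,1}\delta_{j,2N}$. **The map $\mathcal R_{LK}$.** $\mathcal R_{LK}(l,m)=(l',m')$, where $(l',m')\in\mathcal B_K(D_N^{(1)})\times\mathcal B_L(D_N^{(1)})$ is the unique solution of $M_L(l,z)M_K(m,z)=M_K(l',z)M_L(m',z)$; it is known to be a birational map. **Involutions on $\mathcal B_L(D_N^{(1)})$** ($l'=\Sigma(l)$; unlisted coordinates are unchanged): - $\Sigma_0$: $l_1'=\overline l_1$, $\overline l_1'=l_1$. - $\Sigma_1$: $l'_{N-1}=l_{N-1}l_N$, $l'_N=1/l_N$, $\overline l'_{N-1}=l_N\overline l_{N-1}$. - $\Sigma_2$ ($N$ even): $l_1'=\frac{l_{N-1}\overline l_{N-1}}{l_{N-1}+\overline l_{N-1}}$, $\overline l_1'=\frac{l_Nl_{N-1}\overline l_{N-1}}{l_{N-1}+\overline l_{N-1}}$, $l_N'=\overline l_1/l_1$, $l'_{N-1}=\frac{l_1\overline l_2}{l_2}\left(\frac{l_2}{\overline l_2}+1\right)$,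 $\overline l'_{N-1}=l_1\left(\frac{l_2}{\overline l_2}+1\right)$, and for $2\le i\le N-2$: $l'_{N-i}=\frac{l_i\overline l_i}{l_{i+1}}\cdot\frac{l_{i+1}+\overline l_{i+1}}{l_i+\overline l_i}$, $\overline l'_{N-i}=\frac{l_i\overline l_i}{\overline l_{i+1}}\cdot\frac{l_{i+1}+\overline l_{i+1}}{l_i+\overline l_i}$. - $\Sigma_3=\Sigma_0\circ\Sigma_1$. - $\Sigma_4=\Sigma_2\circ\Sigma_1\circ\Sigma_0$ ($N$ even). **Fixed-point varieties.** For $i=1,2,3,4$, with $N=n+1,\,2n,\,n+2,\,2n+2$ respectively, $$X_i^{(n,L)}=\{l\in\mathcal B_L(D_N^{(1)}):\Sigma_i(l)=l\}.$$ (For $i=1$ the condition is $l_{n+1}=1$; for $i=3$ it is $l_{n+2}=1$ and $l_1=\overline l_1$.)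
   Formalization: The matrix M_L(l,z) is taken as A+zB+z²L·E_{1,2N} instead of A+zB+z²E_{1,2N}, since with the printed coefficient the equation defining R_{LK} has no solutions when L≠K (compare the z² coefficients at entry (2N,2N): L versus K). *)

theory Defs
  imports
    Complex_Main
    "HOL-Library.FuncSet"
    "HOL-Computational_Algebra.Polynomial"
    "HOL-Analysis.Function_Topology"
    "Jordan_Normal_Form.Matrix"
begin

section \<open>Rational maps between quasi-affine complex varieties\<close>

text \<open>
  All varieties below are sets of pairs \<open>(l, m)\<close> of coordinate vectors.  A vector is a function
  on \<open>nat\<close> taking the value \<open>undefined\<close> outside its finite index range.  As the field is infinite,
  polynomials in the coordinates may be identified with polynomial functions.
\<close>

type_synonym pt = "nat \<Rightarrow> complex"

inductive_set polyfun :: "(pt \<times> pt \<Rightarrow> complex) set" where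
  const: "(\<lambda>_. c) \<in> polyfun"
| coord_fst: "(\<lambda>p. fst p k) \<in> polyfun"
| coord_snd: "(\<lambda>p. snd p k) \<in> polyfun"
| add: "f \<in> polyfun \<Longrightarrow> g \<in> polyfun \<Longrightarrow> (\<lambda>p. f p + g p) \<in> polyfun"
| mult: "f \<in> polyfun \<Longrightarrow> g \<in> polyfun \<Longrightarrow> (\<lambda>p. f p * g p) \<in> polyfun"

definition zariski :: "(pt \<times> pt) topology" where
  "zariski = topology_generated_by {{p. f p \<noteq> 0} | f. f \<in> polyfun}"

definition zopen :: "(pt \<times> pt) set \<Rightarrow> (pt \<times> pt) set \<Rightarrow> bool" where
  "zopen X U \<longleftrightarrow> openin (subtopology zariski X) U"

text \<open>\<open>X\<close> may be reducible; a dense open subset meets every irreducible component.\<close>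

definition zdense :: "(pt \<times> pt) set \<Rightarrow> (pt \<times> pt) set \<Rightarrow> bool" where
  "zdense X U \<longleftrightarrow> U \<subseteq> X \<and> (subtopology zariski X) closure_of U = X"

definition regular_fun :: "(pt \<times> pt) set \<Rightarrow> (pt \<times> pt) set \<Rightarrow> (pt \<times> pt \<Rightarrow> complex) \<Rightarrow> bool" where
  "regular_fun X W f \<longleftrightarrow>
     (\<forall>p\<in>W. \<exists>V a b. zopen X V \<and> p \<in> V \<and> V \<subseteq> W \<and> a \<in> polyfun \<and> b \<in> polyfun \<and>
        (\<forall>q\<in>V. b q \<noteq> 0 \<and> f q = a q / b q))"

definition regular_map :: "(pt \<times> pt) set \<Rightarrow> (pt \<times> pt) set \<Rightarrow> (pt \<times> pt \<Rightarrow> pt \<times> pt) \<Rightarrow> bool" where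
  "regular_map X W F \<longleftrightarrow>
     (\<forall>k. regular_fun X W (\<lambda>p. fst (F p) k) \<and> regular_fun X W (\<lambda>p. snd (F p) k))"

definition rational_map ::
    "(pt \<times> pt) set \<Rightarrow> (pt \<times> pt) set \<Rightarrow> (pt \<times> pt \<rightharpoonup> pt \<times> pt) \<Rightarrow> bool" where
  "rational_map X Y g \<longleftrightarrow>
     zopen X (dom g) \<and> zdense X (dom g) \<and> ran g \<subseteq> Y \<and> regular_map X (dom g) (\<lambda>p. the (g p))"

definition birational_map ::
    "(pt \<times> pt) set \<Rightarrow> (pt \<times> pt) set \<Rightarrow> (pt \<times> pt \<rightharpoonup> pt \<times> pt) \<Rightarrow> bool" where
  "birational_map X Y g \<longleftrightarrow>
     rational_map X Y g \<and>
     (\<exists>h. rational_map Y X h \<and>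
        (\<exists>U. zopen X U \<and> zdense X U \<and> (\<forall>p\<in>U. (h \<circ>\<^sub>m g) p = Some p)) \<and>
        (\<exists>V. zopen Y V \<and> zdense Y V \<and> (\<forall>q\<in>V. (g \<circ>\<^sub>m h) q = Some q)))"

text \<open>
  The rational map \<open>X \<rightharpoonup> Y\<close> determined by a partial function \<open>s\<close> that is generically given by
  regular functions, with its maximal domain of definition: it is defined at \<open>p\<close> if some regular
  map from an open neighbourhood of \<open>p\<close> to \<open>Y\<close> agrees with \<open>s\<close> on a dense open subset
  of that neighbourhood.
\<close>

definition rational_value ::
    "(pt \<times> pt) set \<Rightarrow> (pt \<times> pt) set \<Rightarrow> (pt \<times> pt \<rightharpoonup> pt \<times> pt) \<Rightarrow> pt \<times> pt \<Rightarrow> pt \<times> pt \<Rightarrow> bool" where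
  "rational_value X Y s p y \<longleftrightarrow>
     (\<exists>W D F. zopen X W \<and> p \<in> W \<and> regular_map X W F \<and> F ` W \<subseteq> Y \<and>
        zopen X D \<and> zdense W D \<and> (\<forall>q\<in>D. s q = Some (F q)) \<and> y = F p)"

definition rational_closure ::
    "(pt \<times> pt) set \<Rightarrow> (pt \<times> pt) set \<Rightarrow> (pt \<times> pt \<rightharpoonup> pt \<times> pt) \<Rightarrow> (pt \<times> pt \<rightharpoonup> pt \<times> pt)" where
  "rational_closure X Y s p =
     (if \<exists>y. rational_value X Y s p y then Some (THE y. rational_value X Y s p y) else None)"


section \<open>The varieties \<open>\<B>\<^sub>L(D\<^sub>N\<^sup>(\<^sup>1\<^sup>))\<close> and the tropical R map\<close>

text \<open>
  The vector \<open>(l\<^sub>1,\<dots>,l\<^sub>N, l\<^sub>N\<^sub>-\<^sub>1-bar,\<dots>,l\<^sub>1-bar)\<close> is indexed by \<open>{1..2*N-1}\<close> in this order, so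
  \<open>l\<^sub>i-bar\<close> is the coordinate with index \<open>2*N - i\<close>.
\<close>

definition bar :: "nat \<Rightarrow> pt \<Rightarrow> nat \<Rightarrow> complex" where
  "bar N l i = l (2*N - i)"

definition mk_pt :: "nat \<Rightarrow> (nat \<Rightarrow> complex) \<Rightarrow> (nat \<Rightarrow> complex) \<Rightarrow> pt" where
  "mk_pt N u v = (\<lambda>k\<in>{1..2*N-1}. if k \<le> N then u k else v (2*N - k))"

definition BD :: "nat \<Rightarrow> complex \<Rightarrow> pt set" where
  "BD N L = {l \<in> {1..2*N-1} \<rightarrow>\<^sub>E - {0}. (\<Prod>k=1..2*N-1. l k) = L}"

text \<open>Rows and columns of \<open>A\<close> and \<open>B\<close> are numbered from 1 to \<open>2*N\<close>.\<close>

definition A_entry :: "nat \<Rightarrow> pt \<Rightarrow> nat \<Rightarrow> nat \<Rightarrow> complex" where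
  "A_entry N l i j =
     (let i' = 2*N + 1 - i; j' = 2*N + 1 - j; lb = bar N l in
      if i = j then
        (if i < N then l i / lb i
         else if i = N then l N
         else if i = N + 1 then 1 / l N
         else lb i' / l i')
      else if j < i \<and> i < N then (\<Prod>k=j..<i. l k) * (1 + l i / lb i)
      else if i' < j' \<and> j' < N then (\<Prod>k=i'..<j'. lb k) * (1 + lb j' / l j')
      else if i = N \<and> j < N then (\<Prod>k=j..N. l k)
      else if i = N + 1 \<and> j < N then (\<Prod>k=j..<N. l k)
      else if i' < N \<and> j = N then (\<Prod>k=i'..<N. lb k) * l N
      else if i' < N \<and> j = N + 1 then (\<Prod>k=i'..<N. lb k)
      else if i' < N \<and> j < N then (\<Prod>k=j..N. l k) * (\<Prod>k=i'..<N. lb k)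
      else 0)"

definition B_entry :: "nat \<Rightarrow> complex \<Rightarrow> pt \<Rightarrow> nat \<Rightarrow> nat \<Rightarrow> complex" where
  "B_entry N L l i j =
     A_entry N l i 1 * A_entry N l (2*N) j - L * A_entry N l i j
     - (if i = 1 \<and> j = 2*N then 1 else 0)"

text \<open>
  The matrix \<open>A + z B + z\<^sup>2 L E\<^sub>1\<^sub>,\<^sub>2\<^sub>N\<close>, as a matrix of polynomials in \<open>z\<close>.
  The factor \<open>L\<close> at \<open>E\<^sub>1\<^sub>,\<^sub>2\<^sub>N\<close> is forced: with \<open>z\<^sup>2 c\<^sub>L E\<^sub>1\<^sub>,\<^sub>2\<^sub>N\<close> instead,
  the coefficient of \<open>z\<^sup>2\<close> at \<open>(2N,2N)\<close> of \<open>M\<^sub>L(l,z) M\<^sub>K(m,z)\<close> is \<open>L c\<^sub>K\<close>, because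
  \<open>A\<^sub>2\<^sub>N\<^sub>,\<^sub>1 = L\<close> and row \<open>2N\<close> of \<open>B\<close> vanishes.  Hence the equation
  \<open>M\<^sub>L(l,z) M\<^sub>K(m,z) = M\<^sub>K(l',z) M\<^sub>L(m',z)\<close> implies \<open>L c\<^sub>K = K c\<^sub>L\<close>; for \<open>c\<^sub>L = c\<^sub>K = 1\<close> it would have
  no solutions at all unless \<open>L = K\<close>.
\<close>

definition M_mat :: "nat \<Rightarrow> complex \<Rightarrow> pt \<Rightarrow> complex poly mat" where
  "M_mat N L l = mat (2*N) (2*N) (\<lambda>(i, j).
     [: A_entry N l (i+1) (j+1), B_entry N L l (i+1) (j+1),
        if i+1 = 1 \<and> j+1 = 2*N then L else 0 :])"

definition M_solution :: "nat \<Rightarrow> complex \<Rightarrow> complex \<Rightarrow> pt \<times> pt \<Rightarrow> pt \<times> pt \<Rightarrow> bool" where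
  "M_solution N L K = (\<lambda>(l, m) (l', m').
     l' \<in> BD N K \<and> m' \<in> BD N L \<and>
     M_mat N L l * M_mat N K m = M_mat N K l' * M_mat N L m')"

definition solution_map :: "nat \<Rightarrow> complex \<Rightarrow> complex \<Rightarrow> (pt \<times> pt \<rightharpoonup> pt \<times> pt)" where
  "solution_map N L K p =
     (if p \<in> BD N L \<times> BD N K \<and> (\<exists>!q. M_solution N L K p q)
      then Some (THE q. M_solution N L K p q) else None)"

text \<open>
  The solution is unique only generically, so \<open>\<R>\<^sub>L\<^sub>K\<close> is the rational map given by it.
  Taking the maximal domain of definition matters when restricting to subvarieties: for \<open>L = K\<close>
  this rational map is the identity, but the fixed-point varieties of \<open>\<Sigma>\<^sub>2\<close> and \<open>\<Sigma>\<^sub>4\<close> are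
  reducible, and on some components of their products the matrix equation has further solutions.
\<close>

definition tropical_R :: "nat \<Rightarrow> complex \<Rightarrow> complex \<Rightarrow> (pt \<times> pt \<rightharpoonup> pt \<times> pt)" where
  "tropical_R N L K =
     rational_closure (BD N L \<times> BD N K) (BD N K \<times> BD N L) (solution_map N L K)"


section \<open>The involutions and their fixed-point varieties\<close>

definition Sigma0 :: "nat \<Rightarrow> pt \<Rightarrow> pt" where
  "Sigma0 N l = mk_pt N (l(1 := bar N l 1)) ((bar N l)(1 := l 1))"

definition Sigma1 :: "nat \<Rightarrow> pt \<Rightarrow> pt" where
  "Sigma1 N l = mk_pt N (l(N - 1 := l (N-1) * l N, N := 1 / l N))
                        ((bar N l)(N - 1 := l N * bar N l (N-1)))"

text \<open>
  \<open>\<Sigma>\<^sub>2\<close> is only a rational map.  On \<open>BD N L\<close>, where no coordinate is 0, its denominators vanish iff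
  \<open>l\<^sub>i + l\<^sub>i-bar = 0\<close> for some \<open>2 \<le> i \<le> N - 1\<close>; by \<open>x / 0 = 0\<close> the formulas then produce a zero
  coordinate, so such points are not fixed points of \<open>\<Sigma>\<^sub>2\<close> or \<open>\<Sigma>\<^sub>4\<close>.
  The \<open>j\<close>-th coordinates for \<open>2 \<le> j \<le> N - 2\<close> are given in terms of \<open>i = N - j\<close>.
\<close>

definition Sigma2 :: "nat \<Rightarrow> pt \<Rightarrow> pt" where
  "Sigma2 N l =
     (let lb = bar N l in
      mk_pt N
       (\<lambda>j. if j = 1 then l (N-1) * lb (N-1) / (l (N-1) + lb (N-1))
            else if j = N then lb 1 / l 1
            else if j = N - 1 then (l 1 * lb 2 / l 2) * (l 2 / lb 2 + 1)
            else (let i = N - j in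
                  (l i * lb i / l (i+1)) * ((l (i+1) + lb (i+1)) / (l i + lb i))))
       (\<lambda>j. if j = 1 then l N * l (N-1) * lb (N-1) / (l (N-1) + lb (N-1))
            else if j = N - 1 then l 1 * (l 2 / lb 2 + 1)
            else (let i = N - j in
                  (l i * lb i / lb (i+1)) * ((l (i+1) + lb (i+1)) / (l i + lb i)))))"

definition Sigma_inv :: "nat \<Rightarrow> nat \<Rightarrow> pt \<Rightarrow> pt" where
  "Sigma_inv i N =
     (if i = 1 then Sigma1 N
      else if i = 2 then Sigma2 N
      else if i = 3 then Sigma0 N \<circ> Sigma1 N
      else Sigma2 N \<circ> Sigma1 N \<circ> Sigma0 N)"

definition rankN :: "nat \<Rightarrow> nat \<Rightarrow> nat" where
  "rankN i n = (if i = 1 then n + 1 else if i = 2 then 2*n else if i = 3 then n + 2 else 2*n + 2)"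

definition X_var :: "nat \<Rightarrow> nat \<Rightarrow> complex \<Rightarrow> pt set" where
  "X_var i n L = {l \<in> BD (rankN i n) L. Sigma_inv i (rankN i n) l = l}"

end

(*
Write v(l) for the last row of A(l) and u(l) for its first column. At z = 1/L the matrix M_L(l, z) has
rank one, namely u(l) v(l)^T / L. Evaluating M_L(l, z) M_K(m, z) = M_K(l', z) M_L(m', z) at z = 1/L thus
shows that v(m') is proportional to v(l) M_K(m, 1/L), and reflecting in the antidiagonal determines l'
in the same way from z = 1/K. A point is recovered from its row vector v, and the vectors that occur
are the generic isotropic vectors of a quadratic form that every M(l, z) preserves up to the factor
(1 - L z)^2. Conversely, for L and K distinct, the l' and m' so defined satisfy
M_K(l')^{-1} M_L(l) M_K(m) M_L(m')^{-1} = T with T constant: the pairing of matrices with equal row space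
has double zeros, which cancel the poles, and the degrees are bounded. The values at z = 0 and the leading
coefficients are triangular, which forces T = 1. So R_LK is given by explicit regular maps on an open
set, with R_KL as inverse. For L = K the identity is a solution, and generically the only one.

The fixed-point varieties are cut out by linear conditions on v(l), and these are inherited by
v(l) M_K(m, 1/L). Hence the map respects the varieties wherever the explicit formula applies, and by
closedness on the whole domain. The formula applies on a dense subset of X x X: the conditions for this
are conditions on v(l) and its image under an invertible similitude, and any two isotropic vectors of the
linear space in question are joined by a conic of isotropic vectors, along which a generic condition
satisfied at one end persists near the other.
*)

theory Submission imports Defs begin

section \<open>Regular functions and rational maps\<close>

text \<open>A dense open subset of the ambient product may miss a subvariety, or one of its
  components, so genericity has to be established inside X x X, near every point. Row vectors make
  this feasible: Sigma_2 and Sigma_4 are complicated in the coordinates, but their fixed points are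
  described by pairing the entries of v(l) with ratio c, where c is a square root of L. Each root
  contributes its own linear space. These spaces are totally isotropic, whereas for i = 1, 3 a
  quadric remains inside the linear space, and a curve on it has to be constructed.

  The far end of that curve is chosen as a preimage of v(l) itself under M_K(m, 1/L), so that its
  image is generic for free. This matrix is a similitude with factor (1 - K/L)^2 and hence
  invertible precisely for K distinct from L. For L = K it has rank one; there the map is recognised
  as the identity by extension from the ambient product.

  Nearness along curves is taken in the usual topology of the complex numbers: a polynomial that is
  nonzero at the limit is nonzero close to it, which suffices for Zariski density.\<close>

lemma openin_zariski_basis:
  assumes "openin zariski V" "p \<in> V"
  obtains g where "g \<in> polyfun" "g p \<noteq> 0" "{q. g q \<noteq> 0} \<subseteq> V"
proof -
  have "generate_topology_on {{p. f p \<noteq> 0} | f. f \<in> polyfun} V"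
    using assms(1) by (simp add: zariski_def openin_topology_generated_by_iff)
  then have "\<forall>p\<in>V. \<exists>g\<in>polyfun. g p \<noteq> 0 \<and> {q. g q \<noteq> 0} \<subseteq> V"
  proof induction
    case Empty
    then show ?case by simp
  next
    case (Int a b)
    show ?case
    proof
      fix p assume "p \<in> a \<inter> b"
      with Int obtain g h where "g \<in> polyfun" "g p \<noteq> 0" "{q. g q \<noteq> 0} \<subseteq> a"
        "h \<in> polyfun" "h p \<noteq> 0" "{q. h q \<noteq> 0} \<subseteq> b" by (meson IntD1 IntD2)
      then show "\<exists>g\<in>polyfun. g p \<noteq> 0 \<and> {q. g q \<noteq> 0} \<subseteq> a \<inter> b"
        by (intro bexI[of _ "\<lambda>p. g p * h p"]) (auto intro: polyfun.mult)
    qed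
  next
    case (UN S)
    then show ?case by (meson UnionE Union_upper order_trans)
  next
    case (Basis s)
    then show ?case by auto
  qed
  with assms(2) that show thesis by blast
qed

lemma openin_zariski_nonzero: "g \<in> polyfun \<Longrightarrow> openin zariski {q. g q \<noteq> 0}"
  unfolding zariski_def by (rule topology_generated_by_Basis) blast

lemma topspace_zariski [simp]: "topspace zariski = UNIV"
proof -
  have "openin zariski {q. (\<lambda>_. 1 :: complex) q \<noteq> 0}"
    by (rule openin_zariski_nonzero) (rule polyfun.const)
  then show ?thesis using openin_subset by fastforce
qed

text \<open>Principal open sets form a basis, so openness can be tested with one polynomial per
  point. All later arguments use this form and \<open>zdense_iff\<close> instead of the topology
  itself.\<close>

lemma zopen_iff:
  "zopen X U \<longleftrightarrow> U \<subseteq> X \<and>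
     (\<forall>p\<in>U. \<exists>g\<in>polyfun. g p \<noteq> 0 \<and> (\<forall>q\<in>X. g q \<noteq> 0 \<longrightarrow> q \<in> U))"
proof
  assume "zopen X U"
  then obtain V where V: "openin zariski V" "U = V \<inter> X"
    unfolding zopen_def openin_subtopology by blast
  have "\<exists>g\<in>polyfun. g p \<noteq> 0 \<and> (\<forall>q\<in>X. g q \<noteq> 0 \<longrightarrow> q \<in> U)" if "p \<in> U" for p
  proof -
    from that V have "p \<in> V" by simp
    then obtain g where "g \<in> polyfun" "g p \<noteq> 0" "{q. g q \<noteq> 0} \<subseteq> V"
      by (rule openin_zariski_basis[OF V(1)])
    then show ?thesis using V by blast
  qed
  with V show "U \<subseteq> X \<and> (\<forall>p\<in>U. \<exists>g\<in>polyfun. g p \<noteq> 0 \<and> (\<forall>q\<in>X. g q \<noteq> 0 \<longrightarrow> q \<in> U))"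
    by blast
next
  assume *: "U \<subseteq> X \<and> (\<forall>p\<in>U. \<exists>g\<in>polyfun. g p \<noteq> 0 \<and> (\<forall>q\<in>X. g q \<noteq> 0 \<longrightarrow> q \<in> U))"
  then obtain g where g: "\<And>p. p \<in> U \<Longrightarrow> g p \<in> polyfun \<and> g p p \<noteq> 0 \<and> (\<forall>q\<in>X. g p q \<noteq> 0 \<longrightarrow> q \<in> U)"
    by metis
  have "openin zariski (\<Union>p\<in>U. {q. g p q \<noteq> 0})"
    using g by (intro openin_clauses(3)) (auto intro: openin_zariski_nonzero)
  moreover have "U = (\<Union>p\<in>U. {q. g p q \<noteq> 0}) \<inter> X" using g * by blast
  ultimately show "zopen X U" unfolding zopen_def openin_subtopology by blast
qed

lemma zopen_subset: "zopen X U \<Longrightarrow> U \<subseteq> X"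
  by (simp add: zopen_iff)

lemma zopenE:
  assumes "zopen X U" "p \<in> U"
  obtains g where "g \<in> polyfun" "g p \<noteq> 0" "\<forall>q\<in>X. g q \<noteq> 0 \<longrightarrow> q \<in> U"
  using assms unfolding zopen_iff by blast

lemma zopen_self [simp]: "zopen X X"
  unfolding zopen_iff by (auto intro!: bexI[OF _ polyfun.const[of 1]])

lemma zopen_Int:
  assumes "zopen X U" "zopen X V" shows "zopen X (U \<inter> V)"
  using assms unfolding zopen_def by (rule openin_Int)

lemma zopen_restrict:
  assumes "zopen X U" "Y \<subseteq> X" shows "zopen Y (U \<inter> Y)"
proof -
  obtain V where "openin zariski V" "U = V \<inter> X"
    using assms(1) unfolding zopen_def openin_subtopology by blast
  then have "openin zariski V \<and> U \<inter> Y = V \<inter> Y" using assms(2) by blast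
  then show ?thesis unfolding zopen_def openin_subtopology by blast
qed

lemma zdense_iff:
  "zdense X U \<longleftrightarrow> U \<subseteq> X \<and> (\<forall>p\<in>X. \<forall>g\<in>polyfun. g p \<noteq> 0 \<longrightarrow> (\<exists>q\<in>U. g q \<noteq> 0))"
proof -
  have "subtopology zariski X closure_of U = X \<longleftrightarrow>
      (\<forall>p\<in>X. \<forall>g\<in>polyfun. g p \<noteq> 0 \<longrightarrow> (\<exists>q\<in>U. g q \<noteq> 0))" if "U \<subseteq> X"
  proof
    assume L: "subtopology zariski X closure_of U = X"
    show "\<forall>p\<in>X. \<forall>g\<in>polyfun. g p \<noteq> 0 \<longrightarrow> (\<exists>q\<in>U. g q \<noteq> 0)"
    proof (intro ballI impI)
      fix p g assume "p \<in> X" "g \<in> polyfun" "g p \<noteq> 0"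
      then have "zopen X ({q. g q \<noteq> 0} \<inter> X)" "p \<in> {q. g q \<noteq> 0} \<inter> X"
        unfolding zopen_def by (auto simp: openin_subtopology intro: openin_zariski_nonzero)
      moreover have "p \<in> subtopology zariski X closure_of U" using L \<open>p \<in> X\<close> by simp
      ultimately obtain y where "y \<in> U" "y \<in> {q. g q \<noteq> 0} \<inter> X"
        unfolding zopen_def in_closure_of by meson
      then show "\<exists>q\<in>U. g q \<noteq> 0" by blast
    qed
  next
    assume R: "\<forall>p\<in>X. \<forall>g\<in>polyfun. g p \<noteq> 0 \<longrightarrow> (\<exists>q\<in>U. g q \<noteq> 0)"
    have "p \<in> subtopology zariski X closure_of U" if "p \<in> X" for p
      unfolding in_closure_of
    proof (intro conjI allI impI)
      show "p \<in> topspace (subtopology zariski X)" using that by simp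
      fix T assume T: "p \<in> T \<and> openin (subtopology zariski X) T"
      then have "zopen X T" "p \<in> T" unfolding zopen_def by auto
      then obtain g where "g \<in> polyfun" "g p \<noteq> 0" "\<forall>q\<in>X. g q \<noteq> 0 \<longrightarrow> q \<in> T"
        by (rule zopenE)
      then show "\<exists>y. y \<in> U \<and> y \<in> T" using R that \<open>U \<subseteq> X\<close> by blast
    qed
    moreover have "subtopology zariski X closure_of U \<subseteq> X"
      using closure_of_subset_topspace[of "subtopology zariski X" U] by simp
    ultimately show "subtopology zariski X closure_of U = X" by blast
  qed
  then show ?thesis unfolding zdense_def by blast
qed

lemma zdenseE:
  assumes "zdense X U" "g \<in> polyfun" "p \<in> X" "g p \<noteq> 0"
  obtains q where "q \<in> U" "g q \<noteq> 0"
  using assms unfolding zdense_iff by blast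

lemma zdense_subset: "zdense X U \<Longrightarrow> U \<subseteq> X"
  by (simp add: zdense_def)

lemma zdense_self [simp]: "zdense X X"
  unfolding zdense_iff by blast

lemma zdense_mono: "zdense X U \<Longrightarrow> U \<subseteq> V \<Longrightarrow> V \<subseteq> X \<Longrightarrow> zdense X V"
  unfolding zdense_iff by blast

section \<open>Regular functions as local quotients of polynomials\<close>

lemma regular_fun_iff:
  assumes "W \<subseteq> X"
  shows "regular_fun X W f \<longleftrightarrow>
     (\<forall>p\<in>W. \<exists>a\<in>polyfun. \<exists>b\<in>polyfun. b p \<noteq> 0 \<and> (\<forall>q\<in>X. b q \<noteq> 0 \<longrightarrow> q \<in> W \<and> f q = a q / b q))"
proof
  assume L: "regular_fun X W f"
  show "\<forall>p\<in>W. \<exists>a\<in>polyfun. \<exists>b\<in>polyfun. b p \<noteq> 0 \<and> (\<forall>q\<in>X. b q \<noteq> 0 \<longrightarrow> q \<in> W \<and> f q = a q / b q)"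
  proof
    fix p assume "p \<in> W"
    with L obtain V a b where V: "zopen X V" "p \<in> V" "V \<subseteq> W" "a \<in> polyfun" "b \<in> polyfun"
      "\<forall>q\<in>V. b q \<noteq> 0 \<and> f q = a q / b q" unfolding regular_fun_def by meson
    \<comment> \<open>Multiplying \<open>a\<close> and \<open>b\<close> by \<open>g\<close> shrinks
      the neighbourhood to the locus where the denominator is nonzero, so that no separate open set
      has to be carried along.\<close>
    obtain g where "g \<in> polyfun" "g p \<noteq> 0" "\<forall>q\<in>X. g q \<noteq> 0 \<longrightarrow> q \<in> V"
      by (rule zopenE[OF V(1,2)])
    with V show "\<exists>a\<in>polyfun. \<exists>b\<in>polyfun. b p \<noteq> 0 \<and> (\<forall>q\<in>X. b q \<noteq> 0 \<longrightarrow> q \<in> W \<and> f q = a q / b q)"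
      by (intro bexI[of _ "\<lambda>q. a q * g q"] bexI[of _ "\<lambda>q. b q * g q"])
         (auto intro: polyfun.mult)
  qed
next
  assume R: "\<forall>p\<in>W. \<exists>a\<in>polyfun. \<exists>b\<in>polyfun. b p \<noteq> 0 \<and> (\<forall>q\<in>X. b q \<noteq> 0 \<longrightarrow> q \<in> W \<and> f q = a q / b q)"
  show "regular_fun X W f"
    unfolding regular_fun_def
  proof
    fix p assume p: "p \<in> W"
    with R obtain a b where ab: "a \<in> polyfun" "b \<in> polyfun" "b p \<noteq> 0"
      "\<forall>q\<in>X. b q \<noteq> 0 \<longrightarrow> q \<in> W \<and> f q = a q / b q" by blast
    have "zopen X ({q. b q \<noteq> 0} \<inter> X)"
      unfolding zopen_def openin_subtopology using ab openin_zariski_nonzero by blast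
    then show "\<exists>V a b. zopen X V \<and> p \<in> V \<and> V \<subseteq> W \<and> a \<in> polyfun \<and> b \<in> polyfun \<and>
        (\<forall>q\<in>V. b q \<noteq> 0 \<and> f q = a q / b q)"
      using ab p assms by (intro exI[of _ "{q. b q \<noteq> 0} \<inter> X"] exI[of _ a] exI[of _ b]) auto
  qed
qed

lemma regular_fun_cong:
  assumes "\<And>p. p \<in> W \<Longrightarrow> f p = g p" shows "regular_fun X W f \<longleftrightarrow> regular_fun X W g"
proof -
  have "(\<forall>q\<in>V. b q \<noteq> 0 \<and> f q = a q / b q) \<longleftrightarrow> (\<forall>q\<in>V. b q \<noteq> 0 \<and> g q = a q / b q)"
    if "V \<subseteq> W" for V a b
    using that assms by (intro ball_cong) auto
  then show ?thesis unfolding regular_fun_def by (auto cong: conj_cong)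
qed

lemma regular_funE:
  assumes "regular_fun X W f" "W \<subseteq> X" "p \<in> W"
  obtains a b where "a \<in> polyfun" "b \<in> polyfun" "b p \<noteq> 0"
    "\<forall>q\<in>X. b q \<noteq> 0 \<longrightarrow> q \<in> W \<and> f q = a q / b q"
  using assms unfolding regular_fun_iff[OF assms(2)] by blast

lemma regular_polyfun:
  assumes "zopen X W" "f \<in> polyfun" shows "regular_fun X W f"
  unfolding regular_fun_iff[OF zopen_subset[OF assms(1)]]
proof
  fix p assume "p \<in> W"
  then obtain g where "g \<in> polyfun" "g p \<noteq> 0" "\<forall>q\<in>X. g q \<noteq> 0 \<longrightarrow> q \<in> W"
    by (rule zopenE[OF assms(1)])
  then show "\<exists>a\<in>polyfun. \<exists>b\<in>polyfun. b p \<noteq> 0 \<and> (\<forall>q\<in>X. b q \<noteq> 0 \<longrightarrow> q \<in> W \<and> f q = a q / b q)"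
    by (intro bexI[of _ "\<lambda>q. f q * g q"] bexI[of _ g]) (auto intro: polyfun.mult assms)
qed

lemma regular_const: assumes "zopen X W" shows "regular_fun X W (\<lambda>_. c)"
  by (rule regular_polyfun[OF assms polyfun.const])

lemma regular_add:
  assumes "W \<subseteq> X" "regular_fun X W f" "regular_fun X W g"
  shows "regular_fun X W (\<lambda>p. f p + g p)"
  unfolding regular_fun_iff[OF assms(1)]
proof
  fix p assume p: "p \<in> W"
  obtain a b where ab: "a \<in> polyfun" "b \<in> polyfun" "b p \<noteq> 0"
    "\<forall>q\<in>X. b q \<noteq> 0 \<longrightarrow> q \<in> W \<and> f q = a q / b q"
    by (rule regular_funE[OF assms(2,1) p])
  obtain a' b' where ab': "a' \<in> polyfun" "b' \<in> polyfun" "b' p \<noteq> 0"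
    "\<forall>q\<in>X. b' q \<noteq> 0 \<longrightarrow> q \<in> W \<and> g q = a' q / b' q"
    by (rule regular_funE[OF assms(3,1) p])
  have "(\<lambda>q. a q * b' q + a' q * b q) \<in> polyfun" "(\<lambda>q. b q * b' q) \<in> polyfun"
    by (intro polyfun.add polyfun.mult ab(1,2) ab'(1,2))+
  then show "\<exists>a\<in>polyfun. \<exists>b\<in>polyfun. b p \<noteq> 0 \<and>
      (\<forall>q\<in>X. b q \<noteq> 0 \<longrightarrow> q \<in> W \<and> f q + g q = a q / b q)"
    using ab(3,4) ab'(3,4)
    by (intro bexI[of _ "\<lambda>q. a q * b' q + a' q * b q"] bexI[of _ "\<lambda>q. b q * b' q"])
       (auto simp: add_frac_eq)
qed

lemma regular_mult:
  assumes "W \<subseteq> X" "regular_fun X W f" "regular_fun X W g"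
  shows "regular_fun X W (\<lambda>p. f p * g p)"
  unfolding regular_fun_iff[OF assms(1)]
proof
  fix p assume p: "p \<in> W"
  obtain a b where ab: "a \<in> polyfun" "b \<in> polyfun" "b p \<noteq> 0"
    "\<forall>q\<in>X. b q \<noteq> 0 \<longrightarrow> q \<in> W \<and> f q = a q / b q"
    by (rule regular_funE[OF assms(2,1) p])
  obtain a' b' where ab': "a' \<in> polyfun" "b' \<in> polyfun" "b' p \<noteq> 0"
    "\<forall>q\<in>X. b' q \<noteq> 0 \<longrightarrow> q \<in> W \<and> g q = a' q / b' q"
    by (rule regular_funE[OF assms(3,1) p])
  have "(\<lambda>q. a q * a' q) \<in> polyfun" "(\<lambda>q. b q * b' q) \<in> polyfun"
    by (intro polyfun.mult ab(1,2) ab'(1,2))+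
  then show "\<exists>a\<in>polyfun. \<exists>b\<in>polyfun. b p \<noteq> 0 \<and>
      (\<forall>q\<in>X. b q \<noteq> 0 \<longrightarrow> q \<in> W \<and> f q * g q = a q / b q)"
    using ab(3,4) ab'(3,4)
    by (intro bexI[of _ "\<lambda>q. a q * a' q"] bexI[of _ "\<lambda>q. b q * b' q"]) auto
qed

lemma regular_inverse:
  assumes "W \<subseteq> X" "regular_fun X W f" "\<And>p. p \<in> W \<Longrightarrow> f p \<noteq> 0"
  shows "regular_fun X W (\<lambda>p. 1 / f p)"
  unfolding regular_fun_iff[OF assms(1)]
proof
  fix p assume p: "p \<in> W"
  obtain a b where *: "a \<in> polyfun" "b \<in> polyfun" "b p \<noteq> 0"
    "\<forall>q\<in>X. b q \<noteq> 0 \<longrightarrow> q \<in> W \<and> f q = a q / b q"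
    by (rule regular_funE[OF assms(2,1) p])
  have "a p \<noteq> 0" using *(3) bspec[OF *(4), of p] assms(3)[OF p] assms(1) p by auto
  then show "\<exists>a\<in>polyfun. \<exists>b\<in>polyfun. b p \<noteq> 0 \<and>
      (\<forall>q\<in>X. b q \<noteq> 0 \<longrightarrow> q \<in> W \<and> 1 / f q = a q / b q)"
    using * by (intro bexI[of _ "\<lambda>q. b q * b q"] bexI[of _ "\<lambda>q. b q * a q"])
       (auto intro: polyfun.mult)
qed

lemma regular_divide:
  assumes "W \<subseteq> X" "regular_fun X W f" "regular_fun X W g" "\<And>p. p \<in> W \<Longrightarrow> g p \<noteq> 0"
  shows "regular_fun X W (\<lambda>p. f p / g p)"
  using regular_mult[OF assms(1,2) regular_inverse[OF assms(1,3,4)]] by simp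

lemma regular_diff:
  assumes "W \<subseteq> X" "regular_fun X W f" "regular_fun X W g" "zopen X W"
  shows "regular_fun X W (\<lambda>p. f p - g p)"
  using regular_add[OF assms(1,2) regular_mult[OF assms(1) regular_const[OF assms(4), where c = "-1"] assms(3)]]
  by simp

lemma regular_sum:
  assumes "zopen X W" "\<And>i. i \<in> I \<Longrightarrow> regular_fun X W (f i)"
  shows "regular_fun X W (\<lambda>p. \<Sum>i\<in>I. f i p)"
  using assms(2)
  by (induction I rule: infinite_finite_induct)
     (auto intro!: regular_add zopen_subset[OF assms(1)] regular_const[OF assms(1)])

lemma regular_prod:
  assumes "zopen X W" "\<And>i. i \<in> I \<Longrightarrow> regular_fun X W (f i)"
  shows "regular_fun X W (\<lambda>p. \<Prod>i\<in>I. f i p)"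
  using assms(2)
  by (induction I rule: infinite_finite_induct)
     (auto intro!: regular_mult zopen_subset[OF assms(1)] regular_const[OF assms(1)])

lemma regular_restrict:
  assumes "regular_fun X W f" "W \<subseteq> X" "Y \<subseteq> X" shows "regular_fun Y (W \<inter> Y) f"
proof -
  have "W \<inter> Y \<subseteq> Y" by blast
  show ?thesis
    unfolding regular_fun_iff[OF \<open>W \<inter> Y \<subseteq> Y\<close>]
  proof
    fix p assume "p \<in> W \<inter> Y"
    then have "p \<in> W" by simp
    then obtain a b where "a \<in> polyfun" "b \<in> polyfun" "b p \<noteq> 0"
      "\<forall>q\<in>X. b q \<noteq> 0 \<longrightarrow> q \<in> W \<and> f q = a q / b q"
      by (rule regular_funE[OF assms(1,2)])
    then show "\<exists>a\<in>polyfun. \<exists>b\<in>polyfun. b p \<noteq> 0 \<and>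
        (\<forall>q\<in>Y. b q \<noteq> 0 \<longrightarrow> q \<in> W \<inter> Y \<and> f q = a q / b q)"
      using assms(3) by (intro bexI[of _ a] bexI[of _ b]) auto
  qed
qed

lemma regular_open_subset:
  assumes "regular_fun X W f" "W \<subseteq> X" "zopen X V" "V \<subseteq> W"
  shows "regular_fun X V f"
  unfolding regular_fun_iff[OF zopen_subset[OF assms(3)]]
proof (intro ballI)
  fix p assume p: "p \<in> V"
  obtain a b where *: "a \<in> polyfun" "b \<in> polyfun" "b p \<noteq> 0"
    "\<forall>q\<in>X. b q \<noteq> 0 \<longrightarrow> q \<in> W \<and> f q = a q / b q"
    by (rule regular_funE[OF assms(1,2) subsetD[OF assms(4) p]])
  obtain g where "g \<in> polyfun" "g p \<noteq> 0" "\<forall>q\<in>X. g q \<noteq> 0 \<longrightarrow> q \<in> V"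
    by (rule zopenE[OF assms(3) p])
  with * show "\<exists>a\<in>polyfun. \<exists>b\<in>polyfun. b p \<noteq> 0 \<and> (\<forall>q\<in>X. b q \<noteq> 0 \<longrightarrow> q \<in> V \<and> f q = a q / b q)"
    by (intro bexI[of _ "\<lambda>q. a q * g q"] bexI[of _ "\<lambda>q. b q * g q"])
         (auto intro: polyfun.mult)
qed

lemma zopen_regular_nonzero:
  assumes "regular_fun X W f" "W \<subseteq> X" shows "zopen X {p\<in>W. f p \<noteq> 0}"
  unfolding zopen_iff
proof (intro conjI ballI)
  show "{p\<in>W. f p \<noteq> 0} \<subseteq> X" using assms by blast
  fix p assume p: "p \<in> {p\<in>W. f p \<noteq> 0}"
  then have "p \<in> W" by simp
  then obtain a b where *: "a \<in> polyfun" "b \<in> polyfun" "b p \<noteq> 0"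
    "\<forall>q\<in>X. b q \<noteq> 0 \<longrightarrow> q \<in> W \<and> f q = a q / b q"
    by (rule regular_funE[OF assms])
  have "a p \<noteq> 0" using *(3) bspec[OF *(4), of p] assms(2) p by auto
  with * show "\<exists>g\<in>polyfun. g p \<noteq> 0 \<and> (\<forall>q\<in>X. g q \<noteq> 0 \<longrightarrow> q \<in> {p \<in> W. f p \<noteq> 0})"
    by (intro bexI[of _ "\<lambda>q. a q * b q"]) (auto intro: polyfun.mult)
qed

lemma regular_eq_on_dense:
  assumes "regular_fun X W f" "regular_fun X W g" "W \<subseteq> X" "zopen X W" "zdense W D"
    and "\<And>q. q \<in> D \<Longrightarrow> f q = g q" and "p \<in> W"
  shows "f p = g p"
proof (rule ccontr)
  assume "f p \<noteq> g p"
  define h where "h = (\<lambda>q. f q - g q)"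
  have "regular_fun X W h" unfolding h_def using regular_diff assms by blast
  then have "zopen X {p\<in>W. h p \<noteq> 0}" using zopen_regular_nonzero assms(3) by blast
  moreover have "p \<in> {p\<in>W. h p \<noteq> 0}" using assms(7) \<open>f p \<noteq> g p\<close> h_def by simp
  ultimately obtain k where k: "k \<in> polyfun" "k p \<noteq> 0" "\<forall>q\<in>X. k q \<noteq> 0 \<longrightarrow> q \<in> {p\<in>W. h p \<noteq> 0}"
    by (rule zopenE)
  obtain q where q: "q \<in> D" "k q \<noteq> 0" by (rule zdenseE[OF assms(5) k(1) assms(7) k(2)])
  then have "h q \<noteq> 0" using bspec[OF k(3), of q] zdense_subset[OF assms(5)] assms(3) by auto
  then show False using assms(6) q h_def by simp
qed

text \<open>Two dense sets may be disjoint; openness of \<open>D1\<close> prevents this. Density of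
  \<open>D1\<close> yields a point of it close to \<open>p\<close>, and density of \<open>D2\<close>
  is then applied in a neighbourhood of that point inside \<open>D1\<close>.\<close>

lemma zdense_Int:
  assumes "zopen X W1" "zopen X W2" "zopen X D1" "zdense W1 D1" "zdense W2 D2"
  shows "zdense (W1 \<inter> W2) (D1 \<inter> D2)"
  unfolding zdense_iff
proof (intro conjI ballI impI)
  show "D1 \<inter> D2 \<subseteq> W1 \<inter> W2"
    using zdense_subset[OF assms(4)] zdense_subset[OF assms(5)] by blast
  fix p g assume p: "p \<in> W1 \<inter> W2" and g: "g \<in> polyfun" "g p \<noteq> 0"
  obtain h where h: "h \<in> polyfun" "h p \<noteq> 0" "\<forall>q\<in>X. h q \<noteq> 0 \<longrightarrow> q \<in> W1 \<inter> W2"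
    by (rule zopenE[OF zopen_Int[OF assms(1,2)] p])
  have gh: "(\<lambda>q. g q * h q) \<in> polyfun" by (intro polyfun.mult g(1) h(1))
  obtain q1 where q1: "q1 \<in> D1" "g q1 * h q1 \<noteq> 0"
    using zdenseE[OF assms(4) gh, of p] p g h by auto
  obtain k where k: "k \<in> polyfun" "k q1 \<noteq> 0" "\<forall>q\<in>X. k q \<noteq> 0 \<longrightarrow> q \<in> D1"
    by (rule zopenE[OF assms(3) q1(1)])
  have "q1 \<in> X" using zopen_subset[OF assms(3)] q1(1) by blast
  then have "q1 \<in> W2" using bspec[OF h(3), of q1] q1 by auto
  have ghk: "(\<lambda>q. g q * h q * k q) \<in> polyfun" by (intro polyfun.mult g(1) h(1) k(1))
  obtain q2 where q2: "q2 \<in> D2" "g q2 * h q2 * k q2 \<noteq> 0"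
    using zdenseE[OF assms(5) ghk \<open>q1 \<in> W2\<close>] q1 k by auto
  moreover have "q2 \<in> X"
    using q2 zdense_subset[OF assms(5)] zopen_subset[OF assms(2)] by blast
  ultimately show "\<exists>q\<in>D1 \<inter> D2. g q \<noteq> 0" using bspec[OF k(3), of q2] by auto
qed

section \<open>Values of a rational map on its maximal domain\<close>

lemma regular_map_open_subset:
  assumes "regular_map X W F" "W \<subseteq> X" "zopen X V" "V \<subseteq> W"
  shows "regular_map X V F"
  using assms(1) regular_open_subset[OF _ assms(2-4)] unfolding regular_map_def by blast

text \<open>Two local representatives agree with \<open>s\<close> on a common dense subset of the
  intersection of their domains, hence they coincide there. This justifies the \<open>THE\<close> in
  \<open>rational_closure\<close>.\<close>

lemma rational_value_unique:
  assumes "rational_value X Y s p y1" "rational_value X Y s p y2"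
  shows "y1 = y2"
proof -
  obtain W1 D1 F1 where 1: "zopen X W1" "p \<in> W1" "regular_map X W1 F1" "zopen X D1" "zdense W1 D1"
    "\<forall>q\<in>D1. s q = Some (F1 q)" "y1 = F1 p"
    using assms(1) unfolding rational_value_def by blast
  obtain W2 D2 F2 where 2: "zopen X W2" "p \<in> W2" "regular_map X W2 F2" "zopen X D2" "zdense W2 D2"
    "\<forall>q\<in>D2. s q = Some (F2 q)" "y2 = F2 p"
    using assms(2) unfolding rational_value_def by blast
  let ?W = "W1 \<inter> W2" and ?D = "D1 \<inter> D2"
  have W: "zopen X ?W" using 1 2 zopen_Int by blast
  have R: "regular_map X ?W F1" "regular_map X ?W F2"
    using regular_map_open_subset[OF 1(3) zopen_subset[OF 1(1)] W]
      regular_map_open_subset[OF 2(3) zopen_subset[OF 2(1)] W] by auto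
  have D: "zdense ?W ?D" using zdense_Int[OF 1(1) 2(1) 1(4,5) 2(5)] .
  have eq: "F1 q = F2 q" if "q \<in> ?D" for q using 1(6) 2(6) that by force
  have p: "p \<in> ?W" using 1(2) 2(2) by blast
  have "fst (F1 p) k = fst (F2 p) k" for k
    by (rule regular_eq_on_dense[OF _ _ zopen_subset[OF W] W D _ p])
      (use R eq in \<open>simp_all add: regular_map_def\<close>)
  moreover have "snd (F1 p) k = snd (F2 p) k" for k
    by (rule regular_eq_on_dense[OF _ _ zopen_subset[OF W] W D _ p])
      (use R eq in \<open>simp_all add: regular_map_def\<close>)
  ultimately have "F1 p = F2 p" by (simp add: prod_eq_iff fun_eq_iff)
  then show ?thesis using 1 2 by simp
qed

lemma rational_closure_eq_Some_iff:
  "rational_closure X Y s p = Some y \<longleftrightarrow> rational_value X Y s p y"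
proof (cases "\<exists>y. rational_value X Y s p y")
  case True
  then obtain z where z: "rational_value X Y s p z" ..
  then have "(THE y. rational_value X Y s p y) = z"
    by (intro the_equality rational_value_unique[OF _ z])
  then have "rational_closure X Y s p = Some z"
    using True unfolding rational_closure_def by simp
  moreover have "z = y \<longleftrightarrow> rational_value X Y s p y"
    using z rational_value_unique[OF z, of y] by iprover
  ultimately show ?thesis by (simp only: option.inject)
next
  case False
  then have "rational_closure X Y s p = None"
    unfolding rational_closure_def by (rule if_not_P)
  then show ?thesis using False by (simp only: option.distinct) iprover
qed

lemma rational_closure_on:
  assumes "zopen X W" "regular_map X W F" "F ` W \<subseteq> Y" "zopen X D" "zdense W D"
    "\<And>q. q \<in> D \<Longrightarrow> s q = Some (F q)" "p \<in> W"
  shows "rational_closure X Y s p = Some (F p)"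
  unfolding rational_closure_eq_Some_iff rational_value_def
  by (intro exI[of _ W] exI[of _ D] exI[of _ F]) (use assms in simp)

text \<open>A local representative gives the value at every point of its neighbourhood, not only at
  \<open>p\<close>. Openness of the domain and regularity of the map both rest on this.\<close>

lemma rational_closure_cases:
  assumes "rational_closure X Y s p = Some y"
  obtains W F where "zopen X W" "p \<in> W" "regular_map X W F" "F ` W \<subseteq> Y"
    "\<And>q. q \<in> W \<Longrightarrow> rational_closure X Y s q = Some (F q)"
proof -
  obtain W D F where *: "zopen X W" "p \<in> W" "regular_map X W F" "F ` W \<subseteq> Y"
        "zopen X D" "zdense W D" "\<forall>q\<in>D. s q = Some (F q)"
    using assms unfolding rational_closure_eq_Some_iff rational_value_def by blast
  have "rational_closure X Y s q = Some (F q)" if "q \<in> W" for q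
    using *(7) by (intro rational_closure_on[OF *(1,3,4,5,6) _ that]) auto
  with * show thesis by (intro that)
qed

section \<open>The matrices \<open>A\<close> and \<open>M\<close>\<close>

locale D_rank =
  fixes N :: nat
  assumes N4: "4 \<le> N"
begin

definition rv :: "nat \<Rightarrow> nat" where "rv i = 2 * N + 1 - i"

text \<open>Signs of the antidiagonal form. They are symmetric under \<open>rv\<close>, which makes
  the form quadratic and not symplectic.\<close>

definition sg :: "nat \<Rightarrow> complex" where
  "sg i = (-1) ^ (if i \<le> N then i else rv i)"

abbreviation lb :: "pt \<Rightarrow> nat \<Rightarrow> complex" where "lb \<equiv> bar N"

definition P :: "pt \<Rightarrow> nat \<Rightarrow> complex" where "P l k = (\<Prod>i=1..k. l i)"
definition Q :: "pt \<Rightarrow> nat \<Rightarrow> complex" where "Q l k = (\<Prod>i=1..k. lb l i)"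

definition u :: "pt \<Rightarrow> nat \<Rightarrow> complex" where "u l i = A_entry N l i 1"
definition v :: "pt \<Rightarrow> nat \<Rightarrow> complex" where "v l j = A_entry N l (2 * N) j"

text \<open>The involution with \<open>M(dual l)\<close> the reflection of \<open>M(l)\<close> in the antidiagonal; up to the signs \<open>sg\<close>,
  it is \<open>(1 - L z)\<^sup>2\<close> times the inverse of \<open>M(l)\<close>.\<close>

definition dual :: "pt \<Rightarrow> pt" where
  "dual l = mk_pt N ((lb l)(N - 1 := lb l (N - 1) * l N, N := 1 / l N))
                    (l(N - 1 := l (N - 1) * l N))"

text \<open>The deviation of \<open>A\<close>, on and below the diagonal, from the rank-one matrix
  with entries \<open>u l i * v l j / L\<close>. The indices 1, N, N+1 and 2N are
  exceptional.\<close>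

definition D :: "nat \<Rightarrow> nat \<Rightarrow> complex" where
  "D i j = (if i = j \<and> 1 < i \<and> i < 2 * N \<and> i \<noteq> N \<and> i \<noteq> N + 1 \<or> i = N + 1 \<and> j = N then 1 else 0)"

section \<open>Partial products and the entries of A\<close>

lemma BD_nonzero: "l \<in> BD N L \<Longrightarrow> 1 \<le> k \<Longrightarrow> k < 2 * N \<Longrightarrow> l k \<noteq> 0"
  unfolding BD_def by (auto simp: PiE_iff)

lemma BD_bar_nonzero: "l \<in> BD N L \<Longrightarrow> 1 \<le> k \<Longrightarrow> k < 2 * N \<Longrightarrow> lb l k \<noteq> 0"
  using BD_nonzero[of l L "2 * N - k"] by (auto simp: bar_def)

lemma P_nonzero: assumes "l \<in> BD N L" "k \<le> N" shows "P l k \<noteq> 0"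
proof -
  have "l i \<noteq> 0" if "i \<in> {1..k}" for i
    using that assms(2) N4 by (intro BD_nonzero[OF assms(1)]) auto
  then show ?thesis unfolding P_def by (simp add: prod_zero_iff)
qed

lemma Q_nonzero: assumes "l \<in> BD N L" "k \<le> N" shows "Q l k \<noteq> 0"
proof -
  have "lb l i \<noteq> 0" if "i \<in> {1..k}" for i
    using that assms(2) N4 by (intro BD_bar_nonzero[OF assms(1)]) auto
  then show ?thesis unfolding Q_def by (simp add: prod_zero_iff)
qed

lemma prod_all: "(\<Prod>k=1..2*N-1. l k) = P l N * Q l (N - 1)"
proof -
  have "{1..2*N-1} = {1..N} \<union> {N+1..2*N-1}" using N4 by auto
  then have "(\<Prod>k=1..2*N-1. l k) = P l N * (\<Prod>k=N+1..2*N-1. l k)"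
    by (simp add: P_def prod.union_disjoint)
  also have "(\<Prod>k=N+1..2*N-1. l k) = Q l (N - 1)"
    unfolding Q_def bar_def
    by (rule prod.reindex_bij_witness[where i = "\<lambda>k. 2 * N - k" and j = "\<lambda>k. 2 * N - k"])
       (use N4 in auto)
  finally show ?thesis .
qed

lemma BD_prod: "l \<in> BD N L \<Longrightarrow> P l N * Q l (N - 1) = L"
  using prod_all[of l] by (simp add: BD_def)

lemma BD_param_nonzero: "l \<in> BD N L \<Longrightarrow> L \<noteq> 0"
  using BD_prod P_nonzero Q_nonzero by force

lemma P_0 [simp]: "P l 0 = 1" and Q_0 [simp]: "Q l 0 = 1"
  by (auto simp: P_def Q_def)

lemma P_step: "1 \<le> k \<Longrightarrow> P l k = P l (k - 1) * l k"
  unfolding P_def by (cases k) simp_all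

lemma Q_step: "1 \<le> k \<Longrightarrow> Q l k = Q l (k - 1) * lb l k"
  unfolding Q_def by (cases k) simp_all

lemma prod_P: assumes "1 \<le> j" "j \<le> i" shows "P l (j - 1) * (\<Prod>k=j..<i. l k) = P l (i - 1)"
proof -
  have "{1..i-1} = {1..j-1} \<union> {j..<i}" using assms by auto
  then show ?thesis unfolding P_def using assms by (subst prod.union_disjoint[symmetric]) auto
qed

lemma prod_Q: assumes "1 \<le> j" "j \<le> i" shows "Q l (j - 1) * (\<Prod>k=j..<i. lb l k) = Q l (i - 1)"
proof -
  have "{1..i-1} = {1..j-1} \<union> {j..<i}" using assms by auto
  then show ?thesis unfolding Q_def using assms by (subst prod.union_disjoint[symmetric]) auto
qed

lemma prod_P_closed: assumes "1 \<le> j" "j \<le> N" shows "P l (j - 1) * (\<Prod>k=j..N. l k) = P l N"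
  using prod_P[of j "Suc N" l] assms by (simp add: atLeastLessThanSuc_atLeastAtMost)

context
  fixes l L assumes l: "l \<in> BD N L"
begin

lemma L0: "L \<noteq> 0" by (rule BD_param_nonzero[OF l])

lemma prod_interval: "1 \<le> j \<Longrightarrow> j \<le> i \<Longrightarrow> i \<le> N + 1 \<Longrightarrow> (\<Prod>k=j..<i. l k) = P l (i - 1) / P l (j - 1)"
  using prod_P[of j i l] P_nonzero[OF l, of "j - 1"] by (simp add: field_simps)

lemma prod_interval_closed: "1 \<le> j \<Longrightarrow> j \<le> N \<Longrightarrow> (\<Prod>k=j..N. l k) = P l N / P l (j - 1)"
  using prod_P_closed[of j l] P_nonzero[OF l, of "j - 1"] by (simp add: field_simps)

lemma prod_bar_interval: "1 \<le> j \<Longrightarrow> j \<le> i \<Longrightarrow> i \<le> N + 1 \<Longrightarrow> (\<Prod>k=j..<i. lb l k) = Q l (i - 1) / Q l (j - 1)"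
  using prod_Q[of j i l] Q_nonzero[OF l, of "j - 1"] by (simp add: field_simps)

lemma PQ_total: "P l (N - 1) * l N * Q l (N - 1) = L" "P l N * Q l (N - 1) = L" "l N \<noteq> 0"
  using BD_prod[OF l] P_step[of N l] N4 BD_nonzero[OF l, of N] by auto

lemma v_low: assumes "1 \<le> j" "j \<le> N" shows "v l j = L / P l (j - 1)"
proof (cases "j = N")
  case True
  then show ?thesis
    using N4 PQ_total P_nonzero[OF l, of "N - 1"] prod_bar_interval[of 1 N]
    by (simp add: v_def A_entry_def Let_def field_simps)
next
  case False
  then have "v l j = (\<Prod>k=j..N. l k) * (\<Prod>k=1..<N. lb l k)"
    using assms N4 by (auto simp: v_def A_entry_def Let_def)
  then show ?thesis
    using assms N4 PQ_total prod_bar_interval[of 1 N] prod_interval_closed[of j] by simp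
qed

lemma v_mid: "v l (N + 1) = Q l (N - 1)"
  using N4 prod_bar_interval[of 1 N]
  by (simp add: v_def A_entry_def Let_def field_simps)

lemma v_high: assumes "1 < i" "i < N" shows "v l (rv i) = Q l (i - 1) * (1 + lb l i / l i)"
proof -
  have "v l (rv i) = (\<Prod>k=1..<i. lb l k) * (1 + lb l i / l i)"
    using assms N4 by (auto simp: v_def A_entry_def Let_def rv_def)
  then show ?thesis using assms prod_bar_interval[of 1 i] by simp
qed

lemma v_last: "v l (2 * N) = lb l 1 / l 1"
  using N4 by (simp add: v_def A_entry_def Let_def)

lemma v_first: "v l 1 = L"
  using v_low[of 1] N4 by simp

lemma u_low: assumes "1 < i" "i < N" shows "u l i = P l (i - 1) * (1 + l i / lb l i)"
  using assms prod_interval[of 1 i] by (simp add: u_def A_entry_def Let_def)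

lemma u_first: "u l 1 = l 1 / lb l 1"
  using N4 by (simp add: u_def A_entry_def Let_def)

lemma u_N: "u l N = P l N"
  using N4 prod_interval_closed[of 1] by (simp add: u_def A_entry_def Let_def)

lemma u_mid: "u l (N + 1) = P l (N - 1)"
  using N4 prod_interval[of 1 N] by (simp add: u_def A_entry_def Let_def)

lemma u_high: assumes "1 \<le> i" "i < N" shows "u l (rv i) = L / Q l (i - 1)"
proof -
  have "u l (rv i) = (\<Prod>k=1..N. l k) * (\<Prod>k=i..<N. lb l k)"
    using assms N4 by (auto simp: u_def A_entry_def Let_def rv_def)
  then show ?thesis
    using assms N4 PQ_total prod_bar_interval[of i N] prod_interval_closed[of 1] by simp
qed

lemma u_last: "u l (2 * N) = L"
  using u_high[of 1] N4 by (simp add: rv_def)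

lemma A_upper: assumes "1 \<le> i" "i < j" "j \<le> 2 * N" shows "A_entry N l i j = 0"
  using assms by (auto simp: A_entry_def Let_def)

text \<open>Every product over an interval is a quotient of partial products, so it splits into a
  factor for the row and one for the column. Only the diagonal and the entry (N+1, N) deviate from
  this, and \<open>D\<close> records the difference.\<close>

lemma A_lower:
  assumes "1 \<le> j" "j \<le> i" "i \<le> 2 * N"
  shows "A_entry N l i j = u l i * v l j / L - D i j"
proof -
  have nz: "P l (j - 1) \<noteq> 0" "Q l (j - 1) \<noteq> 0" if "j \<le> N + 1" for j
    using that P_nonzero[OF l] Q_nonzero[OF l] by auto
  have rr: "rv (rv k) = k" if "k \<le> 2 * N" for k using that by (simp add: rv_def)
  consider "i < N" | "i = N" | "i = N + 1" | "N + 1 < i" by linarith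
  then show ?thesis
  proof cases
    case 1
    then have v: "v l j = L / P l (j - 1)" using v_low assms by simp
    show ?thesis
    proof (cases "i = j")
      case True
      have "P l 0 = 1" by simp
      then show ?thesis
        using True v 1 assms u_low[of i] u_first nz[of i] L0 N4
        by (cases "i = 1") (simp_all add: A_entry_def Let_def D_def)
    next
      case False
      then have "A_entry N l i j = (\<Prod>k=j..<i. l k) * (1 + l i / lb l i)"
        using assms 1 by (simp add: A_entry_def Let_def)
      also have "\<dots> = u l i * v l j / L"
        using False 1 assms v u_low[of i] prod_interval[of j i] L0 by simp
      finally show ?thesis using False 1 by (simp add: D_def)
    qed
  next
    case 2
    then have v: "v l j = L / P l (j - 1)" using v_low assms by simp
    show ?thesis
    proof (cases "i = j")
      case True
      then have ij: "i = N" "j = N" using 2 by auto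
      show ?thesis
        using v u_N nz[of N] L0 N4 P_step[of N l] by (simp add: ij A_entry_def Let_def D_def)
    next
      case False
      then have "A_entry N l i j = (\<Prod>k=j..N. l k)"
        using assms 2 by (auto simp: A_entry_def Let_def)
      then show ?thesis
        using False 2 assms v u_N prod_interval_closed[of j] L0 by (simp add: D_def)
    qed
  next
    case 3
    consider "j < N" | "j = N" | "j = N + 1" using assms 3 by linarith
    then show ?thesis
    proof cases
      case 1
      then have "A_entry N l i j = (\<Prod>k=j..<N. l k)"
        using assms 3 by (auto simp: A_entry_def Let_def)
      then show ?thesis
        using 1 3 assms v_low[of j] u_mid prod_interval[of j N] L0 by (simp add: D_def)
    next
      case 2
      show ?thesis
        using v_low[of N] u_mid nz[of N] L0 N4 by (simp add: 2 3 A_entry_def Let_def D_def)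
    next
      case j: 3
      show ?thesis
        using v_mid u_mid PQ_total nz[of N] L0 N4 by (simp add: j 3 A_entry_def Let_def D_def field_simps)
    qed
  next
    case 4
    define i' where "i' = rv i"
    have i': "1 \<le> i'" "i' < N" "i = rv i'" using 4 assms by (auto simp: i'_def rv_def)
    then have u: "u l i = L / Q l (i' - 1)" using u_high by simp
    have q: "Q l (i' - 1) \<noteq> 0" using nz(2)[of i'] i' by simp
    consider "j \<le> N" | "j = N + 1" | "N + 1 < j" by linarith
    then show ?thesis
    proof cases
      case 1
      have "A_entry N l i j = (\<Prod>k=j..N. l k) * (\<Prod>k=i'..<N. lb l k)"
        using assms 4 1 by (auto simp: A_entry_def Let_def i'_def rv_def)
      then show ?thesis
        using 1 4 assms i'(1,2) u v_low[of j] prod_interval_closed[of j] prod_bar_interval[of i' N] PQ_total L0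
        by (simp add: D_def)
    next
      case 2
      have "A_entry N l i j = (\<Prod>k=i'..<N. lb l k)"
        using assms 4 2 by (auto simp: A_entry_def Let_def i'_def rv_def)
      then show ?thesis
        using 2 4 i'(1,2) u v_mid prod_bar_interval[of i' N] L0 by (simp add: D_def)
    next
      case 3
      define j' where "j' = rv j"
      have j': "i' \<le> j'" "j' < N" "j = rv j'" using 3 assms by (auto simp: i'_def j'_def rv_def)
      show ?thesis
      proof (cases "i = j")
        case True
        then have A: "A_entry N l i j = lb l i' / l i'"
          using 4 assms by (auto simp: A_entry_def Let_def i'_def rv_def)
        have e: "i = 2 * N \<longleftrightarrow> i' = 1" using assms 4 by (auto simp: i'_def rv_def)
        have l0: "l i' \<noteq> 0" using BD_nonzero[OF l, of i'] i' by simp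
        show ?thesis
        proof (cases "i' = 1")
          case True
          then show ?thesis using A e \<open>i = j\<close> u v_last L0 by (simp add: D_def)
        next
          case False
          then have "v l j = Q l (i' - 1) * (1 + lb l i' / l i')"
            using \<open>i = j\<close> i' v_high[of i'] by (metis One_nat_def le_neq_implies_less)
          then show ?thesis
            using False e A \<open>i = j\<close> 4 assms u L0 q by (simp add: D_def)
        qed
      next
        case False
        then have ij: "i' < j'" using assms by (auto simp: i'_def j'_def rv_def)
        then have "A_entry N l i j = (\<Prod>k=i'..<j'. lb l k) * (1 + lb l j' / l j')"
          using 3 4 assms by (auto simp: A_entry_def Let_def i'_def j'_def rv_def)
        also have "\<dots> = u l i * v l j / L"
          using u v_high[of j'] j' ij i'(1,2) prod_bar_interval[of i' j'] L0 by simp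
        finally show ?thesis using False 3 by (simp add: D_def)
      qed
    qed
  qed
qed

end

section \<open>Reflection in the antidiagonal\<close>

lemma rv_rv [simp]: "i \<le> 2 * N + 1 \<Longrightarrow> rv (rv i) = i"
  by (simp add: rv_def)

lemma rv_range: "i \<in> {1..2*N} \<Longrightarrow> rv i \<in> {1..2*N}"
  by (auto simp: rv_def)

lemma sg_rv [simp]: "i \<in> {1..2*N} \<Longrightarrow> sg (rv i) = sg i"
  by (auto simp: sg_def rv_def)

lemma sg_sq [simp]: "sg i * sg i = 1" and sg_nonzero [simp]: "sg i \<noteq> 0"
  by (simp_all add: sg_def flip: power_add)

lemma sg_Suc: "Suc i \<le> N \<Longrightarrow> sg (Suc i) = - sg i"
  by (simp add: sg_def)

lemma sum_rv: "(\<Sum>k=1..2*N. f (rv k)) = (\<Sum>k=1..2*N. f k)"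
  by (rule sum.reindex_bij_witness[where i = rv and j = rv]) (auto simp: rv_def)

lemma pt_eqI:
  assumes "l \<in> BD N L" "m \<in> BD N L'"
    and "\<And>k. 1 \<le> k \<Longrightarrow> k \<le> N \<Longrightarrow> l k = m k" "\<And>k. 1 \<le> k \<Longrightarrow> k < N \<Longrightarrow> lb l k = lb m k"
  shows "l = m"
proof (rule PiE_ext)
  show "l \<in> {1..2*N-1} \<rightarrow>\<^sub>E - {0}" "m \<in> {1..2*N-1} \<rightarrow>\<^sub>E - {0}" using assms(1,2) by (auto simp: BD_def)
  fix k assume "k \<in> {1..2*N-1}"
  then show "l k = m k"
    using assms(3)[of k] assms(4)[of "2 * N - k"] by (cases "k \<le> N") (auto simp: bar_def)
qed

lemma mk_pt_low [simp]: "1 \<le> k \<Longrightarrow> k \<le> N \<Longrightarrow> mk_pt N f g k = f k"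
  using N4 by (auto simp: mk_pt_def)

lemma bar_mk_pt [simp]: "1 \<le> k \<Longrightarrow> k < N \<Longrightarrow> lb (mk_pt N f g) k = g k"
  using N4 by (auto simp: mk_pt_def bar_def)

lemma mk_pt_BD:
  assumes "\<And>k. 1 \<le> k \<Longrightarrow> k \<le> N \<Longrightarrow> f k \<noteq> 0" "\<And>k. 1 \<le> k \<Longrightarrow> k < N \<Longrightarrow> g k \<noteq> 0"
    and "P (mk_pt N f g) N * Q (mk_pt N f g) (N - 1) = L"
  shows "mk_pt N f g \<in> BD N L"
proof -
  have "mk_pt N f g k \<noteq> 0" if "k \<in> {1..2*N-1}" for k
  proof (cases "k \<le> N")
    case False
    then have "1 \<le> 2 * N - k" "2 * N - k < N" using that by auto
    then show ?thesis using False that assms(2)[of "2 * N - k"] by (simp add: mk_pt_def)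
  qed (use that assms(1)[of k] in \<open>simp add: mk_pt_def\<close>)
  moreover have "mk_pt N f g \<in> extensional {1..2*N-1}" by (simp add: mk_pt_def)
  ultimately show ?thesis using prod_all[of "mk_pt N f g"] assms(3) by (auto simp: BD_def PiE_def)
qed

lemma dual_low: "1 \<le> k \<Longrightarrow> k < N - 1 \<Longrightarrow> dual l k = lb l k"
  and dual_N1: "dual l (N - 1) = lb l (N - 1) * l N"
  and dual_N: "dual l N = 1 / l N"
  and bar_dual_low: "1 \<le> k \<Longrightarrow> k < N - 1 \<Longrightarrow> lb (dual l) k = l k"
  and bar_dual_N1: "lb (dual l) (N - 1) = l (N - 1) * l N"
  using N4 unfolding dual_def by (subst mk_pt_low bar_mk_pt; auto)+

lemma P_dual: "k < N - 1 \<Longrightarrow> P (dual l) k = Q l k"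
  unfolding P_def Q_def by (rule prod.cong) (auto simp: dual_low)

lemma Q_dual: "k < N - 1 \<Longrightarrow> Q (dual l) k = P l k"
  unfolding P_def Q_def by (rule prod.cong) (auto simp: bar_dual_low)

lemma P_dual_N1: "P (dual l) (N - 1) = Q l (N - 1) * l N"
  using N4 P_step[of "N - 1" "dual l"] Q_step[of "N - 1" l] P_dual[of "N - 2" l] dual_N1[of l]
  by (simp add: numeral_2_eq_2)

lemma Q_dual_N1: "Q (dual l) (N - 1) = P l N"
  using N4 Q_step[of "N - 1" "dual l"] P_step[of "N - 1" l] P_step[of N l] Q_dual[of "N - 2" l]
    bar_dual_N1[of l]
  by (simp add: numeral_2_eq_2)

lemma P_dual_N: "l N \<noteq> 0 \<Longrightarrow> P (dual l) N = Q l (N - 1)"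
  using N4 P_step[of N "dual l"] P_dual_N1[of l] dual_N[of l] by simp

lemma dual_BD: assumes l: "l \<in> BD N L" shows "dual l \<in> BD N L"
  unfolding dual_def
proof (rule mk_pt_BD, goal_cases)
  case (1 k)
  then show ?case using BD_nonzero[OF l, of N] BD_bar_nonzero[OF l, of k] N4 by auto
next
  case (2 k)
  then show ?case using BD_nonzero[OF l, of N] BD_nonzero[OF l, of k] N4 by auto
next
  case 3
  then show ?case
    using P_dual_N[of l] Q_dual_N1[of l] PQ_total[OF l] by (simp add: dual_def mult.commute)
qed

lemma dual_dual: assumes l: "l \<in> BD N L" shows "dual (dual l) = l"
proof (rule pt_eqI[OF dual_BD[OF dual_BD[OF l]] l])
  fix k assume k: "1 \<le> k" "k \<le> N"
  consider "k = N" | "k = N - 1" | "k < N - 1" using k by linarith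
  then show "dual (dual l) k = l k"
    using k PQ_total(3)[OF l] dual_N1[of l] dual_N1[of "dual l"] bar_dual_N1[of l]
    by cases (auto simp add: dual_N dual_low bar_dual_low)
next
  fix k assume k: "1 \<le> k" "k < N"
  consider "k = N - 1" | "k < N - 1" using k by linarith
  then show "lb (dual (dual l)) k = lb l k"
    using k PQ_total(3)[OF l] dual_N1[of l] bar_dual_N1[of "dual l"] bar_dual_N1[of l]
    by cases (auto simp add: dual_N dual_low bar_dual_low)
qed

text \<open>The last-row case of \<open>A_dual\<close>. As \<open>A\<close> is determined on and
  below the diagonal by \<open>u\<close>, \<open>v\<close> and \<open>D\<close>, this case already
  implies the general one.\<close>

lemma v_dual:
  assumes l: "l \<in> BD N L" and j: "j \<in> {1..2*N}"
  shows "v (dual l) j = u l (rv j)"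
proof -
  note d = dual_BD[OF l]
  note nz = P_nonzero[OF l] Q_nonzero[OF l] PQ_total[OF l] L0[OF l]
  have "1 \<le> j" "j \<le> 2 * N" using j by auto
  then consider "j < N" | "j = N" | "j = N + 1" | "j = N + 2" | "N + 2 < j" "j < 2 * N" | "j = 2 * N"
    by linarith
  then show ?thesis
  proof cases
    case 1
    then show ?thesis using v_low[OF d, of j] u_high[OF l, of j] j P_dual[of "j - 1" l] by auto
  next
    case 2
    have "rv N = N + 1" by (simp add: rv_def)
    then show ?thesis
      using 2 v_low[OF d, of N] u_mid[OF l] P_dual_N1[of l] nz(2)[of "N - 1"] nz(3,5) N4
      by (auto simp: field_simps)
  next
    case 3
    have "rv (N + 1) = N" by (simp add: rv_def)
    then show ?thesis
      using 3 v_mid[OF d] u_N[OF l] Q_dual_N1[of l] by simp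
  next
    case 4
    have "rv (N - 1) = j" "rv j = N - 1" using 4 N4 by (auto simp: rv_def)
    moreover have "lb l (N - 1) \<noteq> 0" "l (N - 1) \<noteq> 0"
      using BD_bar_nonzero[OF l, of "N - 1"] BD_nonzero[OF l, of "N - 1"] N4 by auto
    ultimately show ?thesis
      using v_high[OF d, of "N - 1"] u_low[OF l, of "N - 1"] Q_dual[of "N - 2" l] N4 nz
      by (simp add: dual_N1[simplified] bar_dual_N1[simplified] numeral_2_eq_2)
  next
    case 5
    define k where "k = rv j"
    have k: "1 < k" "k < N - 1" "j = rv k" "rv j = k" using 5 j by (auto simp: k_def rv_def)
    then show ?thesis
      using v_high[OF d, of k] u_low[OF l, of k] Q_dual[of "k - 1" l] dual_low[of k l] bar_dual_low[of k l] by simp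
  next
    case 6
    have "rv (2 * N) = 1" using N4 by (simp add: rv_def)
    then show ?thesis
      using 6 v_last[OF d] u_first[OF l] N4 dual_low[of 1 l] bar_dual_low[of 1 l] by simp
  qed
qed

lemma u_dual:
  assumes l: "l \<in> BD N L" and j: "j \<in> {1..2*N}"
  shows "u (dual l) j = v l (rv j)"
  using v_dual[OF dual_BD[OF l] rv_range[OF j]] j by (simp add: dual_dual[OF l])

lemma D_rv: assumes "i \<in> {1..2*N}" "j \<in> {1..2*N}" shows "D (rv j) (rv i) = D i j"
proof -
  have j: "1 < rv j \<longleftrightarrow> j < 2 * N" "rv j < 2 * N \<longleftrightarrow> 1 < j" "rv j = N \<longleftrightarrow> j = N + 1" "rv j = N + 1 \<longleftrightarrow> j = N"
    if "j \<in> {1..2*N}" for j using that by (auto simp: rv_def)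
  have "rv j = rv i \<longleftrightarrow> i = j" using assms by (auto simp: rv_def)
  then show ?thesis unfolding D_def j[OF assms(1)] j[OF assms(2)] by (intro if_cong) auto
qed

lemma A_dual:
  assumes l: "l \<in> BD N L" and i: "i \<in> {1..2*N}" and j: "j \<in> {1..2*N}"
  shows "A_entry N (dual l) i j = A_entry N l (rv j) (rv i)"
proof (cases "j \<le> i")
  case True
  then have "rv i \<le> rv j" by (simp add: rv_def)
  then show ?thesis
    using True i j rv_range[OF i] rv_range[OF j]
    by (simp add: A_lower[OF l] A_lower[OF dual_BD[OF l]] u_dual[OF l] v_dual[OF l] D_rv)
next
  case False
  then have "rv j < rv i" using i j by (auto simp: rv_def)
  then show ?thesis
    using False i j rv_range[OF i] rv_range[OF j]
    by (simp add: A_upper[OF l] A_upper[OF dual_BD[OF l]])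
qed

text \<open>Partial sums of the quadratic form \<open>\<Sum>\<^sub>i sg i w\<^sub>i w\<^sub>2\<^sub>N\<^sub>+\<^sub>1\<^sub>-\<^sub>i\<close> preserved by \<open>M\<close>; the full sum is
  \<open>2 G w N\<close>, so \<open>w\<close> is isotropic iff \<open>G w N = 0\<close>.\<close>

definition G :: "(nat \<Rightarrow> complex) \<Rightarrow> nat \<Rightarrow> complex" where
  "G w k = (\<Sum>i=1..k. sg i * w i * w (rv i))"

section \<open>Invariance of the quadratic form under A\<close>

lemma G_0 [simp]: "G w 0 = 0" and G_Suc: "G w (Suc k) = G w k + sg (Suc k) * w (Suc k) * w (rv (Suc k))"
  by (simp_all add: G_def)

lemma G_refl: assumes "j \<le> 2 * N" shows "G w (2 * N - j) + G w j = G w (2 * N)"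
proof -
  have "G w j = (\<Sum>i=2*N-j+1..2*N. sg i * w i * w (rv i))"
    unfolding G_def
    by (rule sum.reindex_bij_witness[where i = rv and j = rv]) (use assms sg_rv in \<open>auto simp: rv_def\<close>)
  moreover have "{1..2*N} = {1..2*N-j} \<union> {2*N-j+1..2*N}" using assms by auto
  ultimately show ?thesis unfolding G_def by (simp add: sum.union_disjoint)
qed

lemma G_full: "G w (2 * N) = 2 * G w N"
  using G_refl[of N w] by simp

text \<open>The summand with index \<open>k\<close> is minus the preceding sum times
  \<open>1 + lb l k / l k\<close>. Adding it therefore just multiplies the sum by
  \<open>- lb l k / l k\<close>, and the result stays a single term.\<close>

lemma G_v: assumes l: "l \<in> BD N L" shows "1 \<le> k \<Longrightarrow> k < N \<Longrightarrow> G (v l) k = sg k * Q l k * (L / P l k)"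
proof (induction k rule: nat_induct_at_least)
  case base
  have "rv 1 = 2 * N" "P l 1 = l 1" "Q l 1 = lb l 1" by (simp_all add: rv_def P_def Q_def)
  then show ?case using v_first[OF l] v_last[OF l] by (simp add: G_Suc)
next
  case (Suc k)
  have nz: "P l k \<noteq> 0" "l (Suc k) \<noteq> 0" "lb l (Suc k) \<noteq> 0" "Q l k \<noteq> 0"
    using Suc.prems P_nonzero[OF l, of k] Q_nonzero[OF l, of k] BD_nonzero[OF l, of "Suc k"]
     BD_bar_nonzero[OF l, of "Suc k"] N4 by auto
  have "v l (Suc k) = L / P l k" "v l (rv (Suc k)) = Q l k * (1 + lb l (Suc k) / l (Suc k))"
    using v_low[OF l, of "Suc k"] v_high[OF l, of "Suc k"] Suc by auto
  then have "G (v l) (Suc k) = sg k * Q l k * (L / P l k)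
      - sg k * (L / P l k) * (Q l k * (1 + lb l (Suc k) / l (Suc k)))"
    using Suc by (simp add: G_Suc sg_Suc)
  also have "\<dots> = sg (Suc k) * Q l (Suc k) * (L / P l (Suc k))"
    using Suc.prems nz P_step[of "Suc k" l] Q_step[of "Suc k" l]
    by (simp add: sg_Suc field_simps)
  finally show ?case .
qed

lemma G_v_N: assumes l: "l \<in> BD N L" shows "G (v l) N = 0"
proof -
  obtain n where n: "N = Suc n" using N4 by (cases N) auto
  have "rv N = N + 1" by (simp add: rv_def)
  moreover have "G (v l) n = sg n * Q l n * (L / P l n)" "v l N = L / P l n" "v l (N + 1) = Q l n"
      "sg N = - sg n"
    using G_v[OF l, of n] v_low[OF l, of N] v_mid[OF l] sg_Suc[of n] n N4 by auto
  moreover have "G (v l) N = G (v l) n + sg N * v l N * v l (rv N)" using G_Suc[of "v l" n] n by simp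
  ultimately show ?thesis by simp
qed

text \<open>Expresses the first column through the last row; the four exceptional indices are
  treated in \<open>u_ends\<close>. For \<open>i < N\<close> both sides are explicit. Beyond N+1 the
  vanishing of the full sum turns \<open>G\<close> at \<open>i\<close> into minus \<open>G\<close>
  at \<open>rv i - 1\<close>.\<close>

lemma u_G_v:
  assumes l: "l \<in> BD N L" and i: "1 < i" "i < 2 * N" "i \<noteq> N" "i \<noteq> N + 1"
  shows "u l i * G (v l) i = L * sg i * v l (rv i)"
proof (cases "i < N")
  case True
  have nz: "P l (i - 1) \<noteq> 0" "l i \<noteq> 0" "lb l i \<noteq> 0" "Q l i \<noteq> 0"
    using i True P_nonzero[OF l, of "i - 1"] Q_nonzero[OF l, of i] BD_nonzero[OF l, of i]
     BD_bar_nonzero[OF l, of i] N4 by auto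
  have e: "G (v l) i = sg i * Q l i * (L / P l i)" "u l i = P l (i - 1) * (1 + l i / lb l i)"
    "v l (rv i) = Q l (i - 1) * (1 + lb l i / l i)"
    "P l i = P l (i - 1) * l i" "Q l i = Q l (i - 1) * lb l i"
    using True i G_v[OF l, of i] u_low[OF l, of i] v_high[OF l, of i] P_step[of i l] Q_step[of i l] by auto
  show ?thesis unfolding e using nz by (simp add: field_simps)
next
  case False
  define k where "k = rv i"
  have k: "1 < k" "k < N" "rv i = k" "i = rv k" "2 * N - (k - 1) = i" using False i by (auto simp: k_def rv_def)
  have nz: "P l (k - 1) \<noteq> 0" "Q l (k - 1) \<noteq> 0"
    using k P_nonzero[OF l, of "k - 1"] Q_nonzero[OF l, of "k - 1"] by auto
  have s: "sg i = sg k" "sg k = - sg (k - 1)" using k sg_rv[of k] sg_Suc[of "k - 1"] by auto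
  have "G (v l) i = - G (v l) (k - 1)"
    using G_refl[of "k - 1" "v l"] k G_full[of "v l"] G_v_N[OF l] by (simp add: add_eq_0_iff2)
  then show ?thesis
    using G_v[OF l, of "k - 1"] k s u_high[OF l, of k] v_low[OF l, of k] nz by simp
qed

lemma A_diag_rv:
  assumes l: "l \<in> BD N L" and i: "i \<in> {1..2*N}"
  shows "A_entry N l i i * A_entry N l (rv i) (rv i) = 1"
proof -
  have *: "A_entry N l i i * A_entry N l (rv i) (rv i) = 1" if "i \<le> N" "1 \<le> i" for i
  proof (cases "i = N")
    case True
    have "rv N = N + 1" by (simp add: rv_def)
    then show ?thesis using True PQ_total(3)[OF l] by (simp add: A_entry_def Let_def)
  next
    case False
    then have "A_entry N l i i = l i / lb l i" "A_entry N l (rv i) (rv i) = lb l i / l i"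
      using that by (auto simp: A_entry_def Let_def rv_def)
    then show ?thesis using BD_nonzero[OF l, of i] BD_bar_nonzero[OF l, of i] that N4 by simp
  qed
  show ?thesis
  proof (cases "i \<le> N")
    case False
    then have "rv i \<le> N" "1 \<le> rv i" "rv (rv i) = i" using i by (auto simp: rv_def)
    then show ?thesis using *[of "rv i"] by (simp add: mult.commute)
  qed (use *[of i] i in auto)
qed

text \<open>In the orthogonality relation the rank-one part of \<open>A\<close> leaves partial sums
  of the form over; the cross terms with \<open>D\<close> reproduce exactly these. At N and 2N both
  sides vanish, since the row of \<open>D\<close> is zero and so is \<open>G\<close>.\<close>

lemma D_v_sum:
  assumes l: "l \<in> BD N L" and i: "1 < i" "i \<le> 2 * N" and j: "j < i" "1 \<le> j"
  shows "(\<Sum>k=j..i. D i k * (sg k * v l (rv k))) = u l i * G (v l) i / L"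
proof -
  note L0 = L0[OF l]
  consider "i = N" | "i = N + 1" | "i = 2 * N" | "i < 2 * N" "i \<noteq> N" "i \<noteq> N + 1" using i by linarith
  then show ?thesis
  proof cases
    case 1
    have "D N k = 0" for k by (simp add: D_def)
    then show ?thesis using 1 G_v_N[OF l] by simp
  next
    case 2
    have "(\<Sum>k=j..i. D i k * (sg k * v l (rv k))) = (\<Sum>k=j..i. if k = N then sg N * v l (rv N) else 0)"
      using 2 by (intro sum.cong) (auto simp: D_def)
    also have "\<dots> = sg N * v l (rv N)" using 2 j by simp
    finally have e: "(\<Sum>k=j..i. D i k * (sg k * v l (rv k))) = sg N * v l (N + 1)"
      by (simp add: rv_def)
    have "rv (N + 1) = N" "N + 1 \<in> {1..2*N}" using N4 by (auto simp: rv_def)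
    then have "sg (N + 1) = sg N" using sg_rv[of "N + 1"] by simp
    then have "G (v l) i = sg N * v l (N + 1) * v l N"
      using 2 G_Suc[of "v l" N] G_v_N[OF l] \<open>rv (N + 1) = N\<close> by simp
    moreover have "u l i = P l (N - 1)" "v l N = L / P l (N - 1)" "P l (N - 1) \<noteq> 0"
      using 2 u_mid[OF l] v_low[OF l, of N] P_nonzero[OF l] N4 by auto
    ultimately show ?thesis using e L0 by simp
  next
    case 3
    have "D i k = 0" if "k \<le> i" for k using 3 that N4 by (auto simp: D_def)
    then show ?thesis using 3 G_v_N[OF l] G_full[of "v l"] by simp
  next
    case 4
    have "(\<Sum>k=j..i. D i k * (sg k * v l (rv k))) = (\<Sum>k=j..i. if k = i then sg i * v l (rv i) else 0)"
      using 4 i by (intro sum.cong) (auto simp: D_def)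
    also have "\<dots> = sg i * v l (rv i)" using j by simp
    finally show ?thesis using u_G_v[OF l, of i] 4 i L0 by simp
  qed
qed

text \<open>Triangularity restricts the sum to \<open>k\<close> between \<open>rv j\<close> and
  \<open>i\<close>. If this range has more than one element, the product of the rank-one parts
  contributes \<open>G\<close> at \<open>i\<close> plus \<open>G\<close> at \<open>j\<close>, the
  two cross terms with \<open>D\<close> cancel these, and the product of the two entries of
  \<open>D\<close> is zero.\<close>

lemma A_orthogonal:
  assumes l: "l \<in> BD N L" and i: "i \<in> {1..2*N}" and j: "j \<in> {1..2*N}"
  shows "(\<Sum>k=1..2*N. sg k * A_entry N l i k * A_entry N l j (rv k)) = (if j = rv i then sg i else 0)"
proof -
  note L0 = L0[OF l]
  define j' where "j' = rv j"
  have j': "1 \<le> j'" "j' \<le> 2 * N" "rv j' = j" "j = rv i \<longleftrightarrow> j' = i" "rv j = j'"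
    using i j by (auto simp: j'_def rv_def)
  have "(\<Sum>k=1..2*N. sg k * A_entry N l i k * A_entry N l j (rv k))
      = (\<Sum>k=j'..i. sg k * A_entry N l i k * A_entry N l j (rv k))"
  proof (rule sum.mono_neutral_right)
    show "\<forall>k\<in>{1..2*N} - {j'..i}. sg k * A_entry N l i k * A_entry N l j (rv k) = 0"
    proof
      fix k assume k: "k \<in> {1..2*N} - {j'..i}"
      then have "i < k \<or> j < rv k" using j by (auto simp: j'_def rv_def)
      then show "sg k * A_entry N l i k * A_entry N l j (rv k) = 0"
        using k i j rv_range[of k] A_upper[OF l, of i k] A_upper[OF l, of j "rv k"] by auto
    qed
  qed (use i j' in auto)
  also have "\<dots> = (if j = rv i then sg i else 0)"
  proof (cases "j' < i")
    case False
    then show ?thesis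
      using j' A_diag_rv[OF l i] by (cases "j' = i") (auto simp: mult.assoc)
  next
    case True
    then have ij: "1 < i" "1 < j" "rv i < j" "1 \<le> rv i" "i \<le> 2 * N" "j \<le> 2 * N"
      using i j by (auto simp: j'_def rv_def)
    have "(\<Sum>k=j'..i. sg k * A_entry N l i k * A_entry N l j (rv k))
      = (\<Sum>k=j'..i. u l i * u l j / L\<^sup>2 * (sg k * v l k * v l (rv k))
           - u l j / L * (D i k * (sg k * v l (rv k)))
           - u l i / L * (D j (rv k) * (sg k * v l k)))"
    proof (rule sum.cong)
      fix k assume k: "k \<in> {j'..i}"
      then have "rv k \<le> j" "1 \<le> rv k" using i j by (auto simp: j'_def rv_def)
      then have A: "A_entry N l i k = u l i * v l k / L - D i k"
        "A_entry N l j (rv k) = u l j * v l (rv k) / L - D j (rv k)"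
        using k i j j' by (auto simp: A_lower[OF l])
      have "D i k * D j (rv k) = 0" using True j' k i by (auto simp: D_def rv_def)
      then have "sg k * D i k * D j (rv k) = 0" by simp
      then show "sg k * A_entry N l i k * A_entry N l j (rv k)
        = u l i * u l j / L\<^sup>2 * (sg k * v l k * v l (rv k))
           - u l j / L * (D i k * (sg k * v l (rv k)))
           - u l i / L * (D j (rv k) * (sg k * v l k))"
        unfolding A by (simp add: algebra_simps power2_eq_square)
    qed simp
    also have "\<dots> = u l i * u l j / L\<^sup>2 * (\<Sum>k=j'..i. sg k * v l k * v l (rv k))
           - u l j / L * (\<Sum>k=j'..i. D i k * (sg k * v l (rv k)))
           - u l i / L * (\<Sum>k=j'..i. D j (rv k) * (sg k * v l k))"
      by (simp only: sum_subtractf sum_distrib_left)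
    also have "(\<Sum>k=j'..i. D i k * (sg k * v l (rv k))) = u l i * G (v l) i / L"
      using D_v_sum[OF l ij(1,5) True j'(1)] .
    also have "(\<Sum>k=j'..i. D j (rv k) * (sg k * v l k)) = (\<Sum>k=rv i..j. D j k * (sg k * v l (rv k)))"
      by (rule sum.reindex_bij_witness[where i = rv and j = rv])
         (use i j j' sg_rv in \<open>auto simp: j'_def rv_def\<close>)
    also have "\<dots> = u l j * G (v l) j / L"
      using D_v_sum[OF l ij(2,6,3,4)] .
    also have "(\<Sum>k=j'..i. sg k * v l k * v l (rv k)) = G (v l) i + G (v l) j"
    proof -
      have "{1..i} = {1..2*N-j} \<union> {j'..i}" using True j by (auto simp: j'_def rv_def)
      then have "G (v l) i = G (v l) (2 * N - j) + (\<Sum>k=j'..i. sg k * v l k * v l (rv k))"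
        unfolding G_def by (simp only:, subst sum.union_disjoint) (use j in \<open>auto simp: j'_def rv_def\<close>)
      then show ?thesis
        using G_refl[OF ij(6), of "v l"] G_full[of "v l"] G_v_N[OF l] by (simp add: add_eq_0_iff2)
    qed
    finally show ?thesis using True j' L0 by (simp add: field_simps power2_eq_square)
  qed
  finally show ?thesis .
qed

section \<open>The polynomial matrix M\<close>

definition e :: "nat \<Rightarrow> nat \<Rightarrow> complex" where "e i j = (if i = 1 \<and> j = 2 * N then 1 else 0)"

definition M :: "complex \<Rightarrow> pt \<Rightarrow> nat \<Rightarrow> nat \<Rightarrow> complex poly" where
  "M L l i j = [: A_entry N l i j, B_entry N L l i j, L * e i j :]"

lemma poly_M:
  "poly (M L l i j) z = (1 - L * z) * (A_entry N l i j - z * e i j) + z * u l i * v l j"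
  by (simp add: M_def B_entry_def e_def u_def v_def algebra_simps)

lemma poly_M_special:
  "L \<noteq> 0 \<Longrightarrow> poly (M L l i j) (1 / L) = u l i * v l j / L"
  by (simp add: poly_M)

lemma M_dual:
  assumes "l \<in> BD N L" "i \<in> {1..2*N}" "j \<in> {1..2*N}"
  shows "M L (dual l) i j = M L l (rv j) (rv i)"
proof -
  have "e i j = e (rv j) (rv i)" using assms by (auto simp: e_def rv_def)
  then have "poly (M L (dual l) i j) z = poly (M L l (rv j) (rv i)) z" for z
    using assms by (simp add: poly_M A_dual u_dual v_dual)
  then show ?thesis by (simp add: poly_eq_poly_eq_iff[symmetric] fun_eq_iff)
qed

abbreviation psmult :: "complex \<Rightarrow> complex poly \<Rightarrow> complex poly" where
  "psmult \<equiv> Polynomial.smult"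

definition qd :: "complex \<Rightarrow> complex poly" where "qd L = [:1, - L:]\<^sup>2"

text \<open>By \<open>poly_M\<close>, a row of \<open>M\<close> is \<open>(1 - L z)\<close> times a
  row of \<open>A - z e\<close>, plus a multiple of \<open>v\<close>. Isotropy of \<open>v\<close>
  removes the square of the second part. The corner term \<open>z e\<close> disturbs the pairings
  with row 1 by exactly the amount that the cross terms with \<open>v\<close> restore.\<close>

lemma M_orthogonal:
  assumes l: "l \<in> BD N L" and i: "i \<in> {1..2*N}" and j: "j \<in> {1..2*N}"
  shows "(\<Sum>k=1..2*N. psmult (sg k) (M L l i k * M L l j (rv k))) = (if j = rv i then psmult (sg i) (qd L) else 0)"
proof -
  have ends: "1 \<in> {1..2*N}" "2 * N \<in> {1..2*N}" "rv 1 = 2 * N" "rv (2 * N) = 1" using N4 by (auto simp: rv_def)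
  have Av: "(\<Sum>k=1..2*N. sg k * A_entry N l i k * v l (rv k)) = (if i = 1 then sg 1 else 0)"
    if i: "i \<in> {1..2*N}" for i
  proof -
    have "2 * N = rv i \<longleftrightarrow> i = 1" "i = 1 \<Longrightarrow> sg i = sg 1" using i by (auto simp: rv_def)
    then show ?thesis using A_orthogonal[OF l i ends(2)] by (simp add: v_def)
  qed
  have vv: "(\<Sum>k=1..2*N. sg k * v l k * v l (rv k)) = 0"
    using Av[OF ends(2)] N4 by (simp add: v_def)
  have pick: "(\<Sum>k=1..2*N. sg k * e i k * f (rv k)) = (if i = 1 then sg 1 * f 1 else 0)" for f i
  proof -
    have "(\<Sum>k=1..2*N. sg k * e i k * f (rv k)) = (\<Sum>k=1..2*N. if k = 2 * N then if i = 1 then sg 1 * f 1 else 0 else 0)"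
      using ends sg_rv[of 1] by (intro sum.cong) (auto simp: e_def)
    also have "\<dots> = (if i = 1 then sg 1 * f 1 else 0)" using ends by (subst sum.delta) auto
    finally show ?thesis .
  qed
  have flip: "(\<Sum>k=1..2*N. sg k * f k * g (rv k)) = (\<Sum>k=1..2*N. sg k * g k * f (rv k))" for f g
    by (rule sum.reindex_bij_witness[where i = rv and j = rv]) (use sg_rv in \<open>auto simp: rv_def\<close>)
  have "poly (\<Sum>k=1..2*N. psmult (sg k) (M L l i k * M L l j (rv k))) z = poly (if j = rv i then psmult (sg i) (qd L) else 0) z"
    for z
  proof -
    define X where "X i k = A_entry N l i k - z * e i k" for i k
    define a where "a = 1 - L * z"
    have Xv: "(\<Sum>k=1..2*N. sg k * X i k * v l (rv k)) = (if i = 1 then a * sg 1 else 0)"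
      if i: "i \<in> {1..2*N}" for i
    proof -
      have E: "(\<Sum>k=1..2*N. sg k * X i k * v l (rv k)) = (\<Sum>k=1..2*N. sg k * A_entry N l i k * v l (rv k))
          - z * (\<Sum>k=1..2*N. sg k * e i k * v l (rv k))"
        by (simp add: X_def sum_distrib_left algebra_simps flip: sum_subtractf)
      show ?thesis unfolding E Av[OF i] pick v_first[OF l] by (simp add: a_def algebra_simps)
    qed
    have XX: "(\<Sum>k=1..2*N. sg k * X i k * X j (rv k)) = (if j = rv i then sg i else 0)
       - z * ((if i = 1 then sg 1 * u l j else 0) + (if j = 1 then sg 1 * u l i else 0))"
    proof -
      have "(\<Sum>k=1..2*N. sg k * X i k * X j (rv k)) = (\<Sum>k=1..2*N. sg k * A_entry N l i k * A_entry N l j (rv k))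
          - z * ((\<Sum>k=1..2*N. sg k * e i k * A_entry N l j (rv k)) + (\<Sum>k=1..2*N. sg k * A_entry N l i k * e j (rv k)))
          + z\<^sup>2 * (\<Sum>k=1..2*N. sg k * e i k * e j (rv k))"
        by (simp add: X_def sum_distrib_left algebra_simps power2_eq_square flip: sum_subtractf sum.distrib)
      also have "(\<Sum>k=1..2*N. sg k * A_entry N l i k * e j (rv k)) = (\<Sum>k=1..2*N. sg k * e j k * A_entry N l i (rv k))"
        by (rule flip)
      also have "(\<Sum>k=1..2*N. sg k * e i k * e j (rv k)) = 0" using N4 unfolding pick by (simp add: e_def)
      finally show ?thesis unfolding pick A_orthogonal[OF l i j] by (simp add: u_def)
    qed
    have "poly (\<Sum>k=1..2*N. psmult (sg k) (M L l i k * M L l j (rv k))) z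
       = (\<Sum>k=1..2*N. sg k * ((a * X i k + z * u l i * v l k) * (a * X j (rv k) + z * u l j * v l (rv k))))"
      by (simp add: poly_sum poly_M X_def a_def)
    also have "\<dots> = (\<Sum>k=1..2*N. a\<^sup>2 * (sg k * X i k * X j (rv k)) + a * z * u l j * (sg k * X i k * v l (rv k))
        + a * z * u l i * (sg k * v l k * X j (rv k)) + z\<^sup>2 * u l i * u l j * (sg k * v l k * v l (rv k)))"
      by (intro sum.cong) (simp_all add: algebra_simps power2_eq_square)
    also have "\<dots> = a\<^sup>2 * (\<Sum>k=1..2*N. sg k * X i k * X j (rv k)) + a * z * u l j * (\<Sum>k=1..2*N. sg k * X i k * v l (rv k))
        + a * z * u l i * (\<Sum>k=1..2*N. sg k * v l k * X j (rv k)) + z\<^sup>2 * u l i * u l j * (\<Sum>k=1..2*N. sg k * v l k * v l (rv k))"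
      by (simp only: sum.distrib sum_distrib_left)
    also have "(\<Sum>k=1..2*N. sg k * v l k * X j (rv k)) = (\<Sum>k=1..2*N. sg k * X j k * v l (rv k))"
      by (rule flip)
    finally have F: "poly (\<Sum>k=1..2*N. psmult (sg k) (M L l i k * M L l j (rv k))) z
        = a\<^sup>2 * (\<Sum>k=1..2*N. sg k * X i k * X j (rv k)) + a * z * u l j * (\<Sum>k=1..2*N. sg k * X i k * v l (rv k))
        + a * z * u l i * (\<Sum>k=1..2*N. sg k * X j k * v l (rv k)) + z\<^sup>2 * u l i * u l j * (\<Sum>k=1..2*N. sg k * v l k * v l (rv k))" .
    show ?thesis
      unfolding F Xv[OF i] Xv[OF j] XX vv by (simp add: qd_def a_def algebra_simps power2_eq_square)
  qed
  then show ?thesis by (simp add: poly_eq_poly_eq_iff[symmetric] fun_eq_iff)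
qed

end

section \<open>Existence of solutions\<close>

lemma psmult_sum: "Polynomial.smult c (sum f A) = (\<Sum>i\<in>A. Polynomial.smult c (f i))"
  by (induction A rule: infinite_finite_induct) (simp_all add: smult_add_right)

lemma pderiv_sum_poly: "pderiv (sum f A) = (\<Sum>i\<in>A. pderiv (f i))"
  by (induction A rule: infinite_finite_induct) (simp_all add: pderiv_add)

lemma double_root_dvd_iff:
  fixes p :: "complex poly"
  shows "[:- a, 1:]\<^sup>2 dvd p \<longleftrightarrow> poly p a = 0 \<and> poly (pderiv p) a = 0"
proof -
  obtain c where c: "c = [:- a, 1:]" by blast
  then have c': "poly c a = 0" "pderiv c = 1" by (simp_all add: pderiv_pCons)
  have dvd: "c dvd r" if "poly r a = 0" for r using that by (simp add: c poly_eq_0_iff_dvd)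
  have "c\<^sup>2 dvd p \<longleftrightarrow> poly p a = 0 \<and> poly (pderiv p) a = 0"
  proof
    assume "c\<^sup>2 dvd p"
    then obtain s where "p = c * (c * s)" by (auto simp: dvd_def power2_eq_square mult.assoc)
    then show "poly p a = 0 \<and> poly (pderiv p) a = 0" using c' by (simp add: pderiv_mult)
  next
    assume *: "poly p a = 0 \<and> poly (pderiv p) a = 0"
    then obtain r where r: "p = c * r" using dvd by (auto elim: dvdE)
    then have "poly r a = 0" using * c' by (simp add: pderiv_mult)
    then show "c\<^sup>2 dvd p" using r dvd by (simp add: power2_eq_square mult_dvd_mono)
  qed
  then show ?thesis by (simp only: c)
qed

lemma coprime_squares_dvd:
  fixes p :: "complex poly"
  assumes "[:- a, 1:]\<^sup>2 dvd p" "[:- b, 1:]\<^sup>2 dvd p" "a \<noteq> b"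
  shows "[:- a, 1:]\<^sup>2 * [:- b, 1:]\<^sup>2 dvd p"
proof (cases "p = 0")
  case False
  obtain r where r: "p = [:- a, 1:]\<^sup>2 * r" using assms(1) by (auto simp: dvd_def)
  have "order b ([:- a, 1:]\<^sup>2) = 0"
    using assms(3) by (intro order_0I) simp
  then have "order b p = order b r"
    using False r by (simp add: order_mult)
  moreover have "2 \<le> order b p" using assms(2) False by (simp add: order_divides)
  ultimately have "[:- b, 1:]\<^sup>2 dvd r" by (simp add: order_divides)
  then show ?thesis using r by (simp add: mult_dvd_mono)
qed simp

lemma coeff_mult_bound:
  fixes p q :: "'a::comm_semiring_1 poly"
  assumes "degree p \<le> m" "degree q \<le> n"
  shows "coeff (p * q) (m + n) = coeff p m * coeff q n"
proof -
  have "coeff (p * q) (m + n) = (\<Sum>i\<le>m+n. coeff p i * coeff q (m + n - i))"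
    by (simp add: coeff_mult)
  also have "\<dots> = (\<Sum>i\<le>m+n. if i = m then coeff p m * coeff q n else 0)"
  proof (rule sum.cong)
    fix i assume "i \<in> {..m+n}"
    consider "i < m" | "i = m" | "m < i" by linarith
    then show "coeff p i * coeff q (m + n - i) = (if i = m then coeff p m * coeff q n else 0)"
    proof cases
      case 1
      then have "coeff q (m + n - i) = 0" using assms(2) by (intro coeff_eq_0) auto
      then show ?thesis using 1 by simp
    next
      case 3
      then have "coeff p i = 0" using assms(1) by (intro coeff_eq_0) auto
      then show ?thesis using 3 by simp
    qed simp
  qed simp
  finally show ?thesis by simp
qed

text \<open>Uniqueness of a triangular factorisation: \<open>T\<close> is lower triangular, but it
  also equals an upper unitriangular matrix obtained by inverting \<open>U1\<close> and
  \<open>U2\<close>. The induction treats the rows of \<open>T\<close> from the bottom, because row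
  \<open>i\<close> of \<open>U1\<close> only involves rows of \<open>T\<close> from \<open>i\<close>
  on, and the rows below \<open>i\<close> do not contribute to the columns up to
  \<open>i\<close>.\<close>

lemma lower_triangular_eq_one:
  fixes U1 U2 T :: "nat \<Rightarrow> nat \<Rightarrow> complex"
  assumes ab: "a \<noteq> 0" "b \<noteq> 0"
    and U1: "\<And>i k. i \<in> {1..n} \<Longrightarrow> k \<in> {1..n} \<Longrightarrow> k \<le> i \<Longrightarrow> U1 i k = (if k = i then a else 0)"
    and U2: "\<And>i k. i \<in> {1..n} \<Longrightarrow> k \<in> {1..n} \<Longrightarrow> k \<le> i \<Longrightarrow> U2 i k = (if k = i then b else 0)"
    and T: "\<And>i k. i \<in> {1..n} \<Longrightarrow> k \<in> {1..n} \<Longrightarrow> i < k \<Longrightarrow> T i k = 0"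
    and V: "\<And>i j. i \<in> {1..n} \<Longrightarrow> j \<in> {1..n} \<Longrightarrow> j \<le> i \<Longrightarrow>
       (\<Sum>k=1..n. U1 i k * (\<Sum>q=1..n. T k q * U2 q j)) = (if j = i then a * b else 0)"
    and i: "i \<in> {1..n}" and j: "j \<in> {1..n}"
  shows "T i j = (if i = j then 1 else 0)"
proof -
  have "\<forall>j\<in>{1..n}. T i j = (if i = j then 1 else 0)" using i
  proof (induction "n - i" arbitrary: i rule: less_induct)
    case less
    have row: "T k q = (if k = q then 1 else 0)" if "k \<in> {1..n}" "i < k" "q \<in> {1..n}" for k q
      using less(1)[of k] that by auto
    have *: "(\<Sum>q=1..n. T i q * U2 q j) = (if j = i then b else 0)" if j: "j \<in> {1..n}" "j \<le> i" for j
    proof -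
      have "(\<Sum>k=1..n. U1 i k * (\<Sum>q=1..n. T k q * U2 q j))
          = (\<Sum>k=1..n. if k = i then a * (\<Sum>q=1..n. T i q * U2 q j) else 0)"
      proof (rule sum.cong)
        fix k assume k: "k \<in> {1..n}"
        show "U1 i k * (\<Sum>q=1..n. T k q * U2 q j) = (if k = i then a * (\<Sum>q=1..n. T i q * U2 q j) else 0)"
        proof (cases "i < k")
          case True
          have "(\<Sum>q=1..n. T k q * U2 q j) = (\<Sum>q=1..n. if q = k then U2 k j else 0)"
            using row[OF k True] by (intro sum.cong) auto
          also have "\<dots> = 0" using k j True U2[OF k j(1)] by simp
          finally show ?thesis using True by simp
        qed (use U1[OF less.prems k] in auto)
      qed simp
      also have "\<dots> = a * (\<Sum>q=1..n. T i q * U2 q j)" using less.prems by simp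
      finally show ?thesis using V[OF less.prems j] ab by (auto split: if_splits)
    qed
    have low: "T i j = (if i = j then 1 else 0)" if "j \<in> {1..n}" "j \<le> i" for j
      using that
    proof (induction j rule: less_induct)
      case (less j')
      have "(\<Sum>q=1..n. T i q * U2 q j') = (\<Sum>q=1..n. if q = j' then T i j' * b else 0)"
      proof (rule sum.cong)
        fix q assume q: "q \<in> {1..n}"
        show "T i q * U2 q j' = (if q = j' then T i j' * b else 0)"
          using less.IH[of q] less.prems q U2[OF q less.prems(1)] by (cases "q < j'") auto
      qed simp
      then show ?case using *[OF less.prems] less.prems ab by (auto split: if_splits)
    qed
    show ?case
    proof
      fix j assume "j \<in> {1..n}"
      then show "T i j = (if i = j then 1 else 0)"
        using low[of j] T[OF less.prems, of j] by (cases "j \<le> i") auto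
    qed
  qed
  then show ?thesis using j by blast
qed

context D_rank begin

section \<open>Products of polynomial matrices and their divisibility\<close>

abbreviation R :: "nat set" where "R \<equiv> {1..2*N}"

definition mm :: "(nat \<Rightarrow> nat \<Rightarrow> complex poly) \<Rightarrow> (nat \<Rightarrow> nat \<Rightarrow> complex poly) \<Rightarrow> nat \<Rightarrow> nat \<Rightarrow> complex poly" where
  "mm X Y i j = (\<Sum>k\<in>R. X i k * Y k j)"

definition dm :: "(nat \<Rightarrow> nat \<Rightarrow> complex poly) \<Rightarrow> nat \<Rightarrow> nat \<Rightarrow> complex poly" where
  "dm X i j = psmult (sg i * sg j) (X i j)"

lemma mm_assoc: "mm (mm X Y) Z = mm X (mm Y Z)"
proof (intro ext)
  fix i j
  have "mm (mm X Y) Z i j = (\<Sum>k\<in>R. \<Sum>q\<in>R. X i q * Y q k * Z k j)"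
    by (simp add: mm_def sum_distrib_right)
  also have "\<dots> = (\<Sum>q\<in>R. \<Sum>k\<in>R. X i q * Y q k * Z k j)" by (rule sum.swap)
  also have "\<dots> = mm X (mm Y Z) i j"
    by (simp add: mm_def sum_distrib_left mult.assoc)
  finally show "mm (mm X Y) Z i j = mm X (mm Y Z) i j" .
qed

lemma mm_cong:
  assumes "\<And>k. k \<in> R \<Longrightarrow> X i k = X' i k" "\<And>k. k \<in> R \<Longrightarrow> Y k j = Y' k j"
  shows "mm X Y i j = mm X' Y' i j"
  unfolding mm_def using assms by (intro sum.cong) auto

lemma dm_mm: "dm (mm X Y) i j = mm (dm X) (dm Y) i j"
proof -
  have "psmult (sg i * sg j) (x * y) = psmult (sg i * sg k) x * psmult (sg k * sg j) y" for k x y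
  proof -
    have "sg i * sg k * (sg k * sg j) = sg i * sg j * (sg k * sg k)" by (simp only: mult_ac)
    then have e: "sg i * sg k * (sg k * sg j) = sg i * sg j" by simp
    have "psmult (sg i * sg k) x * psmult (sg k * sg j) y = psmult (sg i * sg k * (sg k * sg j)) (x * y)"
      by (simp only: mult_smult_left mult_smult_right smult_smult mult.commute)
    then show ?thesis unfolding e by simp
  qed
  then show ?thesis unfolding mm_def dm_def psmult_sum by (intro sum.cong refl)
qed

lemma mm_dual:
  assumes l: "l \<in> BD N L" and m: "m \<in> BD N K" and ij: "i \<in> R" "j \<in> R"
  shows "mm (M K (dual m)) (M L (dual l)) i j = mm (M L l) (M K m) (rv j) (rv i)"
proof -
  have "mm (M K (dual m)) (M L (dual l)) i j = (\<Sum>k\<in>R. M L l (rv j) (rv k) * M K m (rv k) (rv i))"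
    unfolding mm_def using ij by (intro sum.cong refl) (simp add: M_dual[OF l] M_dual[OF m] mult.commute)
  then show ?thesis unfolding mm_def by (simp only: sum_rv[of "\<lambda>k. M L l (rv j) k * M K m k (rv i)"])
qed

lemma mm_scalar_left: "(\<And>k. k \<in> R \<Longrightarrow> X i k = (if i = k then c else 0)) \<Longrightarrow> i \<in> R \<Longrightarrow> mm X Y i j = c * Y i j"
  unfolding mm_def by (subst sum.cong[OF refl, where h = "\<lambda>k. if i = k then c * Y i j else 0"]) auto

lemma mm_scalar_right: "(\<And>k. k \<in> R \<Longrightarrow> Y k j = (if k = j then c else 0)) \<Longrightarrow> j \<in> R \<Longrightarrow> mm X Y i j = c * X i j"
  unfolding mm_def by (subst sum.cong[OF refl, where h = "\<lambda>k. if k = j then c * X i j else 0"]) auto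

lemma M_dm_dual:
  assumes l: "l \<in> BD N L" and i: "i \<in> R" and j: "j \<in> R"
  shows "mm (M L l) (dm (M L (dual l))) i j = (if i = j then qd L else 0)"
proof -
  have "mm (M L l) (dm (M L (dual l))) i j = (\<Sum>k\<in>R. psmult (sg j) (psmult (sg k) (M L l i k * M L l (rv j) (rv k))))"
    unfolding mm_def dm_def using M_dual[OF l _ j] by (intro sum.cong) (auto simp: mult.commute)
  also have "\<dots> = psmult (sg j) (if rv j = rv i then psmult (sg i) (qd L) else 0)"
    unfolding M_orthogonal[OF l i rv_range[OF j], symmetric] by (simp add: psmult_sum)
  also have "\<dots> = (if i = j then qd L else 0)"
  proof -
    have "rv j = rv i \<longleftrightarrow> i = j" using i j by (auto simp: rv_def)
    then show ?thesis by simp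
  qed
  finally show ?thesis .
qed

lemma dm_dual_M:
  assumes l: "l \<in> BD N L" and i: "i \<in> R" and j: "j \<in> R"
  shows "mm (dm (M L (dual l))) (M L l) i j = (if i = j then qd L else 0)"
proof -
  have dd: "dm (dm X) = X" for X
  proof (intro ext)
    fix i j
    have "sg i * sg j * (sg i * sg j) = sg i * sg i * (sg j * sg j)" by (simp only: mult_ac)
    then show "dm (dm X) i j = X i j" by (simp add: dm_def)
  qed
  have "mm (dm (M L (dual l))) (dm (dm (M L l))) i j = dm (mm (M L (dual l)) (dm (M L l))) i j"
    by (rule dm_mm[symmetric])
  also have "\<dots> = (if i = j then qd L else 0)"
    using M_dm_dual[OF dual_BD[OF l] i j] by (simp add: dual_dual[OF l] dm_def)
  finally show ?thesis by (simp add: dd)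
qed

lemma M_mult_orthogonal:
  assumes l: "l \<in> BD N L" and m: "m \<in> BD N K" and i: "i \<in> R" and j: "j \<in> R"
  shows "(\<Sum>k\<in>R. psmult (sg k) (mm (M L l) (M K m) i k * mm (M L l) (M K m) j (rv k)))
    = (if j = rv i then psmult (sg i) (qd L * qd K) else 0)"
proof -
  have "(\<Sum>k\<in>R. psmult (sg k) (mm (M L l) (M K m) i k * mm (M L l) (M K m) j (rv k)))
     = (\<Sum>k\<in>R. \<Sum>a\<in>R. \<Sum>b\<in>R. M L l i a * M L l j b * psmult (sg k) (M K m a k * M K m b (rv k)))"
    unfolding mm_def sum_product psmult_sum by (intro sum.cong refl) (simp add: mult.assoc mult.left_commute)
  also have "\<dots> = (\<Sum>a\<in>R. \<Sum>b\<in>R. \<Sum>k\<in>R. M L l i a * M L l j b * psmult (sg k) (M K m a k * M K m b (rv k)))"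
    by (subst sum.swap, rule sum.cong[OF refl], rule sum.swap)
  also have "\<dots> = (\<Sum>a\<in>R. \<Sum>b\<in>R. if b = rv a then M L l i a * M L l j (rv a) * psmult (sg a) (qd K) else 0)"
    by (intro sum.cong[OF refl], subst sum_distrib_left[symmetric], subst M_orthogonal[OF m]) auto
  also have "\<dots> = (\<Sum>a\<in>R. qd K * psmult (sg a) (M L l i a * M L l j (rv a)))"
    using rv_range by (intro sum.cong[OF refl], subst sum.delta) (auto simp: algebra_simps)
  also have "\<dots> = qd K * (if j = rv i then psmult (sg i) (qd L) else 0)"
    by (subst sum_distrib_left[symmetric], subst M_orthogonal[OF l i j]) simp
  finally show ?thesis by (auto simp: mult.commute)
qed

text \<open>At \<open>a\<close> all rows of \<open>F\<close> and \<open>H\<close> are multiples of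
  one vector \<open>y\<close>. Value and derivative of any pairing then involve only the pairing
  \<open>q\<close> of \<open>y\<close> with itself and the pairings \<open>d\<close> of the
  differentiated rows with \<open>y\<close>. The double roots of the self-pairings force
  \<open>q\<close> and \<open>d\<close> to vanish, since some row has a nonzero factor, and so the
  mixed pairing has a double root too.\<close>

lemma double_root_pairing:
  assumes F: "\<And>i j. i \<in> R \<Longrightarrow> j \<in> R \<Longrightarrow> [:- a, 1:]\<^sup>2 dvd (\<Sum>k\<in>R. psmult (sg k) (F i k * F j (rv k)))"
    and H: "\<And>i j. i \<in> R \<Longrightarrow> j \<in> R \<Longrightarrow> [:- a, 1:]\<^sup>2 dvd (\<Sum>k\<in>R. psmult (sg k) (H i k * H j (rv k)))"
    and Fa: "\<And>i k. i \<in> R \<Longrightarrow> k \<in> R \<Longrightarrow> poly (F i k) a = x i * y k"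
    and Ha: "\<And>i k. i \<in> R \<Longrightarrow> k \<in> R \<Longrightarrow> poly (H i k) a = x' i * y k"
    and x: "i0 \<in> R" "x i0 \<noteq> 0" and x': "i1 \<in> R" "x' i1 \<noteq> 0"
    and i: "i \<in> R" and j: "j \<in> R"
  shows "[:- a, 1:]\<^sup>2 dvd (\<Sum>k\<in>R. psmult (sg k) (F i k * H j (rv k)))"
proof -
  define d where "d F i = (\<Sum>k\<in>R. sg k * poly (pderiv (F i k)) a * y (rv k))" for F :: "nat \<Rightarrow> nat \<Rightarrow> complex poly" and i :: nat
  define q where "q = (\<Sum>k\<in>R. sg k * y k * y (rv k))"
  have val: "poly (\<Sum>k\<in>R. psmult (sg k) (F i k * H j (rv k))) a = x i * x' j * q"
    if "\<And>i k. i \<in> R \<Longrightarrow> k \<in> R \<Longrightarrow> poly (F i k) a = x i * y k"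
      "\<And>i k. i \<in> R \<Longrightarrow> k \<in> R \<Longrightarrow> poly (H i k) a = x' i * y k" "i \<in> R" "j \<in> R" for F H x x' i j
    unfolding q_def poly_sum sum_distrib_left
    using that rv_range by (intro sum.cong) (auto simp: algebra_simps)
  have der: "poly (pderiv (\<Sum>k\<in>R. psmult (sg k) (F i k * H j (rv k)))) a = d F i * x' j + x i * d H j"
    if "\<And>i k. i \<in> R \<Longrightarrow> k \<in> R \<Longrightarrow> poly (F i k) a = x i * y k"
      "\<And>i k. i \<in> R \<Longrightarrow> k \<in> R \<Longrightarrow> poly (H i k) a = x' i * y k" "i \<in> R" "j \<in> R" for F H x x' i j
  proof -
    have "d H j = (\<Sum>k\<in>R. sg k * poly (pderiv (H j (rv k))) a * y k)"
      unfolding d_def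
      by (subst sum_rv[symmetric], rule sum.cong) auto
    then show ?thesis
      unfolding d_def[of F] pderiv_sum_poly poly_sum sum_distrib_left sum_distrib_right
      using that rv_range unfolding sum_distrib_left sum_distrib_right sum.distrib[symmetric]
      by (simp only: sum_distrib_left sum.distrib[symmetric])
        (rule sum.cong, auto simp: pderiv_smult pderiv_mult algebra_simps)
  qed
  have van: "q = 0 \<and> (\<forall>i\<in>R. d F i = 0)"
    if F: "\<And>i j. i \<in> R \<Longrightarrow> j \<in> R \<Longrightarrow> [:- a, 1:]\<^sup>2 dvd (\<Sum>k\<in>R. psmult (sg k) (F i k * F j (rv k)))"
      and Fa: "\<And>i k. i \<in> R \<Longrightarrow> k \<in> R \<Longrightarrow> poly (F i k) a = x i * y k"
      and x: "i0 \<in> R" "x i0 \<noteq> 0" for F x i0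
  proof -
    have "x i0 * x i0 * q = 0"
      using F[OF x(1) x(1)] val[where F = F and H = F, OF Fa Fa x(1) x(1)] unfolding double_root_dvd_iff by simp
    moreover have *: "d F i * x j + x i * d F j = 0" if "i \<in> R" "j \<in> R" for i j
      using F[OF that] der[where F = F and H = F, OF Fa Fa that] unfolding double_root_dvd_iff by simp
    have "d F i0 = 0" using *[OF x(1) x(1)] x(2) by (simp add: mult.commute)
    then have "d F i = 0" if "i \<in> R" for i using *[OF that x(1)] x(2) by simp
    ultimately show ?thesis using x(2) by simp
  qed
  show ?thesis
    unfolding double_root_dvd_iff
    using val[where F = F and H = H, OF Fa Ha i j] der[where F = F and H = H, OF Fa Ha i j]
      van[where F = F and x = x, OF F Fa x] van[where F = H and x = x', OF H Ha x'] i j by simp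
qed

lemma qd_eq: assumes "L \<noteq> 0" shows "qd L = psmult (L\<^sup>2) ([:- (1 / L), 1:]\<^sup>2)"
proof -
  have "[:1, - L:] = psmult (- L) [:- (1 / L), 1:]" using assms by simp
  then show ?thesis unfolding qd_def by (simp only: smult_power) simp
qed

lemma qd_dvd_iff: "L \<noteq> 0 \<Longrightarrow> qd L dvd p \<longleftrightarrow> [:- (1 / L), 1:]\<^sup>2 dvd p"
  by (subst qd_eq) (simp_all add: smult_dvd_iff)

lemma qd_nonzero [simp]: "qd L \<noteq> 0"
  by (simp add: qd_def)

lemma poly_qd_0 [simp]: "poly (qd L) 0 = 1"
  by (simp add: qd_def)

text \<open>Multiplying by the sign-conjugated dual of \<open>m'\<close> means pairing with the rows
  of \<open>M L m'\<close>. By the hypothesis on \<open>c\<close>, both matrices have row space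
  spanned by \<open>v m'\<close> at \<open>1/L\<close>, which is the situation of
  \<open>double_root_pairing\<close>.\<close>

lemma dvd_mult_dual_right:
  assumes l: "l \<in> BD N L" and m: "m \<in> BD N K" and m': "m' \<in> BD N L"
    and c: "c \<noteq> 0" "\<And>j. j \<in> R \<Longrightarrow> (\<Sum>k\<in>R. v l k * poly (M K m k j) (1 / L)) = c * v m' j"
    and i: "i \<in> R" and j: "j \<in> R"
  shows "qd L dvd mm (mm (M L l) (M K m)) (dm (M L (dual m'))) i j"
proof -
  note L = L0[OF l]
  let ?P = "mm (M L l) (M K m)"
  have E: "mm ?P (dm (M L (dual m'))) i j
      = psmult (sg j) (\<Sum>k\<in>R. psmult (sg k) (?P i k * M L m' (rv j) (rv k)))"
    unfolding mm_def[of ?P] dm_def psmult_sum using M_dual[OF m' _ j]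
    by (intro sum.cong refl) (simp add: mult.commute)
  have "[:- (1 / L), 1:]\<^sup>2 dvd (\<Sum>k\<in>R. psmult (sg k) (?P i k * M L m' (rv j) (rv k)))"
  proof (rule double_root_pairing[where F = ?P and x = "\<lambda>i. u l i * c / L" and x' = "\<lambda>i. u m' i / L" and y = "v m'"
        and ?i0.0 = "2 * N" and ?i1.0 = "2 * N"])
    fix i j assume ij: "i \<in> R" "j \<in> R"
    have "qd L dvd (if j = rv i then psmult (sg i) (qd L * qd K) else 0)" by (simp add: dvd_smult)
    then show "[:- (1 / L), 1:]\<^sup>2 dvd (\<Sum>k\<in>R. psmult (sg k) (?P i k * ?P j (rv k)))"
      unfolding M_mult_orthogonal[OF l m ij] using qd_dvd_iff[OF L] by blast
    have "qd L dvd (if j = rv i then psmult (sg i) (qd L) else 0)" by (simp add: dvd_smult)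
    then show "[:- (1 / L), 1:]\<^sup>2 dvd (\<Sum>k\<in>R. psmult (sg k) (M L m' i k * M L m' j (rv k)))"
      unfolding M_orthogonal[OF m' ij] using qd_dvd_iff[OF L] by blast
    show "poly (M L m' i j) (1 / L) = u m' i / L * v m' j" using poly_M_special[OF L] by simp
    have "poly (?P i j) (1 / L) = (\<Sum>k\<in>R. u l i / L * (v l k * poly (M K m k j) (1 / L)))"
      unfolding mm_def poly_sum using poly_M_special[OF L] by (intro sum.cong) auto
    also have "\<dots> = u l i * c / L * v m' j"
      unfolding sum_distrib_left[symmetric] c(2)[OF ij(2)] by simp
    finally show "poly (?P i j) (1 / L) = u l i * c / L * v m' j" .
  qed (use i j rv_range N4 L c u_last[OF l] u_last[OF m'] in auto)
  then show ?thesis unfolding E using qd_dvd_iff[OF L] by (intro dvd_smult) blast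
qed

text \<open>Reflection in the antidiagonal reverses products, so this is the right-hand version for
  the reflected pair.\<close>

lemma dvd_mult_dual_left:
  assumes l: "l \<in> BD N L" and m: "m \<in> BD N K" and l': "l' \<in> BD N K"
    and c: "c \<noteq> 0"
      "\<And>j. j \<in> R \<Longrightarrow> (\<Sum>k\<in>R. v (dual m) k * poly (M L (dual l) k j) (1 / K)) = c * v (dual l') j"
    and i: "i \<in> R" and j: "j \<in> R"
  shows "qd K dvd mm (dm (M K (dual l'))) (mm (M L l) (M K m)) i j"
proof -
  have "mm (mm (M K (dual m)) (M L (dual l))) (dm (M K (dual (dual l')))) (rv j) (rv i)
      = (\<Sum>k\<in>R. mm (M L l) (M K m) (rv k) j * psmult (sg k * sg i) (M K (dual l') i (rv k)))"
    unfolding mm_def[of "mm (M K (dual m)) (M L (dual l))"] dm_def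
    using i j rv_range by (intro sum.cong refl) (simp add: mm_dual[OF l m] M_dual[OF dual_BD[OF l']])
  also have "\<dots> = (\<Sum>k\<in>R. mm (M L l) (M K m) (rv k) j * psmult (sg (rv k) * sg i) (M K (dual l') i (rv k)))"
    by (intro sum.cong refl) simp
  also have "\<dots> = mm (dm (M K (dual l'))) (mm (M L l) (M K m)) i j"
    unfolding sum_rv[of "\<lambda>k. mm (M L l) (M K m) k j * psmult (sg k * sg i) (M K (dual l') i k)"]
    by (simp add: mm_def[of "dm (M K (dual l'))"] dm_def mult.commute)
  finally show ?thesis
    using dvd_mult_dual_right[OF dual_BD[OF m] dual_BD[OF l] dual_BD[OF l'] c rv_range[OF j] rv_range[OF i]]
    by simp
qed

section \<open>Row degrees, column degrees and leading coefficients of M\<close>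

definition \<alpha> :: "nat \<Rightarrow> nat" where "\<alpha> i = (if i = 1 then 2 else if i = 2 * N then 0 else 1)"
definition \<beta> :: "nat \<Rightarrow> nat" where "\<beta> j = 2 - \<alpha> j"

lemma A_first_column_last_row:
  "l \<in> BD N L \<Longrightarrow> A_entry N l (2 * N) 1 = L"
  using v_first by (simp add: v_def)

lemma degree_M:
  assumes "l \<in> BD N L" and "i \<in> R" and "j \<in> R"
  shows "degree (M L l i j) \<le> \<alpha> i" "degree (M L l i j) \<le> \<beta> j"
proof -
  have B: "i = 2 * N \<Longrightarrow> B_entry N L l i j = 0" "j = 1 \<Longrightarrow> B_entry N L l i j = 0"
    using A_first_column_last_row[OF assms(1)] N4 by (auto simp: B_entry_def)
  show "degree (M L l i j) \<le> \<alpha> i"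
    using B N4 by (auto simp: M_def \<alpha>_def e_def)
  show "degree (M L l i j) \<le> \<beta> j"
    using B N4 by (auto simp: M_def \<beta>_def \<alpha>_def e_def)
qed

lemma degree_dm: "degree (dm X i j) = degree (X i j)"
  by (simp add: dm_def)

lemma degree_mm_le:
  assumes "\<And>k. k \<in> R \<Longrightarrow> degree (X i k) + degree (Y k j) \<le> d"
  shows "degree (mm X Y i j) \<le> d"
  unfolding mm_def using assms degree_mult_le order_trans by (intro degree_sum_le) (auto intro: order_trans[OF degree_mult_le])

lemma B_lower:
  assumes l: "l \<in> BD N L" and j: "1 \<le> j" "j \<le> i" "i \<le> 2 * N"
  shows "B_entry N L l i j = L * D i j"
proof -
  have "B_entry N L l i j = u l i * v l j - L * A_entry N l i j"
    using j N4 by (auto simp: B_entry_def u_def v_def)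
  then show ?thesis using A_lower[OF l j] L0[OF l] by (simp add: algebra_simps)
qed

lemma B_middle:
  assumes l: "l \<in> BD N L" shows "B_entry N L l N (N + 1) = L"
proof -
  have "A_entry N l N (N + 1) = 0" using A_upper[OF l, of N "N + 1"] N4 by simp
  then show ?thesis
    using u_N[OF l] v_mid[OF l] PQ_total[OF l] N4 by (simp add: B_entry_def u_def v_def)
qed

text \<open>Permuting by \<open>\<omega>\<close> makes the leading coefficients of \<open>M\<close> (with respect to the row degrees \<open>\<alpha>\<close> or the
  column degrees \<open>\<beta>\<close>) upper triangular.\<close>

definition \<omega> :: "nat \<Rightarrow> nat" where
  "\<omega> i = (if i = 1 then 2 * N else if i = 2 * N then 1 else if i = N then N + 1 else if i = N + 1 then N else i)"

text \<open>\<open>B\<close> equals \<open>L * D\<close> on and below the diagonal, so an ordinary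
  row has leading coefficient \<open>L\<close> at its diagonal place. In the rows N and N+1 it
  stands at the neighbouring place instead, row 1 has it in the last column, and row 2N is constant
  and begins with \<open>L\<close>. The permutation undoes these exchanges.\<close>

lemma leading_row:
  assumes l: "l \<in> BD N L" and i: "i \<in> R" and k: "k \<in> R" "k \<le> i"
  shows "coeff (M L l (\<omega> i) k) (\<alpha> (\<omega> i)) = (if k = i then L else 0)"
proof -
  consider "i = 1" | "i = 2 * N" | "i = N" | "i = N + 1" | "i \<noteq> 1" "i \<noteq> 2 * N" "i \<noteq> N" "i \<noteq> N + 1" by blast
  then show ?thesis
  proof cases
    case 1
    then show ?thesis
      using k N4 A_first_column_last_row[OF l] by (auto simp: \<omega>_def \<alpha>_def M_def)
  next
    case 2
    then show ?thesis
      using k N4 by (auto simp: \<omega>_def \<alpha>_def M_def e_def numeral_2_eq_2)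
  next
    case 3
    have w: "\<omega> i = N + 1" "\<alpha> (N + 1) = 1" using 3 N4 by (auto simp: \<omega>_def \<alpha>_def)
    show ?thesis unfolding w using B_lower[OF l, of k "N + 1"] k 3 N4 by (auto simp: M_def D_def)
  next
    case 4
    have w: "\<omega> i = N" "\<alpha> (N) = 1" using 4 N4 by (auto simp: \<omega>_def \<alpha>_def)
    show ?thesis unfolding w
      using B_lower[OF l, of k N] B_middle[OF l] k 4 N4 by (cases "k = N + 1") (auto simp: M_def D_def)
  next
    case 5
    have w: "\<omega> i = i" "\<alpha> (i) = 1" using 5 N4 by (auto simp: \<omega>_def \<alpha>_def)
    show ?thesis unfolding w using B_lower[OF l, of k i] 5 k i by (auto simp: M_def D_def)
  qed
qed

lemma leading_column:
  assumes l: "l \<in> BD N L" and i: "i \<in> R" and j: "j \<in> R" "j \<le> i"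
  shows "coeff (M L l i (\<omega> j)) (\<beta> (\<omega> j)) = (if j = i then L else 0)"
proof -
  consider "j = 1" | "j = 2 * N" | "j = N" | "j = N + 1" | "j \<noteq> 1" "j \<noteq> 2 * N" "j \<noteq> N" "j \<noteq> N + 1" by blast
  then show ?thesis
  proof cases
    case 1
    then show ?thesis
      using N4 by (auto simp: \<omega>_def \<alpha>_def \<beta>_def M_def e_def numeral_2_eq_2)
  next
    case 2
    then have "i = 2 * N" using i j by auto
    then show ?thesis
      using 2 N4 A_first_column_last_row[OF l] by (auto simp: \<omega>_def \<alpha>_def \<beta>_def M_def)
  next
    case 3
    have w: "\<omega> j = N + 1" "\<beta> (N + 1) = 1" using 3 N4 by (auto simp: \<omega>_def \<alpha>_def \<beta>_def)
    show ?thesis unfolding w using B_lower[OF l, of "N + 1" i] B_middle[OF l] j i 3 N4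
      by (cases "i = N") (auto simp: M_def D_def)
  next
    case 4
    have w: "\<omega> j = N" "\<beta> (N) = 1" using 4 N4 by (auto simp: \<omega>_def \<alpha>_def \<beta>_def)
    show ?thesis unfolding w
      using B_lower[OF l, of N i] i j 4 N4 by (auto simp: M_def D_def)
  next
    case 5
    have w: "\<omega> j = j" "\<beta> (j) = 1" using 5 N4 by (auto simp: \<omega>_def \<alpha>_def \<beta>_def)
    show ?thesis unfolding w using B_lower[OF l, of j i] 5 j i by (auto simp: M_def D_def)
  qed
qed

lemma \<omega>_range: "i \<in> R \<Longrightarrow> \<omega> i \<in> R"
  using N4 by (auto simp: \<omega>_def)

lemma degree_qd: "L \<noteq> 0 \<Longrightarrow> degree (qd L) = 2"
  by (simp add: qd_def degree_power_eq)

text \<open>The quotient of the two products is a constant matrix: it has no poles at \<open>1/L\<close>, \<open>1/K\<close>, and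
  is bounded at infinity.\<close>

lemma product_eq_conjugated:
  assumes l: "l \<in> BD N L" and m: "m \<in> BD N K" and l': "l' \<in> BD N K" and m': "m' \<in> BD N L"
    and LK: "L \<noteq> K"
    and c: "c \<noteq> 0" "\<And>j. j \<in> R \<Longrightarrow> (\<Sum>k\<in>R. v l k * poly (M K m k j) (1 / L)) = c * v m' j"
    and d: "d \<noteq> 0"
      "\<And>j. j \<in> R \<Longrightarrow> (\<Sum>k\<in>R. v (dual m) k * poly (M L (dual l) k j) (1 / K)) = d * v (dual l') j"
  obtains T where
    "\<And>i j. i \<in> R \<Longrightarrow> j \<in> R \<Longrightarrow>
       mm (M L l) (M K m) i j = mm (M K l') (mm (\<lambda>i j. [:T i j:]) (M L m')) i j"
    "\<And>i j. i \<in> R \<Longrightarrow> j \<in> R \<Longrightarrow> i < j \<Longrightarrow> T i j = 0"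
proof -
  note L0 = L0[OF l] and K0 = L0[OF m]
  define H1 where "H1 = dm (M K (dual l'))"
  define H2 where "H2 = dm (M L (dual m'))"
  define X where "X = mm (M L l) (M K m)"
  define Y where "Y = mm H1 (mm X H2)"
  have dvd: "qd L * qd K dvd Y i j" if ij: "i \<in> R" "j \<in> R" for i j
  proof -
    have 1: "qd L dvd Y i j"
      unfolding Y_def mm_def[of H1]
      using dvd_mult_dual_right[OF l m m' c _ ij(2)] unfolding X_def H2_def by (intro dvd_sum dvd_mult) auto
    have "Y = mm (mm H1 X) H2" by (simp add: Y_def mm_assoc)
    then have 2: "qd K dvd Y i j"
      using dvd_mult_dual_left[OF l m l' d ij(1)] unfolding X_def H1_def mm_def[of _ H2]
      by (auto intro!: dvd_sum dvd_mult2)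
    have "1 / L \<noteq> 1 / K" using LK L0 K0 by (simp add: field_simps)
    moreover have "qd L = psmult (L\<^sup>2) ([:- (1 / L), 1:]\<^sup>2)" "qd K = psmult (K\<^sup>2) ([:- (1 / K), 1:]\<^sup>2)"
      by (rule qd_eq[OF L0]) (rule qd_eq[OF K0])
    ultimately show ?thesis
      using coprime_squares_dvd[of "1 / L" "Y i j" "1 / K"] 1 2 qd_dvd_iff[OF L0] qd_dvd_iff[OF K0] L0 K0
      by (simp add: smult_dvd_iff)
  qed
  \<comment> \<open>At both inner indices of the product of \<open>H1\<close>, \<open>X\<close> and
    \<open>H2\<close>, a column degree meets a row degree, and the two add up to 2. Bounding every
    entry of the four factors by degree 2 would only give 8.\<close>
  have deg: "degree (Y i j) \<le> 4" if ij: "i \<in> R" "j \<in> R" for i j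
  proof -
    have X: "degree (X i k) \<le> \<alpha> i + \<beta> k" if "i \<in> R" "k \<in> R" for i k
      unfolding X_def using degree_M(1)[OF l that(1)] degree_M(2)[OF m _ that(2)]
      by (intro degree_mm_le add_mono) auto
    have XH: "degree (mm X H2 k j) \<le> \<alpha> k + 2" if k: "k \<in> R" for k
    proof (rule degree_mm_le)
      fix q assume q: "q \<in> R"
      have "degree (H2 q j) \<le> \<alpha> q" unfolding H2_def degree_dm by (rule degree_M(1)[OF dual_BD[OF m'] q ij(2)])
      moreover have "\<alpha> q \<le> 2" by (simp add: \<alpha>_def)
      ultimately show "degree (X k q) + degree (H2 q j) \<le> \<alpha> k + 2"
        using X[OF k q] by (simp add: \<beta>_def)
    qed
    show ?thesis
      unfolding Y_def
    proof (rule degree_mm_le)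
      fix k assume k: "k \<in> R"
      have "degree (H1 i k) \<le> \<beta> k"
        unfolding H1_def degree_dm by (rule degree_M(2)[OF dual_BD[OF l'] ij(1) k])
      moreover have "\<alpha> k + \<beta> k = 2" by (simp add: \<alpha>_def \<beta>_def)
      ultimately show "degree (H1 i k) + degree (mm X H2 k j) \<le> 4" using XH[OF k] by linarith
    qed
  qed
  have "\<exists>t. Y i j = psmult t (qd L * qd K)" if ij: "i \<in> R" "j \<in> R" for i j
  proof -
    obtain r where r: "Y i j = qd L * qd K * r" using dvd[OF ij] by (auto elim: dvdE)
    show ?thesis
    proof (cases "r = 0")
      case False
      have "degree (qd L * qd K * r) = 4 + degree r"
        using False degree_qd[OF L0] degree_qd[OF K0] by (simp add: degree_mult_eq)
      then have "degree r = 0" using deg[OF ij] r by simp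
      then obtain t where "r = [:t:]" by (rule degree_eq_zeroE)
      then show ?thesis using r by (auto intro: exI[of _ t])
    qed (use r in \<open>auto intro: exI[of _ 0]\<close>)
  qed
  then obtain T where T: "\<And>i j. i \<in> R \<Longrightarrow> j \<in> R \<Longrightarrow> Y i j = psmult (T i j) (qd L * qd K)"
    by metis
  show thesis
  proof
    fix i j assume ij: "i \<in> R" "j \<in> R"
    have "mm (M K l') (mm Y (M L m')) i j = mm (mm (M K l') H1) (mm X (mm H2 (M L m'))) i j"
      by (simp add: Y_def mm_assoc)
    also have "\<dots> = qd K * mm X (mm H2 (M L m')) i j"
      using M_dm_dual[OF l' ij(1)] ij by (intro mm_scalar_left) (auto simp: H1_def)
    also have "mm X (mm H2 (M L m')) i j = qd L * X i j"
      using dm_dual_M[OF m' _ ij(2)] ij by (intro mm_scalar_right) (auto simp: H2_def)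
    finally have 1: "mm (M K l') (mm Y (M L m')) i j = qd L * qd K * X i j" by (simp add: mult_ac)
    have "mm Y (M L m') k j = qd L * qd K * mm (\<lambda>i j. [:T i j:]) (M L m') k j" if "k \<in> R" for k
      unfolding mm_def sum_distrib_left using T[OF that] by (intro sum.cong) auto
    then have "mm (M K l') (mm Y (M L m')) i j = qd L * qd K * mm (M K l') (mm (\<lambda>i j. [:T i j:]) (M L m')) i j"
      unfolding mm_def[of "M K l'"] sum_distrib_left by (intro sum.cong) (auto simp: mult_ac)
    with 1 show "mm (M L l) (M K m) i j = mm (M K l') (mm (\<lambda>i j. [:T i j:]) (M L m')) i j"
      by (simp add: X_def)
  next
    fix i j assume ij: "i \<in> R" "j \<in> R" "i < j"
    \<comment> \<open>At \<open>z = 0\<close> each factor is a lower triangular matrix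
      \<open>A\<close>, up to signs, while \<open>qd L\<close> and \<open>qd K\<close> take the
      value 1. Hence \<open>T\<close> is the value of \<open>Y\<close> there.\<close>
    define low where "low X \<longleftrightarrow> (\<forall>i\<in>R. \<forall>j\<in>R. i < j \<longrightarrow> poly (X i j) 0 = (0::complex))" for X :: "nat \<Rightarrow> nat \<Rightarrow> complex poly"
    have low_mm: "low (mm X Y)" if "low X" "low Y" for X Y
      unfolding low_def mm_def poly_sum
    proof (intro ballI impI sum.neutral)
      fix i j k assume "i \<in> R" "j \<in> R" "i < j" "k \<in> R"
      then show "poly (X i k * Y k j) 0 = 0" using that unfolding low_def by (cases "i < k") auto
    qed
    have low_dm: "low (dm X)" if "low X" for X using that by (auto simp: low_def dm_def)
    have low_M: "low (M L l)" if "l \<in> BD N L" for l L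
      using A_upper[OF that] by (auto simp: low_def M_def)
    have "low Y"
      unfolding Y_def X_def H1_def H2_def
      by (intro low_mm low_dm low_M[OF l] low_M[OF m] low_M[OF dual_BD[OF l']] low_M[OF dual_BD[OF m']])
    then have "poly (Y i j) 0 = 0" using ij unfolding low_def by blast
    then show "T i j = 0" unfolding T[OF ij(1,2)] by simp
  qed
qed

lemma product_eq:
  assumes l: "l \<in> BD N L" and m: "m \<in> BD N K" and l': "l' \<in> BD N K" and m': "m' \<in> BD N L"
    and LK: "L \<noteq> K"
    and c: "c \<noteq> 0" "\<And>j. j \<in> R \<Longrightarrow> (\<Sum>k\<in>R. v l k * poly (M K m k j) (1 / L)) = c * v m' j"
    and d: "d \<noteq> 0"
      "\<And>j. j \<in> R \<Longrightarrow> (\<Sum>k\<in>R. v (dual m) k * poly (M L (dual l) k j) (1 / K)) = d * v (dual l') j"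
    and ij: "i \<in> R" "j \<in> R"
  shows "mm (M L l) (M K m) i j = mm (M K l') (M L m') i j"
proof -
  note L0 = L0[OF l] and K0 = L0[OF m]
  from product_eq_conjugated[OF l m l' m' LK c d]
  obtain T where T: "\<And>i j. i \<in> R \<Longrightarrow> j \<in> R \<Longrightarrow>
       mm (M L l) (M K m) i j = mm (M K l') (mm (\<lambda>i j. [:T i j:]) (M L m')) i j"
    and low: "\<And>i j. i \<in> R \<Longrightarrow> j \<in> R \<Longrightarrow> i < j \<Longrightarrow> T i j = 0" by blast
  define r where "r L l i k = coeff (M L l i k) (\<alpha> i)" for L l i k
  define s where "s L l k j = coeff (M L l k j) (\<beta> j)" for L l k j
  have lead: "coeff (mm X Y i j) (a + b) = (\<Sum>k\<in>R. coeff (X i k) a * coeff (Y k j) b)"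
    if "\<And>k. k \<in> R \<Longrightarrow> degree (X i k) \<le> a" "\<And>k. k \<in> R \<Longrightarrow> degree (Y k j) \<le> b" for X Y i j a b
    unfolding mm_def coeff_sum using that by (intro sum.cong refl coeff_mult_bound) auto
  \<comment> \<open>The constant matrix \<open>T\<close> does not raise degrees, so the coefficient
    at \<open>\<alpha> i + \<beta> j\<close> sees only the leading coefficients of the outer factors
    on either side.\<close>
  have V: "(\<Sum>k\<in>R. r K l' i k * (\<Sum>q\<in>R. T k q * s L m' q j)) = (\<Sum>k\<in>R. r L l i k * s K m k j)"
    if ij: "i \<in> R" "j \<in> R" for i j
  proof -
    have const: "degree (mm (\<lambda>i j. [:T i j:]) (M L m') k j) \<le> \<beta> j"
      "coeff (mm (\<lambda>i j. [:T i j:]) (M L m') k j) (\<beta> j) = (\<Sum>q\<in>R. T k q * s L m' q j)" if "k \<in> R" for k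
      subgoal by (rule degree_mm_le) (simp add: degree_M(2)[OF m' _ ij(2)])
      subgoal by (simp add: mm_def coeff_sum s_def)
      done
    have "coeff (mm (M L l) (M K m) i j) (\<alpha> i + \<beta> j) = (\<Sum>k\<in>R. r L l i k * s K m k j)"
      unfolding r_def s_def by (rule lead) (use degree_M(1)[OF l ij(1)] degree_M(2)[OF m _ ij(2)] in auto)
    moreover have "coeff (mm (M K l') (mm (\<lambda>i j. [:T i j:]) (M L m')) i j) (\<alpha> i + \<beta> j)
        = (\<Sum>k\<in>R. r K l' i k * (\<Sum>q\<in>R. T k q * s L m' q j))"
      using lead[of "M K l'" i "\<alpha> i" "mm (\<lambda>i j. [:T i j:]) (M L m')" j "\<beta> j"] const
        degree_M(1)[OF l' ij(1)] unfolding r_def by simp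
    ultimately show ?thesis using T[OF ij] by simp
  qed
  have "T i j = (if i = j then 1 else 0)" if ij: "i \<in> R" "j \<in> R" for i j
  proof (rule lower_triangular_eq_one[where ?U1.0 = "\<lambda>i. r K l' (\<omega> i)" and ?U2.0 = "\<lambda>q j. s L m' q (\<omega> j)",
        OF K0 L0 _ _ low _ ij])
    fix i k assume "i \<in> R" "k \<in> R" "k \<le> i"
    then show "r K l' (\<omega> i) k = (if k = i then K else 0)" "s L m' i (\<omega> k) = (if k = i then L else 0)"
      unfolding r_def s_def using leading_row[OF l'] leading_column[OF m'] by auto
  next
    fix i j assume ij: "i \<in> R" "j \<in> R" "j \<le> i"
    have "(\<Sum>k\<in>R. r K l' (\<omega> i) k * (\<Sum>q\<in>R. T k q * s L m' q (\<omega> j))) = (\<Sum>k\<in>R. r L l (\<omega> i) k * s K m k (\<omega> j))"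
      by (rule V[OF \<omega>_range[OF ij(1)] \<omega>_range[OF ij(2)]])
    also have "\<dots> = (\<Sum>k\<in>R. if k = i then if j = i then L * K else 0 else 0)"
    proof (rule sum.cong)
      fix k assume k: "k \<in> R"
      show "r L l (\<omega> i) k * s K m k (\<omega> j) = (if k = i then if j = i then L * K else 0 else 0)"
        unfolding r_def s_def
        using leading_row[OF l ij(1) k] leading_column[OF m k ij(2)] ij(3) by (cases "k \<le> i") auto
    qed simp
    finally show "(\<Sum>k\<in>R. r K l' (\<omega> i) k * (\<Sum>q\<in>R. T k q * s L m' q (\<omega> j))) = (if j = i then K * L else 0)"
      using ij by simp
  qed auto
  then have "mm (\<lambda>i j. [:T i j:]) (M L m') k j = M L m' k j" if "k \<in> R" for k
    using that by (subst mm_scalar_left[where c = 1]) auto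
  then show ?thesis unfolding T[OF ij] by (intro mm_cong) auto
qed

section \<open>Points and isotropic row vectors\<close>

text \<open>Up to scaling, \<open>v\<close> maps \<open>BD N L\<close> bijectively onto the good isotropic vectors, with inverse \<open>ptv L\<close>.\<close>

definition good :: "(nat \<Rightarrow> complex) \<Rightarrow> bool" where
  "good w \<longleftrightarrow> (\<forall>j\<in>{1..N+1}. w j \<noteq> 0) \<and> w (2 * N) \<noteq> 0 \<and> (\<forall>k\<in>{2..<N}. G w k \<noteq> 0)"

definition iso :: "(nat \<Rightarrow> complex) \<Rightarrow> bool" where
  "iso w \<longleftrightarrow> G w N = 0"

text \<open>By \<open>v_low\<close> and \<open>v_mid\<close> the unbarred coordinates are ratios of
  consecutive entries. The barred ones come from \<open>G_v\<close>, where consecutive partial sums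
  have ratio \<open>- lb l k / l k\<close>.\<close>

definition ptv :: "complex \<Rightarrow> (nat \<Rightarrow> complex) \<Rightarrow> pt" where
  "ptv L w = mk_pt N (\<lambda>k. w k / w (k + 1))
     (\<lambda>k. if k = 1 then L * w (2 * N) / w 2 else - (G w k * w k) / (w (k + 1) * G w (k - 1)))"

lemma rv_1 [simp]: "rv (Suc 0) = 2 * N"
  by (simp add: rv_def)

lemma G_1: "G w 1 = sg 1 * w 1 * w (2 * N)"
  using G_Suc[of w 0] by simp

lemma goodD:
  assumes "good w"
  shows "\<And>j. 1 \<le> j \<Longrightarrow> j \<le> N + 1 \<Longrightarrow> w j \<noteq> 0" "w (2 * N) \<noteq> 0" "\<And>k. 1 \<le> k \<Longrightarrow> k < N \<Longrightarrow> G w k \<noteq> 0"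
proof -
  show 1: "w j \<noteq> 0" if "1 \<le> j" "j \<le> N + 1" for j using assms that by (auto simp: good_def)
  show 2: "w (2 * N) \<noteq> 0" using assms by (auto simp: good_def)
  show "G w k \<noteq> 0" if "1 \<le> k" "k < N" for k
    using assms that 1[of 1] 2 G_1[of w] by (cases "k = 1") (auto simp: good_def)
qed

lemma G_scale: "G (\<lambda>j. c * w j) k = c\<^sup>2 * G w k"
  by (simp add: G_def sum_distrib_left power2_eq_square mult_ac)

lemma G_cong: assumes "\<And>j. j \<in> R \<Longrightarrow> w j = w' j" "k \<le> 2 * N" shows "G w k = G w' k"
  unfolding G_def
proof (rule sum.cong)
  fix i assume "i \<in> {1..k}"
  then have "i \<in> R" "rv i \<in> R" using assms(2) by (auto simp: rv_def)
  then show "sg i * w i * w (rv i) = sg i * w' i * w' (rv i)" using assms(1) by simp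
qed simp

lemma good_scale: "c \<noteq> 0 \<Longrightarrow> good (\<lambda>j. c * w j) \<longleftrightarrow> good w"
  by (simp add: good_def G_scale)

lemma good_cong: assumes "\<And>j. j \<in> R \<Longrightarrow> w j = w' j" shows "good w \<longleftrightarrow> good w'"
proof -
  have "G w k = G w' k" if "k \<in> {2..<N}" for k using that by (intro G_cong assms) auto
  moreover have "w j = w' j" if "j \<in> {1..N+1}" for j using that N4 by (intro assms) auto
  moreover have "w (2 * N) = w' (2 * N)" using N4 by (intro assms) auto
  ultimately show ?thesis by (simp add: good_def)
qed

lemma mk_pt_cong:
  "(\<And>k. 1 \<le> k \<Longrightarrow> k \<le> N \<Longrightarrow> f k = f' k) \<Longrightarrow> (\<And>k. 1 \<le> k \<Longrightarrow> k < N \<Longrightarrow> g k = g' k) \<Longrightarrow> mk_pt N f g = mk_pt N f' g'"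
  unfolding mk_pt_def by (rule restrict_ext) auto

lemma ptv_cong: assumes "\<And>j. j \<in> R \<Longrightarrow> w j = w' j" shows "ptv L w = ptv L w'"
  unfolding ptv_def
proof (rule mk_pt_cong)
  fix k assume "1 \<le> k" "k \<le> N"
  then show "w k / w (k + 1) = w' k / w' (k + 1)" using assms[of k] assms[of "k + 1"] N4 by simp
next
  fix k assume "1 \<le> k" "k < N"
  then show "(if k = 1 then L * w (2 * N) / w 2 else - (G w k * w k) / (w (k + 1) * G w (k - 1)))
     = (if k = 1 then L * w' (2 * N) / w' 2 else - (G w' k * w' k) / (w' (k + 1) * G w' (k - 1)))"
    using assms[of k] assms[of "k + 1"] assms[of 2] assms[of "2 * N"] N4 G_cong[of w w' k, OF assms] G_cong[of w w' "k - 1", OF assms]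
    by simp
qed

lemma ptv_scale: "c \<noteq> 0 \<Longrightarrow> ptv L (\<lambda>j. c * w j) = ptv L w"
  unfolding ptv_def G_scale by (rule mk_pt_cong) (auto simp: power2_eq_square)

context
  fixes w :: "nat \<Rightarrow> complex" and L :: complex
  assumes w: "good w" "iso w" and L: "L \<noteq> 0"
begin

lemma ptv_low: "1 \<le> k \<Longrightarrow> k \<le> N \<Longrightarrow> ptv L w k = w k / w (k + 1)"
  and ptv_bar: "1 < k \<Longrightarrow> k < N \<Longrightarrow> lb (ptv L w) k = - (G w k * w k) / (w (k + 1) * G w (k - 1))"
  and ptv_bar_1: "lb (ptv L w) 1 = L * w (2 * N) / w 2"
  using N4 by (simp_all add: ptv_def)

lemma P_ptv: "k \<le> N \<Longrightarrow> P (ptv L w) k = w 1 / w (k + 1)"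
proof (induction k)
  case 0
  then show ?case using goodD(1)[OF w(1), of 1] N4 by simp
next
  case (Suc k)
  then show ?case
    using P_step[of "Suc k" "ptv L w"] ptv_low[of "Suc k"] goodD(1)[OF w(1), of "Suc k"] N4 by simp
qed

lemma Q_ptv: "1 \<le> k \<Longrightarrow> k < N \<Longrightarrow> Q (ptv L w) k = sg k * (L / w 1) * G w k / w (k + 1)"
proof (induction k rule: nat_induct_at_least)
  case base
  have "Q (ptv L w) 1 = lb (ptv L w) 1" by (simp add: Q_def)
  then show ?case using ptv_bar_1 goodD(1)[OF w(1), of 1] N4 G_1[of w] by (simp add: numeral_2_eq_2)
next
  case (Suc k)
  then have "w (Suc k) \<noteq> 0" "G w k \<noteq> 0" using goodD[OF w(1)] by auto
  then show ?case
    using Suc Q_step[of "Suc k" "ptv L w"] ptv_bar[of "Suc k"] by (simp add: sg_Suc)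
qed

lemma G_N1: "G w (N - 1) = sg (N - 1) * w N * w (N + 1)"
proof -
  have "rv N = N + 1" "Suc (N - 1) = N" using N4 by (auto simp: rv_def)
  then have "G w (N - 1) - sg (N - 1) * w N * w (N + 1) = 0"
    using G_Suc[of w "N - 1"] w(2) sg_Suc[of "N - 1"] by (simp add: iso_def)
  then show ?thesis by simp
qed

lemma Q_ptv_N1: "Q (ptv L w) (N - 1) = (L / w 1) * w (N + 1)"
proof -
  have nz: "w N \<noteq> 0" using goodD(1)[OF w(1)] N4 by auto
  have *: "s * a * (s * b * c) / b = (s * s) * (a * c)" if "b \<noteq> 0" for s a b c :: complex
    using that by (simp add: field_simps)
  have "Q (ptv L w) (N - 1) = sg (N - 1) * (L / w 1) * (sg (N - 1) * w N * w (N + 1)) / w N"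
    using Q_ptv[of "N - 1"] G_N1 N4 by simp
  then show ?thesis unfolding *[OF nz] by simp
qed

lemma ptv_BD: "ptv L w \<in> BD N L"
proof -
  have nz: "w N \<noteq> 0" "w (N + 1) \<noteq> 0" "w 1 \<noteq> 0" using goodD(1)[OF w(1)] N4 by auto
  have e: "P (ptv L w) N * Q (ptv L w) (N - 1) = L"
    using P_ptv[of N] Q_ptv_N1 nz by simp
  show ?thesis
    unfolding ptv_def
  proof (rule mk_pt_BD)
    fix k assume "1 \<le> k" "k \<le> N"
    then show "w k / w (k + 1) \<noteq> 0" using goodD(1)[OF w(1)] by auto
  next
    fix k assume k: "1 \<le> k" "k < N"
    then have "w (k + 1) \<noteq> 0" "w k \<noteq> 0" "G w k \<noteq> 0" "w 2 \<noteq> 0" "w (2 * N) \<noteq> 0" "k \<noteq> 1 \<Longrightarrow> G w (k - 1) \<noteq> 0"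
      using goodD[OF w(1)] by auto
    then show "(if k = 1 then L * w (2 * N) / w 2 else - (G w k * w k) / (w (k + 1) * G w (k - 1))) \<noteq> 0"
      using L by simp
  qed (use e in \<open>simp add: ptv_def\<close>)
qed

text \<open>The factor is forced: by \<open>v_first\<close> a last row always begins with
  \<open>L\<close>.\<close>

lemma v_ptv: assumes "j \<in> R" shows "v (ptv L w) j = L / w 1 * w j"
proof -
  note B = ptv_BD
  have nz: "w N \<noteq> 0" "w (N + 1) \<noteq> 0" "w 1 \<noteq> 0" "w 2 \<noteq> 0" using goodD(1)[OF w(1)] N4 by auto
  have "1 \<le> j" "j \<le> 2 * N" using assms by auto
  then consider "j \<le> N" | "j = N + 1" | "N + 1 < j" "j < 2 * N" | "j = 2 * N" by linarith
  then show ?thesis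
  proof cases
    case 1
    then show ?thesis using v_low[OF B, of j] P_ptv[of "j - 1"] assms by simp
  next
    case 2
    then show ?thesis using v_mid[OF B] Q_ptv_N1 by simp
  next
    case 3
    define i where "i = rv j"
    have i: "1 < i" "i < N" "j = rv i" "Suc (i - 1) = i" using 3 by (auto simp: i_def rv_def)
    have nzi: "w i \<noteq> 0" "w (i + 1) \<noteq> 0" "G w (i - 1) \<noteq> 0" "w (i - 1 + 1) \<noteq> 0" using goodD[OF w(1)] i by auto
    have "v (ptv L w) j = Q (ptv L w) (i - 1) * (1 + lb (ptv L w) i / ptv L w i)"
      using v_high[OF B i(1,2)] i by simp
    also have "\<dots> = sg (i - 1) * (L / w 1) * G w (i - 1) / w i * (1 - G w i / G w (i - 1))"
    proof -
      have "lb (ptv L w) i / ptv L w i = - (G w i / G w (i - 1))"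
        using ptv_bar[of i] ptv_low[of i] i nzi by simp
      moreover have "Q (ptv L w) (i - 1) = sg (i - 1) * (L / w 1) * G w (i - 1) / w i"
        using Q_ptv[of "i - 1"] i by simp
      ultimately show ?thesis by simp
    qed
    also have "\<dots> = (L / w 1) * (sg (i - 1) * (G w (i - 1) - G w i) / w i)"
      using nzi nz by (simp add: field_simps)
    also have "G w (i - 1) - G w i = - (sg i * w i * w j)"
      using G_Suc[of w "i - 1"] i by simp
    also have "sg (i - 1) * (- (sg i * w i * w j)) / w i = (sg (i - 1) * sg (i - 1)) * w j"
      using sg_Suc[of "i - 1"] i nzi by simp
    finally show ?thesis by simp
  next
    case 4
    then show ?thesis using v_last[OF B] ptv_bar_1 ptv_low[of 1] nz N4 by (simp add: numeral_2_eq_2)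
  qed
qed

end

lemma iso_v: "l \<in> BD N L \<Longrightarrow> iso (v l)"
  by (simp add: iso_def G_v_N)

lemma good_v: assumes l: "l \<in> BD N L" shows "good (v l)"
proof -
  have "v l j \<noteq> 0" if "1 \<le> j" "j \<le> N + 1" for j
    using that v_low[OF l, of j] v_mid[OF l] L0[OF l] P_nonzero[OF l, of "j - 1"] Q_nonzero[OF l, of "N - 1"]
    by (cases "j \<le> N") (auto simp: le_Suc_eq)
  moreover have "v l (2 * N) \<noteq> 0"
    using v_last[OF l] BD_nonzero[OF l, of 1] BD_bar_nonzero[OF l, of 1] N4 by simp
  moreover have "G (v l) k \<noteq> 0" if "2 \<le> k" "k < N" for k
    using that G_v[OF l, of k] L0[OF l] P_nonzero[OF l, of k] Q_nonzero[OF l, of k] by simp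
  ultimately show ?thesis by (auto simp: good_def)
qed

lemma ptv_v: assumes l: "l \<in> BD N L" shows "ptv L (v l) = l"
proof (rule pt_eqI[OF ptv_BD[OF good_v[OF l] iso_v[OF l] L0[OF l]] l])
  note nz = P_nonzero[OF l] Q_nonzero[OF l] L0[OF l]
  fix k assume k: "1 \<le> k" "k \<le> N"
  show "ptv L (v l) k = l k"
  proof (cases "k = N")
    case True
    have "v l N = l N * Q l (N - 1)"
      using v_low[OF l, of N] PQ_total(1)[OF l, symmetric] nz(1)[of "N - 1"] N4 by simp
    then show ?thesis
      using True k v_mid[OF l] nz(2)[of "N - 1"] by (simp add: ptv_def)
  next
    case False
    then show ?thesis
      using k v_low[OF l, of k] v_low[OF l, of "k + 1"] P_step[of k l] nz(1)[of "k - 1"] nz(1)[of k] nz(3)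
      by (simp add: ptv_def)
  qed
next
  note nz = P_nonzero[OF l] Q_nonzero[OF l] L0[OF l]
  fix k assume k: "1 \<le> k" "k < N"
  show "lb (ptv L (v l)) k = lb l k"
  proof (cases "k = 1")
    case True
    have "v l 2 = L / l 1" using v_low[OF l, of 2] N4 by (simp add: P_def)
    then show ?thesis
      using True k v_last[OF l] nz(3) BD_nonzero[OF l, of 1] N4 by (simp add: ptv_def)
  next
    case False
    then have k': "1 \<le> k - 1" "k - 1 < N" "sg k = - sg (k - 1)" using k sg_Suc[of "k - 1"] by auto
    have e: "lb (ptv L (v l)) k = - (G (v l) k * v l k) / (v l (k + 1) * G (v l) (k - 1))"
      using False k by (simp add: ptv_def)
    have e': "G (v l) k = sg k * Q l k * (L / P l k)" "v l k = L / P l (k - 1)" "v l (k + 1) = L / P l k"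
      "G (v l) (k - 1) = sg (k - 1) * Q l (k - 1) * (L / P l (k - 1))" "Q l k = Q l (k - 1) * lb l k"
      using G_v[OF l, of k] G_v[OF l, of "k - 1"] v_low[OF l, of k] v_low[OF l, of "k + 1"] Q_step[of k l] k k' by auto
    have "P l k \<noteq> 0" "P l (k - 1) \<noteq> 0" "Q l (k - 1) \<noteq> 0" using nz k by auto
    then show ?thesis unfolding e e' k'(3) using nz(3) by simp
  qed
qed

section \<open>Solutions of the matrix equation in terms of row vectors\<close>

definition vm :: "complex \<Rightarrow> pt \<Rightarrow> complex \<Rightarrow> (nat \<Rightarrow> complex) \<Rightarrow> nat \<Rightarrow> complex" where
  "vm K m z w j = (\<Sum>k\<in>R. w k * poly (M K m k j) z)"

lemma iso_iff: "iso w \<longleftrightarrow> (\<Sum>k\<in>R. sg k * w k * w (rv k)) = 0"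
  using G_full[of w] by (simp add: iso_def G_def)

lemma iso_vm: assumes m: "m \<in> BD N K" and w: "iso w" shows "iso (vm K m z w)"
proof -
  have "(\<Sum>k\<in>R. sg k * vm K m z w k * vm K m z w (rv k))
     = (\<Sum>k\<in>R. \<Sum>a\<in>R. \<Sum>b\<in>R. w a * w b * poly (psmult (sg k) (M K m a k * M K m b (rv k))) z)"
  proof (rule sum.cong)
    fix k
    have "sg k * vm K m z w k * vm K m z w (rv k) = sg k * (\<Sum>a\<in>R. \<Sum>b\<in>R. w a * poly (M K m a k) z * (w b * poly (M K m b (rv k)) z))"
      unfolding mult.assoc[of "sg k"] vm_def by (simp only: sum_product)
    then show "sg k * vm K m z w k * vm K m z w (rv k) = (\<Sum>a\<in>R. \<Sum>b\<in>R. w a * w b * poly (psmult (sg k) (M K m a k * M K m b (rv k))) z)"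
      unfolding sum_distrib_left by (simp add: mult_ac)
  qed simp
  also have "\<dots> = (\<Sum>a\<in>R. \<Sum>b\<in>R. \<Sum>k\<in>R. w a * w b * poly (psmult (sg k) (M K m a k * M K m b (rv k))) z)"
    by (subst sum.swap, rule sum.cong[OF refl], rule sum.swap)
  also have "\<dots> = (\<Sum>a\<in>R. \<Sum>b\<in>R. if b = rv a then poly (qd K) z * (sg a * w a * w (rv a)) else 0)"
    by (intro sum.cong[OF refl], subst sum_distrib_left[symmetric], subst poly_sum[symmetric], subst M_orthogonal[OF m]) auto
  also have "\<dots> = (\<Sum>a\<in>R. poly (qd K) z * (sg a * w a * w (rv a)))"
    using rv_range by (intro sum.cong[OF refl], subst sum.delta) auto
  also have "\<dots> = 0" using w by (simp only: sum_distrib_left[symmetric] iso_iff) simp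
  finally show ?thesis by (simp only: iso_iff)
qed

text \<open>Up to the factor \<open>qd K\<close>, the sign conjugate of \<open>M K (dual m)\<close>
  inverts \<open>M K m\<close>. Wherever this factor is nonzero, this produces a preimage of a
  prescribed row vector.\<close>

lemma vm_inverse:
  assumes m: "m \<in> BD N K" and j: "j \<in> R"
  shows "vm K m z (\<lambda>j. sg j * vm K (dual m) z (\<lambda>i. sg i * w i) j) j = poly (qd K) z * w j"
proof -
  have "vm K m z (\<lambda>j. sg j * vm K (dual m) z (\<lambda>i. sg i * w i) j) j
     = (\<Sum>k\<in>R. \<Sum>i\<in>R. w i * poly (dm (M K (dual m)) i k * M K m k j) z)"
    unfolding vm_def sum_distrib_left sum_distrib_right by (intro sum.cong refl) (simp add: dm_def mult_ac)
  also have "\<dots> = (\<Sum>i\<in>R. \<Sum>k\<in>R. w i * poly (dm (M K (dual m)) i k * M K m k j) z)"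
    by (rule sum.swap)
  also have "\<dots> = (\<Sum>i\<in>R. w i * poly (mm (dm (M K (dual m))) (M K m) i j) z)"
    by (simp only: mm_def poly_sum sum_distrib_left)
  also have "\<dots> = (\<Sum>i\<in>R. if i = j then poly (qd K) z * w j else 0)"
    using dm_dual_M[OF m _ j] by (intro sum.cong refl) auto
  finally show ?thesis using j by simp
qed

lemma M_solution_iff:
  "M_solution N L K (l, m) (l', m') \<longleftrightarrow> l' \<in> BD N K \<and> m' \<in> BD N L \<and>
     (\<forall>i\<in>R. \<forall>j\<in>R. mm (M L l) (M K m) i j = mm (M K l') (M L m') i j)"
proof -
  have e: "M_mat N L l $$ (i, j) = M L l (i + 1) (j + 1)" if "i < 2 * N" "j < 2 * N" for i j L l
    using that by (simp add: M_mat_def M_def e_def)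
  have prod: "(M_mat N L l * M_mat N K m) $$ (i, j) = mm (M L l) (M K m) (i + 1) (j + 1)"
    if "i < 2 * N" "j < 2 * N" for i j L l K m
  proof -
    have "(M_mat N L l * M_mat N K m) $$ (i, j) = (\<Sum>k<2*N. M_mat N L l $$ (i, k) * M_mat N K m $$ (k, j))"
      using that by (simp add: M_mat_def scalar_prod_def atLeast0LessThan)
    also have "\<dots> = (\<Sum>k<2*N. M L l (i + 1) (k + 1) * M K m (k + 1) (j + 1))"
      using that e by (intro sum.cong) auto
    also have "\<dots> = mm (M L l) (M K m) (i + 1) (j + 1)"
      unfolding mm_def
      by (rule sum.reindex_bij_witness[where i = "\<lambda>k. k - 1" and j = "\<lambda>k. k + 1"]) auto
    finally show ?thesis .
  qed
  have "M_mat N L l * M_mat N K m = M_mat N K l' * M_mat N L m' \<longleftrightarrow>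
      (\<forall>i<2*N. \<forall>j<2*N. mm (M L l) (M K m) (i + 1) (j + 1) = mm (M K l') (M L m') (i + 1) (j + 1))"
    using prod by (auto simp: mat_eq_iff M_mat_def)
  also have "\<dots> \<longleftrightarrow> (\<forall>i\<in>R. \<forall>j\<in>R. mm (M L l) (M K m) i j = mm (M K l') (M L m') i j)"
  proof (intro iffI ballI allI impI)
    fix i j assume *: "\<forall>i<2*N. \<forall>j<2*N. mm (M L l) (M K m) (i + 1) (j + 1) = mm (M K l') (M L m') (i + 1) (j + 1)"
      and ij: "i \<in> R" "j \<in> R"
    from ij have "i - 1 < 2 * N" "j - 1 < 2 * N" "i - 1 + 1 = i" "j - 1 + 1 = j" by auto
    with * show "mm (M L l) (M K m) i j = mm (M K l') (M L m') i j" by metis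
  qed auto
  finally show ?thesis by (simp add: M_solution_def)
qed

lemma M_solution_sym:
  assumes "l \<in> BD N L" "m \<in> BD N K" "M_solution N L K (l, m) (l', m')"
  shows "M_solution N K L (l', m') (l, m)"
  using assms unfolding M_solution_iff by auto

text \<open>Reflection reverses the order of the factors. Statements about the second component of a
  solution thereby apply to the first one as well, with \<open>L\<close> and \<open>K\<close>
  exchanged.\<close>

lemma M_solution_dual:
  assumes "l \<in> BD N L" "m \<in> BD N K" "M_solution N L K (l, m) (l', m')"
  shows "M_solution N K L (dual m, dual l) (dual m', dual l')"
  using assms rv_range unfolding M_solution_iff by (auto simp: dual_BD mm_dual simp del: atLeastAtMost_iff)

text \<open>At \<open>z = 1/L\<close> the right-hand side of the equation has rank one and row space spanned by \<open>v m'\<close>.\<close>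

lemma M_solution_row:
  assumes l: "l \<in> BD N L" and m: "m \<in> BD N K" and s: "M_solution N L K (l, m) (l', m')"
  obtains c where "\<And>j. j \<in> R \<Longrightarrow> vm K m (1 / L) (v l) j = c * v m' j"
proof
  note L0 = L0[OF l]
  fix j assume j: "j \<in> R"
  have "2 * N \<in> R" using N4 by simp
  then have "poly (mm (M L l) (M K m) (2 * N) j) (1 / L) = poly (mm (M K l') (M L m') (2 * N) j) (1 / L)"
    using s j unfolding M_solution_iff by simp
  moreover have "poly (mm (M L l) (M K m) (2 * N) j) (1 / L) = vm K m (1 / L) (v l) j"
    unfolding mm_def vm_def poly_sum using poly_M_special[OF L0] u_last[OF l] L0 by (intro sum.cong) auto
  moreover have "poly (mm (M K l') (M L m') (2 * N) j) (1 / L)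
      = (\<Sum>k\<in>R. poly (M K l' (2 * N) k) (1 / L) * u m' k / L) * v m' j"
    unfolding mm_def poly_sum sum_distrib_right using poly_M_special[OF L0] by (intro sum.cong) auto
  ultimately show "vm K m (1 / L) (v l) j = (\<Sum>k\<in>R. poly (M K l' (2 * N) k) (1 / L) * u m' k / L) * v m' j" by simp
qed

definition F :: "complex \<Rightarrow> complex \<Rightarrow> pt \<times> pt \<Rightarrow> pt \<times> pt" where
  "F L K p = (dual (ptv K (vm L (dual (fst p)) (1 / K) (v (dual (snd p))))),
              ptv L (vm K (snd p) (1 / L) (v (fst p))))"

definition gen :: "complex \<Rightarrow> complex \<Rightarrow> (pt \<times> pt) set" where
  "gen L K = {(l, m). l \<in> BD N L \<and> m \<in> BD N K \<and> good (vm K m (1 / L) (v l)) \<and>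
     good (vm L (dual l) (1 / K) (v (dual m)))}"

text \<open>The vector is a multiple of \<open>v m'\<close>, so a single nonzero coordinate already
  makes it good.\<close>

lemma M_solution_second:
  assumes l: "l \<in> BD N L" and m: "m \<in> BD N K" and s: "M_solution N L K (l, m) (l', m')"
    and nz: "vm K m (1 / L) (v l) 1 \<noteq> 0"
  shows "good (vm K m (1 / L) (v l))" "ptv L (vm K m (1 / L) (v l)) = m'"
proof -
  obtain c where c: "\<And>j. j \<in> R \<Longrightarrow> vm K m (1 / L) (v l) j = c * v m' j"
    using M_solution_row[OF l m s] by blast
  have m': "m' \<in> BD N L" using s by (simp add: M_solution_iff)
  have "c \<noteq> 0" using nz c[of 1] N4 by auto
  then show "good (vm K m (1 / L) (v l))" "ptv L (vm K m (1 / L) (v l)) = m'"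
    using good_cong[of "vm K m (1 / L) (v l)" "\<lambda>j. c * v m' j", OF c]
      ptv_cong[of "vm K m (1 / L) (v l)" "\<lambda>j. c * v m' j", OF c]
      good_scale[of c "v m'"] ptv_scale[of c L "v m'"] good_v[OF m'] ptv_v[OF m'] by auto
qed

text \<open>This covers \<open>L = K\<close> as well, where it shows that the obvious solution
  \<open>(l, m)\<close> is the only one on \<open>gen L L\<close>.\<close>

lemma M_solution_unique:
  assumes "(l, m) \<in> gen L K" and s: "M_solution N L K (l, m) (l', m')"
  shows "(l', m') = F L K (l, m)"
proof -
  have l: "l \<in> BD N L" and m: "m \<in> BD N K" and g: "good (vm K m (1 / L) (v l))"
      "good (vm L (dual l) (1 / K) (v (dual m)))"
    using assms(1) by (auto simp: gen_def)
  have l': "l' \<in> BD N K" using s by (simp add: M_solution_iff)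
  have "dual l' = ptv K (vm L (dual l) (1 / K) (v (dual m)))"
    using M_solution_second(2)[OF dual_BD[OF m] dual_BD[OF l] M_solution_dual[OF l m s]] goodD(1)[OF g(2), of 1] by simp
  moreover have "m' = ptv L (vm K m (1 / L) (v l))"
    using M_solution_second(2)[OF l m s] goodD(1)[OF g(1), of 1] by simp
  ultimately show ?thesis using dual_dual[OF l'] by (simp add: F_def)
qed

lemma F_BD:
  assumes "p \<in> gen L K" shows "F L K p \<in> BD N K \<times> BD N L"
proof -
  obtain l m where p: "p = (l, m)" by fastforce
  have l: "l \<in> BD N L" and m: "m \<in> BD N K" and g: "good (vm K m (1 / L) (v l))"
      "good (vm L (dual l) (1 / K) (v (dual m)))"
    using assms by (auto simp: gen_def p)
  show ?thesis
    using ptv_BD[OF g(1) iso_vm[OF m iso_v[OF l]] L0[OF l]]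
      ptv_BD[OF g(2) iso_vm[OF dual_BD[OF l] iso_v[OF dual_BD[OF m]]] L0[OF m]]
    by (simp add: F_def p dual_BD)
qed

lemma M_solution_F:
  assumes p: "(l, m) \<in> gen L K" and LK: "L \<noteq> K"
  shows "M_solution N L K (l, m) (F L K (l, m))"
proof -
  have l: "l \<in> BD N L" and m: "m \<in> BD N K" and g: "good (vm K m (1 / L) (v l))"
      "good (vm L (dual l) (1 / K) (v (dual m)))"
    using p by (auto simp: gen_def)
  obtain l' m' where F: "F L K (l, m) = (l', m')" by fastforce
  have l': "l' \<in> BD N K" and m': "m' \<in> BD N L" using F_BD[OF p] F by auto
  have e: "m' = ptv L (vm K m (1 / L) (v l))" "dual l' = ptv K (vm L (dual l) (1 / K) (v (dual m)))"
    using F dual_dual[OF ptv_BD[OF g(2) iso_vm[OF dual_BD[OF l] iso_v[OF dual_BD[OF m]]] L0[OF m]]] by (auto simp: F_def)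
  have v: "v m' j = L / vm K m (1 / L) (v l) 1 * vm K m (1 / L) (v l) j"
    "v (dual l') j = K / vm L (dual l) (1 / K) (v (dual m)) 1 * vm L (dual l) (1 / K) (v (dual m)) j" if "j \<in> R" for j
    unfolding e using v_ptv[OF g(1) iso_vm[OF m iso_v[OF l]] L0[OF l] that]
      v_ptv[OF g(2) iso_vm[OF dual_BD[OF l] iso_v[OF dual_BD[OF m]]] L0[OF m] that] by auto
  have nz: "vm K m (1 / L) (v l) 1 / L \<noteq> 0" "vm L (dual l) (1 / K) (v (dual m)) 1 / K \<noteq> 0"
    using goodD(1)[OF g(1), of 1] goodD(1)[OF g(2), of 1] L0[OF l] L0[OF m] by auto
  have "mm (M L l) (M K m) i j = mm (M K l') (M L m') i j" if "i \<in> R" "j \<in> R" for i j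
  proof (rule product_eq[OF l m l' m' LK nz(1) _ nz(2) _ that])
    fix j assume j: "j \<in> R"
    show "(\<Sum>k\<in>R. v l k * poly (M K m k j) (1 / L)) = vm K m (1 / L) (v l) 1 / L * v m' j"
      "(\<Sum>k\<in>R. v (dual m) k * poly (M L (dual l) k j) (1 / K)) =
         vm L (dual l) (1 / K) (v (dual m)) 1 / K * v (dual l') j"
      unfolding vm_def[symmetric] v[OF j] using nz by auto
  qed
  then show ?thesis using l' m' F by (simp add: M_solution_iff)
qed

lemma solution_map_gen:
  assumes p: "p \<in> gen L K" and LK: "L \<noteq> K"
  shows "solution_map N L K p = Some (F L K p)"
proof -
  obtain l m where lm: "p = (l, m)" by fastforce
  have "M_solution N L K p (F L K p)" using M_solution_F p LK by (simp add: lm)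
  moreover have "q = F L K p" if "M_solution N L K p q" for q
    using M_solution_unique[of l m L K "fst q" "snd q"] p that by (simp add: lm)
  ultimately have "(\<exists>!q. M_solution N L K p q)" "(THE q. M_solution N L K p q) = F L K p" by blast+
  then show ?thesis using p by (auto simp: solution_map_def gen_def)
qed

lemma solution_map_diagonal:
  assumes p: "p \<in> gen L L" shows "solution_map N L L p = Some p"
proof -
  obtain l m where lm: "p = (l, m)" by fastforce
  have "M_solution N L L p p" using p by (simp add: lm gen_def M_solution_iff)
  moreover have "q = p" if "M_solution N L L p q" for q
    using M_solution_unique[of l m L L "fst q" "snd q"] M_solution_unique[of l m L L l m] p that calculation
    by (simp add: lm)
  ultimately have "(\<exists>!q. M_solution N L L p q)" "(THE q. M_solution N L L p q) = p" by blast+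
  then show ?thesis using p by (auto simp: solution_map_def gen_def)
qed

text \<open>Both numbers are the entry \<open>(2N, 1)\<close> of the common product at \<open>z = 1/K\<close>.\<close>

lemma backward_nonzero:
  assumes l: "l \<in> BD N L" and m: "m \<in> BD N K" and s: "M_solution N L K (l, m) (l', m')"
    and nz: "vm L (dual l) (1 / K) (v (dual m)) 1 \<noteq> 0"
  shows "vm L m' (1 / K) (v l') 1 \<noteq> 0"
proof -
  note K0 = L0[OF m]
  have l': "l' \<in> BD N K" using s by (simp add: M_solution_iff)
  have R: "2 * N \<in> R" "1 \<in> R" using N4 by auto
  then have "poly (mm (M L l) (M K m) (2 * N) 1) (1 / K) = poly (mm (M K l') (M L m') (2 * N) 1) (1 / K)"
    using s unfolding M_solution_iff by simp
  moreover have "poly (mm (M K l') (M L m') (2 * N) 1) (1 / K) = vm L m' (1 / K) (v l') 1"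
    unfolding mm_def vm_def poly_sum using poly_M_special[OF K0] u_last[OF l'] K0 by (intro sum.cong) auto
  moreover have "poly (mm (M L l) (M K m) (2 * N) 1) (1 / K) = vm L (dual l) (1 / K) (v (dual m)) 1"
  proof -
    have "vm L (dual l) (1 / K) (v (dual m)) 1 = (\<Sum>k\<in>R. u m (rv k) * poly (M L l (2 * N) (rv k)) (1 / K))"
      unfolding vm_def using v_dual[OF m] M_dual[OF l _ R(2)] by (intro sum.cong) auto
    also have "\<dots> = (\<Sum>k\<in>R. u m k * poly (M L l (2 * N) k) (1 / K))"
      by (rule sum_rv)
    finally show ?thesis
      unfolding mm_def poly_sum using poly_M_special[OF K0] v_first[OF m] K0 by (auto intro!: sum.cong)
  qed
  ultimately show ?thesis using nz by simp
qed

text \<open>Read from right to left, the equation makes \<open>(l, m)\<close> a solution for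
  \<open>(l', m')\<close>, and uniqueness returns it as soon as \<open>(l', m')\<close> is generic.
  For that only two first coordinates must be nonzero; they are supplied by
  \<open>backward_nonzero\<close> for the pair and for its reflection.\<close>

lemma F_inverse:
  assumes p: "p \<in> gen L K" and LK: "L \<noteq> K"
  shows "F L K p \<in> gen K L" "F K L (F L K p) = p"
proof -
  obtain l m where lm: "p = (l, m)" by fastforce
  have l: "l \<in> BD N L" and m: "m \<in> BD N K" and g: "good (vm K m (1 / L) (v l))"
      "good (vm L (dual l) (1 / K) (v (dual m)))"
    using p by (auto simp: gen_def lm)
  obtain l' m' where F: "F L K p = (l', m')" by fastforce
  have l': "l' \<in> BD N K" and m': "m' \<in> BD N L" using F_BD[OF p] F by auto
  have s: "M_solution N L K (l, m) (l', m')" using M_solution_F p LK F lm by metis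
  have 1: "vm L m' (1 / K) (v l') 1 \<noteq> 0"
    using backward_nonzero[OF l m s] goodD(1)[OF g(2), of 1] by simp
  have 2: "vm K (dual l') (1 / L) (v (dual m')) 1 \<noteq> 0"
    using backward_nonzero[OF dual_BD[OF m] dual_BD[OF l] M_solution_dual[OF l m s]] goodD(1)[OF g(1), of 1]
    by (simp add: dual_dual[OF l] dual_dual[OF m])
  note s' = M_solution_sym[OF l m s]
  have "good (vm L m' (1 / K) (v l'))" by (rule M_solution_second(1)[OF l' m' s' 1])
  moreover have "good (vm K (dual l') (1 / L) (v (dual m')))"
    by (rule M_solution_second(1)[OF dual_BD[OF m'] dual_BD[OF l'] M_solution_dual[OF l' m' s'] 2])
  ultimately show q: "F L K p \<in> gen K L" using l' m' F by (simp add: gen_def)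
  show "F K L (F L K p) = p" using M_solution_unique[OF _ s'] q F lm by simp
qed

section \<open>The fixed-point varieties\<close>

text \<open>The fixed-point varieties are given by linear conditions on \<open>v l\<close>.  For \<open>i = 2\<close> and \<open>i = 4\<close> there is one
  linear space for each square root \<open>c\<close> of \<open>L\<close>; for \<open>i = 1\<close> and \<open>i = 3\<close> the choice of \<open>c\<close> does not matter.\<close>

definition lin :: "nat \<Rightarrow> complex \<Rightarrow> (nat \<Rightarrow> complex) \<Rightarrow> bool" where
  "lin i c w \<longleftrightarrow>
     (if i = 1 then w N = w (N + 1)
      else if i = 3 then w N = w (N + 1) \<and> w 1 = c\<^sup>2 * w (2 * N)
      else if i = 2 then \<forall>j\<in>{1..N}. w j = c * w (N + j)
      else w 1 = c * w N \<and> w (N + 1) = c * w (2 * N) \<and> (\<forall>j\<in>{2..<N}. w j = c * w (N + j)))"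

definition Xset :: "nat \<Rightarrow> complex \<Rightarrow> pt set" where
  "Xset i L = {l \<in> BD N L. \<exists>c. c\<^sup>2 = L \<and> lin i c (v l)}"

lemma mk_pt_eq_iff:
  assumes l: "l \<in> BD N L"
  shows "mk_pt N f g = l \<longleftrightarrow> (\<forall>k\<in>{1..N}. f k = l k) \<and> (\<forall>k\<in>{1..<N}. g k = lb l k)"
proof
  assume "mk_pt N f g = l"
  then show "(\<forall>k\<in>{1..N}. f k = l k) \<and> (\<forall>k\<in>{1..<N}. g k = lb l k)" by auto
next
  assume *: "(\<forall>k\<in>{1..N}. f k = l k) \<and> (\<forall>k\<in>{1..<N}. g k = lb l k)"
  have "l \<in> extensional {1..2*N-1}" using l by (auto simp: BD_def PiE_def)
  then show "mk_pt N f g = l"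
  proof (intro ext)
    fix k
    show "mk_pt N f g k = l k"
    proof (cases "k \<in> {1..2*N-1}")
      case True
      show ?thesis
      proof (cases "k \<le> N")
        case False
        then have "2 * N - k \<in> {1..<N}" "2 * N - (2 * N - k) = k" using True by auto
        then show ?thesis using * False True by (simp add: mk_pt_def bar_def)
      qed (use * True in \<open>auto simp: mk_pt_def\<close>)
    qed (use \<open>l \<in> extensional {1..2*N-1}\<close> in \<open>auto simp: mk_pt_def extensional_def\<close>)
  qed
qed

section \<open>Fixed points of Sigma_1 and Sigma_3\<close>

lemma v_N: assumes l: "l \<in> BD N L" shows "v l N = l N * v l (N + 1)"
  using v_low[OF l, of N] v_mid[OF l] PQ_total(1)[OF l, symmetric] P_nonzero[OF l, of "N - 1"] N4 by simp

lemma v_N_eq_iff: assumes l: "l \<in> BD N L" shows "v l N = v l (N + 1) \<longleftrightarrow> l N = 1"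
  using v_N[OF l] v_mid[OF l] Q_nonzero[OF l, of "N - 1"] by simp

lemma v_first_eq_iff: assumes l: "l \<in> BD N L" shows "v l 1 = L * v l (2 * N) \<longleftrightarrow> l 1 = lb l 1"
  using v_first[OF l] v_last[OF l] BD_nonzero[OF l, of 1] L0[OF l] N4 by (auto simp: field_simps)

text \<open>The coordinate N alone gives \<open>1 / l N = l N\<close> and leaves the sign open; the
  coordinate N-1, being nonzero, excludes -1.\<close>

lemma Sigma1_fixed: assumes l: "l \<in> BD N L" shows "Sigma1 N l = l \<longleftrightarrow> l N = 1"
proof -
  have "l (N - 1) \<noteq> 0" using BD_nonzero[OF l, of "N - 1"] N4 by auto
  moreover have "N - 1 \<in> {1..N}" "N - 1 \<noteq> N" using N4 by auto
  ultimately show ?thesis unfolding Sigma1_def mk_pt_eq_iff[OF l] by fastforce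
qed

lemma Sigma3_fixed:
  assumes l: "l \<in> BD N L" shows "Sigma0 N (Sigma1 N l) = l \<longleftrightarrow> l N = 1 \<and> l 1 = lb l 1"
proof -
  have *: "l (N - 1) \<noteq> 0" "N - 1 \<in> {1..N}" "N - 1 \<noteq> N" "N \<noteq> 1" "N - 1 \<noteq> 1" "1 \<in> {1..N}" "N \<in> {1..N}"
    using BD_nonzero[OF l, of "N - 1"] N4 by auto
  have s: "Sigma1 N l k = (if k = N - 1 then l (N - 1) * l N else if k = N then 1 / l N else l k)"
    if "k \<in> {1..N}" for k
    using that * by (auto simp: Sigma1_def)
  have b: "lb (Sigma1 N l) k = (if k = N - 1 then l N * lb l (N - 1) else lb l k)" if "k \<in> {1..<N}" for k
    using that by (auto simp: Sigma1_def)
  show ?thesis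
  proof
    assume "Sigma0 N (Sigma1 N l) = l"
    then have "\<forall>k\<in>{1..N}. ((Sigma1 N l)(1 := lb (Sigma1 N l) 1)) k = l k"
      unfolding Sigma0_def mk_pt_eq_iff[OF l] by blast
    from bspec[OF this *(2)] bspec[OF this *(6)] show "l N = 1 \<and> l 1 = lb l 1"
      using * N4 by (auto simp: s b)
  next
    assume "l N = 1 \<and> l 1 = lb l 1"
    then show "Sigma0 N (Sigma1 N l) = l"
      unfolding Sigma0_def mk_pt_eq_iff[OF l] using * N4 s b by auto
  qed
qed

text \<open>For even \<open>N\<close> the summands of \<open>G\<close> cancel in pairs \<open>k\<close>, \<open>N + 1 - k\<close>.\<close>

lemma lin_summand:
  assumes N: "even N" and i: "i = 2 \<or> i = 4" and c: "c \<noteq> 0" and w: "lin i c w" and k: "k \<in> {1..N}"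
  shows "sg (N + 1 - k) * w (N + 1 - k) * w (rv (N + 1 - k)) = - (sg k * w k * w (rv k))"
proof -
  have s: "sg (N + 1 - k) = - sg k"
  proof -
    have "N + 1 - k \<le> N" "even (N + 1 - k) \<longleftrightarrow> odd k" using k N by auto
    then show ?thesis using k by (simp add: sg_def minus_one_power_iff)
  qed
  have r: "rv (N + 1 - k) = N + k" "rv k = N + (N + 1 - k)" using k by (auto simp: rv_def)
  have "w (N + 1 - k) * w (N + k) = w k * w (N + (N + 1 - k))"
    using i
  proof
    assume "i = 2"
    then have "w j = c * w (N + j)" if "j \<in> {1..N}" for j using w that by (simp add: lin_def)
    moreover have "N + 1 - k \<in> {1..N}" using k by auto
    ultimately show ?thesis using k by simp
  next
    assume "i = 4"
    then have l: "w 1 = c * w N" "w (N + 1) = c * w (2 * N)" "\<And>j. j \<in> {2..<N} \<Longrightarrow> w j = c * w (N + j)"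
      using w by (auto simp: lin_def)
    consider "k = 1" | "k = N" | "k \<in> {2..<N}" using k by force
    then show ?thesis
    proof cases
      case 3
      moreover have "N + 1 - k \<in> {2..<N}" using 3 by auto
      ultimately show ?thesis using l(3) by simp
    qed (use l(1,2) in \<open>auto simp: mult_2\<close>)
  qed
  then show ?thesis unfolding r s by (simp add: mult.assoc)
qed

lemma lin_G_sym:
  assumes N: "even N" and i: "i = 2 \<or> i = 4" and c: "c \<noteq> 0" and w: "lin i c w" and k: "k \<le> N"
  shows "G w (N - k) = G w N + G w k"
proof -
  have "G w k = (\<Sum>q=N-k+1..N. - (sg q * w q * w (rv q)))"
    unfolding G_def
    by (rule sum.reindex_bij_witness[where i = "\<lambda>q. N + 1 - q" and j = "\<lambda>q. N + 1 - q"])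
      (use k lin_summand[OF N i c w] in auto)
  moreover have "{1..N} = {1..N-k} \<union> {N-k+1..N}" using k by auto
  ultimately show ?thesis unfolding G_def by (simp add: sum.union_disjoint sum_negf)
qed

text \<open>For i = 2 and i = 4 the linear space is totally isotropic, so linear combinations of two
  of its vectors stay isotropic without any correction.\<close>

lemma lin_iso:
  assumes "even N" "i = 2 \<or> i = 4" "c \<noteq> 0" "lin i c w" shows "iso w"
  using lin_G_sym[OF assms, of N] by (simp add: iso_def)

lemma sg_shift: assumes N: "even N" and j: "j \<in> {1..N}" shows "sg (N + j) = - sg j"
proof -
  have "rv (N + j) = N + 1 - j" by (simp add: rv_def)
  moreover have "even (N + 1 - j) \<longleftrightarrow> odd j" using j N by auto
  ultimately show ?thesis using j by (simp add: sg_def minus_one_power_iff)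
qed

text \<open>\<open>u_G_v\<close> at \<open>k\<close> and at \<open>N + k\<close> reduces the claim
  to the condition on \<open>v\<close> at the index \<open>N + 1 - k\<close>. Passing from
  \<open>k\<close> to \<open>N + k\<close> changes the sign of \<open>sg\<close> and also that of
  \<open>G\<close>, so the signs cancel.\<close>

lemma lin_u_mid:
  assumes N: "even N" and i: "i = 2 \<or> i = 4" and l: "l \<in> BD N L" and c: "c\<^sup>2 = L" and w: "lin i c (v l)"
    and k: "1 < k" "k < N"
  shows "u l (N + k) = c * u l k"
proof -
  have c0: "c \<noteq> 0" using c L0[OF l] by auto
  have g: "G (v l) k \<noteq> 0" using goodD(3)[OF good_v[OF l]] k by simp
  have s: "sg (N + k) = - sg k" using sg_shift[OF N, of k] k by simp
  have r: "rv (N + k) = N + 1 - k" "rv k = N + (N + 1 - k)" using k by (auto simp: rv_def)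
  have "u l (N + k) * G (v l) (N + k) = L * sg (N + k) * v l (rv (N + k))"
    using k by (intro u_G_v[OF l]) auto
  moreover have "G (v l) (N + k) = - G (v l) k"
  proof -
    have "G (v l) (N + k) + G (v l) (N - k) = 0"
      using G_refl[of "N - k" "v l"] G_full[of "v l"] G_v_N[OF l] k by simp
    then show ?thesis
      using lin_G_sym[OF N i c0 w, of k] G_v_N[OF l] k by (simp add: add_eq_0_iff2)
  qed
  moreover have "u l k * G (v l) k = L * sg k * v l (N + (N + 1 - k))"
    using u_G_v[OF l, of k] k r by simp
  moreover have "v l (N + 1 - k) = c * v l (N + (N + 1 - k))"
  proof -
    have "N + 1 - k \<in> {2..<N}" "N + 1 - k \<in> {1..N}" using k by auto
    then show ?thesis using i w unfolding lin_def by auto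
  qed
  ultimately have "u l (N + k) * G (v l) k = c * u l k * G (v l) k"
    unfolding s r by (simp add: mult_ac)
  then show ?thesis using g by simp
qed

lemma u_ends:
  assumes l: "l \<in> BD N L"
  shows "u l 1 * v l (2 * N) = 1" "u l N * v l (N + 1) = L" "u l (N + 1) * v l N = L" "u l (2 * N) = L"
proof -
  show "u l 1 * v l (2 * N) = 1"
    using u_first[OF l] v_last[OF l] BD_nonzero[OF l, of 1] BD_bar_nonzero[OF l, of 1] N4 by simp
  show "u l N * v l (N + 1) = L" using u_N[OF l] v_mid[OF l] PQ_total(2)[OF l] by simp
  show "u l (N + 1) * v l N = L"
    using u_mid[OF l] v_low[OF l, of N] P_nonzero[OF l, of "N - 1"] N4 by simp
qed (rule u_last[OF l])

text \<open>\<open>v (dual l)\<close> is \<open>u l\<close> read backwards. Its middle entries are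
  handled by \<open>lin_u_mid\<close>. The entries at 1, N, N+1 and 2N come from
  \<open>u_ends\<close>; for i = 2 and i = 4 the normalisation \<open>v l 1 = L\<close> makes
  \<open>v l (N + 1)\<close> respectively \<open>v l N\<close> equal to \<open>c\<close>.\<close>

lemma lin_dual:
  assumes N: "i = 2 \<or> i = 4 \<Longrightarrow> even N" and i: "i \<in> {1,2,3,4}"
    and l: "l \<in> BD N L" and c: "c\<^sup>2 = L" and w: "lin i c (v l)"
  shows "lin i c (v (dual l))"
proof -
  have c0: "c \<noteq> 0" using c L0[OF l] by auto
  have rr: "v (dual l) N = u l (N + 1)" "v (dual l) (N + 1) = u l N" "v (dual l) 1 = u l (2 * N)"
    "v (dual l) (2 * N) = u l 1"
    using v_dual[OF l, of N] v_dual[OF l, of "N + 1"] v_dual[OF l, of 1] v_dual[OF l, of "2 * N"] N4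
    by (auto simp: rv_def)
  note nz = goodD(1,2)[OF good_v[OF l]]
  note ue = u_ends[OF l]
  have n: "v l N \<noteq> 0" "v l (N + 1) \<noteq> 0" "v l (2 * N) \<noteq> 0" using nz(1)[of N] nz(1)[of "N + 1"] nz(2) N4 by auto
  have u: "u l 1 = 1 / v l (2 * N)" "u l N = L / v l (N + 1)" "u l (N + 1) = L / v l N"
    using ue n by (auto simp: field_simps)
  have Lc: "L / (c * y) = c / y" for y using c c0 by (auto simp: power2_eq_square)
  have mid: "v (dual l) k = c * v (dual l) (N + k)" if "i = 2 \<or> i = 4" "1 < k" "k < N" for k
  proof -
    have "v (dual l) k = u l (N + (N + 1 - k))" "v (dual l) (N + k) = u l (N + 1 - k)"
      using v_dual[OF l, of k] v_dual[OF l, of "N + k"] that by (auto simp: rv_def mult_2)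
    then show ?thesis using lin_u_mid[OF N[OF that(1)] that(1) l c w, of "N + 1 - k"] that by simp
  qed
  consider "i = 1" | "i = 3" | "i = 2" | "i = 4" using i by auto
  then show ?thesis
  proof cases
    case 1
    then show ?thesis using w rr u by (simp add: lin_def)
  next
    case 2
    then show ?thesis using w rr u ue(4) v_first[OF l] L0[OF l] c by (simp add: lin_def)
  next
    case 3
    then have lw: "v l j = c * v l (N + j)" if "j \<in> {1..N}" for j using w that by (simp add: lin_def)
    have "c * v l (N + 1) = c * c" using lw[of 1] v_first[OF l] c N4 by (simp add: power2_eq_square)
    then have e: "v l (N + 1) = c" "v l N = c * v l (2 * N)"
      using lw[of N] c0 N4 by (auto simp: mult_2)
    have "v (dual l) k = c * v (dual l) (N + k)" if "k \<in> {1..N}" for k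
    proof -
      have "1 \<le> k" "k \<le> N" using that by auto
      then consider "k = 1" | "k = N" | "1 < k" "k < N" by linarith
      then show ?thesis
      proof cases
        case 1
        then show ?thesis using rr u(2) ue(4) e(1) c c0 by (simp add: power2_eq_square)
      next
        case 2
        have "v (dual l) (N + N) = u l 1" using rr(4) by (simp add: mult_2)
        then show ?thesis using 2 rr(1) u(1,3) e(2) Lc[of "v l (2 * N)"] by simp
      qed (use mid 3 in auto)
    qed
    then show ?thesis using 3 by (simp add: lin_def)
  next
    case 4
    then have lw: "v l 1 = c * v l N" "v l (N + 1) = c * v l (2 * N)" using w by (auto simp: lin_def)
    have "c * v l N = c * c" using lw(1) v_first[OF l] c by (simp add: power2_eq_square)
    then have e: "v l N = c" using c0 by simp
    have "v (dual l) 1 = c * v (dual l) N" using rr(1,3) u(3) ue(4) e c c0 by (simp add: power2_eq_square)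
    moreover have "v (dual l) (N + 1) = c * v (dual l) (2 * N)"
      using rr(2,4) u(1,2) lw(2) Lc[of "v l (2 * N)"] by simp
    ultimately show ?thesis using 4 mid by (simp add: lin_def)
  qed
qed

section \<open>Invariance of the linear spaces under M\<close>

definition xcor :: "complex \<Rightarrow> (nat \<Rightarrow> complex) \<Rightarrow> nat \<Rightarrow> complex" where
  "xcor L w j = (if j = N then w (N + 1) else if j = 2 * N then w 1 / L
     else if j = 1 \<or> j = N + 1 then 0 else w j)"

definition Z :: "pt \<Rightarrow> (nat \<Rightarrow> complex) \<Rightarrow> nat \<Rightarrow> complex" where
  "Z m w j = (\<Sum>k=1..<j. w k * u m k)"

lemma Z_1 [simp]: "Z m w (Suc 0) = 0" and Z_Suc: "1 \<le> j \<Longrightarrow> Z m w (Suc j) = Z m w j + w j * u m j"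
  by (simp_all add: Z_def)

text \<open>Combines \<open>poly_M\<close> with \<open>A_lower\<close>: an index \<open>k\<close>
  below \<open>j\<close> contributes only through the rank-one term, with weight \<open>1/L\<close>,
  and from \<open>j\<close> on the two parts add up to weight \<open>1/K\<close>. The vector
  \<open>xcor\<close> collects what \<open>D\<close> and the corner entry \<open>e\<close>
  contribute.\<close>

lemma vm_formula:
  assumes m: "m \<in> BD N K" and L: "L \<noteq> 0" and j: "j \<in> R"
  shows "vm K m (1 / L) w j =
    v m j * ((Z m w (2 * N + 1) - Z m w j) / K + Z m w j / L) - (1 - K / L) * xcor L w j"
proof -
  note K0 = L0[OF m]
  have A: "(\<Sum>k\<in>R. w k * A_entry N m k j) = v m j * (Z m w (2 * N + 1) - Z m w j) / K - (\<Sum>k\<in>R. w k * D k j)"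
  proof -
    have "w k * A_entry N m k j = (if k \<in> {j..2*N} then w k * u m k * (v m j / K) else 0) - w k * D k j"
      if "k \<in> R" for k
    proof (cases "j \<le> k")
      case True
      then show ?thesis using A_lower[OF m, of j k] that j by (simp add: right_diff_distrib)
    next
      case False
      then have "D k j = 0" by (auto simp: D_def)
      then show ?thesis using False A_upper[OF m, of k j] that j by simp
    qed
    then have "(\<Sum>k\<in>R. w k * A_entry N m k j) =
        (\<Sum>k\<in>R. if k \<in> {j..2*N} then w k * u m k * (v m j / K) else 0) - (\<Sum>k\<in>R. w k * D k j)"
      by (simp only: sum_subtractf[symmetric]) (intro sum.cong, auto)
    also have "(\<Sum>k\<in>R. if k \<in> {j..2*N} then w k * u m k * (v m j / K) else 0) = (\<Sum>k=j..2*N. w k * u m k) * (v m j / K)"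
    proof -
      have "R \<inter> {j..2*N} = {j..2*N}" using j by auto
      then show ?thesis by (simp only: sum.inter_restrict[symmetric] finite_atLeastAtMost sum_distrib_right)
    qed
    also have "(\<Sum>k=j..2*N. w k * u m k) = Z m w (2 * N + 1) - Z m w j"
    proof -
      have "{1..<2*N+1} = {1..<j} \<union> {j..2*N}" using j by auto
      then have "Z m w (2 * N + 1) = Z m w j + (\<Sum>k=j..2*N. w k * u m k)"
        unfolding Z_def by (simp only:, intro sum.union_disjoint) auto
      then show ?thesis by simp
    qed
    finally show ?thesis by simp
  qed
  have De: "(\<Sum>k\<in>R. w k * D k j) + (\<Sum>k\<in>R. w k * e k j) / L = xcor L w j"
  proof -
    have e: "(\<Sum>k\<in>R. w k * e k j) = (if j = 2 * N then w 1 else 0)"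
    proof -
      have "(\<Sum>k\<in>R. w k * e k j) = (\<Sum>k\<in>R. if k = 1 then if j = 2 * N then w 1 else 0 else 0)"
        by (intro sum.cong) (auto simp: e_def)
      then show ?thesis using N4 by (simp add: sum.delta)
    qed
    have D: "(\<Sum>k\<in>R. w k * D k j) = (if j = N then w (N + 1) else if j = 1 \<or> j = N + 1 \<or> j = 2 * N then 0 else w j)"
    proof (cases "j = N")
      case True
      have "(\<Sum>k\<in>R. w k * D k j) = (\<Sum>k\<in>R. if k = N + 1 then w (N + 1) else 0)"
        using True by (intro sum.cong) (auto simp: D_def)
      then show ?thesis using True N4 by (simp add: sum.delta)
    next
      case False
      have "(\<Sum>k\<in>R. w k * D k j) = (\<Sum>k\<in>R. if k = j then w j * D j j else 0)"
        using False by (intro sum.cong) (auto simp: D_def)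
      then show ?thesis using False j by (auto simp: sum.delta D_def)
    qed
    show ?thesis unfolding D e using N4 by (auto simp: xcor_def)
  qed
  have T: "(\<Sum>k\<in>R. w k * u m k) = Z m w (2 * N + 1)"
    unfolding Z_def by (rule sum.cong) auto
  have "vm K m (1 / L) w j = (\<Sum>k\<in>R. (1 - K / L) * (w k * A_entry N m k j) - (1 - K / L) / L * (w k * e k j)
      + w k * u m k * (v m j / L))"
    unfolding vm_def poly_M by (intro sum.cong refl) (simp add: algebra_simps)
  also have "\<dots> = (1 - K / L) * (\<Sum>k\<in>R. w k * A_entry N m k j) - (1 - K / L) / L * (\<Sum>k\<in>R. w k * e k j)
      + (\<Sum>k\<in>R. w k * u m k) * (v m j / L)"
    by (simp only: sum.distrib sum_subtractf sum_distrib_left sum_distrib_right)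
  also have "\<dots> = (1 - K / L) * (v m j * (Z m w (2 * N + 1) - Z m w j) / K) + Z m w (2 * N + 1) * (v m j / L)
     - (1 - K / L) * ((\<Sum>k\<in>R. w k * D k j) + (\<Sum>k\<in>R. w k * e k j) / L)"
    unfolding A T by (simp add: algebra_simps)
  also have "\<dots> = v m j * ((Z m w (2 * N + 1) - Z m w j) / K + Z m w j / L) - (1 - K / L) * xcor L w j"
    unfolding De using K0 L by (simp add: field_simps)
  finally show ?thesis .
qed

text \<open>On the linear spaces each summand of the second half is a fixed multiple of its partner
  in the first half, so the partial sums \<open>Z\<close> at \<open>N + j\<close> are affine
  functions of those at \<open>j\<close>.\<close>

lemma Z_shift_2:
  assumes q: "\<And>k. k \<in> {1..N} \<Longrightarrow> w (N + k) * u m (N + k) = r * (w k * u m k)" and j: "1 \<le> j" "j \<le> N + 1"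
  shows "Z m w (N + j) = Z m w (N + 1) + r * Z m w j"
  using j
proof (induction j rule: nat_induct_at_least)
  case (Suc j)
  then show ?case using Z_Suc[of "N + j" m w] Z_Suc[of j m w] q[of j] by (simp add: algebra_simps)
qed simp

lemma Z_shift_4:
  assumes q: "\<And>k. k \<in> {2..<N} \<Longrightarrow> w (N + k) * u m (N + k) = r * (w k * u m k)" and j: "2 \<le> j" "j \<le> N"
  shows "Z m w (N + j) = Z m w (N + 2) + r * (Z m w j - Z m w 2)"
  using j
proof (induction j rule: nat_induct_at_least)
  case (Suc j)
  then show ?case using Z_Suc[of "N + j" m w] Z_Suc[of j m w] q[of j] by (simp add: algebra_simps)
qed simp

lemma lin_u:
  assumes N: "i = 2 \<or> i = 4 \<Longrightarrow> even N" and i: "i \<in> {1,2,3,4}"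
    and m: "m \<in> BD N K" and d: "d\<^sup>2 = K" and w: "lin i d (v m)"
  shows "i = 2 \<Longrightarrow> k \<in> {1..N} \<Longrightarrow> u m (N + k) = d * u m k"
    "i = 4 \<Longrightarrow> u m (2 * N) = d * u m (N + 1) \<and> u m N = d * u m 1 \<and> (\<forall>k\<in>{2..<N}. u m (N + k) = d * u m k)"
proof -
  note w' = lin_dual[OF N i m d w]
  have r: "u m k = v (dual m) (rv k)" if "k \<in> R" for k
    using v_dual[OF m rv_range[OF that]] that by simp
  show "u m (N + k) = d * u m k" if "i = 2" "k \<in> {1..N}"
  proof -
    have "rv (N + k) \<in> {1..N}" "rv k = N + rv (N + k)" using that by (auto simp: rv_def)
    then show ?thesis using w' r[of k] r[of "N + k"] that by (auto simp: lin_def)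
  qed
  show "u m (2 * N) = d * u m (N + 1) \<and> u m N = d * u m 1 \<and> (\<forall>k\<in>{2..<N}. u m (N + k) = d * u m k)" if "i = 4"
  proof -
    have "u m (N + k) = d * u m k" if k: "k \<in> {2..<N}" for k
    proof -
      have "rv (N + k) \<in> {2..<N}" "rv k = N + rv (N + k)" using k by (auto simp: rv_def)
      then show ?thesis using w' r[of k] r[of "N + k"] k \<open>i = 4\<close> by (auto simp: lin_def)
    qed
    moreover have "u m (2 * N) = v (dual m) 1" "u m (N + 1) = v (dual m) N" "u m N = v (dual m) (N + 1)" "u m 1 = v (dual m) (2 * N)"
      using r[of "2 * N"] r[of "N + 1"] r[of N] r[of 1] N4 by (auto simp: rv_def)
    ultimately show ?thesis using w' \<open>i = 4\<close> by (auto simp: lin_def)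
  qed
qed

text \<open>The preserved space belongs to the parameter \<open>L\<close>, because the evaluation
  point is \<open>1/L\<close>; the root \<open>d\<close> of \<open>K\<close> may have either sign.
  By \<open>vm_formula\<close> and the shift lemmas the claim becomes an identity between a few
  partial sums, in which the ratio \<open>d / c\<close> of paired summands balances the weights
  \<open>1/K\<close> and \<open>1/L\<close>.\<close>

lemma lin_vm:
  assumes N: "i = 2 \<or> i = 4 \<Longrightarrow> even N" and i: "i \<in> {1,2,3,4}"
    and m: "m \<in> BD N K" and d: "d\<^sup>2 = K" and md: "lin i d (v m)"
    and c: "c\<^sup>2 = L" and L: "L \<noteq> 0" and w: "lin i c w"
  shows "lin i c (vm K m (1 / L) w)"
proof -
  have nz: "c \<noteq> 0" "d \<noteq> 0" "K \<noteq> 0" using c d L L0[OF m] by auto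
  have LK: "L = c * c" "K = d * d" using c d by (auto simp: power2_eq_square)
  note vmf = vm_formula[OF m L, of _ w]
  note ue = u_ends[OF m]
  have R: "1 \<in> R" "N \<in> R" "N + 1 \<in> R" "2 * N \<in> R" using N4 by auto
  have x: "xcor L w 1 = 0" "xcor L w N = w (N + 1)" "xcor L w (N + 1) = 0" "xcor L w (2 * N) = w 1 / L"
    using N4 by (auto simp: xcor_def)
  define T where "T = Z m w (2 * N + 1)"
  \<comment> \<open>This condition is common to i = 1 and i = 3. Going from N to N+1 adds one
    summand to \<open>Z\<close>, and its effect is exactly the correction \<open>xcor\<close> at N,
    since \<open>u m N * v m (N + 1) = K\<close>.\<close>
  have swap: "vm K m (1 / L) w N = vm K m (1 / L) w (N + 1)" if "w N = w (N + 1)" "v m N = v m (N + 1)"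
  proof -
    have *: "b * ((T - (z + y * a)) / K + (z + y * a) / L) = b * ((T - z) / K + z / L) - (a * b) * y * (1 / K - 1 / L)"
      for a b y z by (simp add: diff_divide_distrib add_divide_distrib algebra_simps)
    have "vm K m (1 / L) w (N + 1) = v m N * ((T - (Z m w N + w N * u m N)) / K + (Z m w N + w N * u m N) / L)"
      using vmf[OF R(3)] x(3) that(2) Z_Suc[of N m w] N4 by (simp add: T_def)
    also have "\<dots> = v m N * ((T - Z m w N) / K + Z m w N / L) - K * w N * (1 / K - 1 / L)"
      unfolding * using ue(2) that(2) by simp
    also have "K * w N * (1 / K - 1 / L) = (1 - K / L) * w (N + 1)"
      using nz that(1) by (simp add: algebra_simps)
    finally show ?thesis using vmf[OF R(2)] x(2) by (simp add: T_def)
  qed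
  consider "i = 1" | "i = 3" | "i = 2" | "i = 4" using i by auto
  then show ?thesis
  proof cases
    case 1
    then show ?thesis using swap w md by (simp add: lin_def)
  next
    case 2
    then have h: "w N = w (N + 1)" "v m N = v m (N + 1)" "w 1 = L * w (2 * N)" "v m 1 = K * v m (2 * N)"
      using w md c d by (auto simp: lin_def)
    have v1: "v m 1 = K" "v m (2 * N) = 1" using h(4) v_first[OF m] nz by auto
    have z: "Z m w (2 * N) = T - w (2 * N) * K"
      using Z_Suc[of "2 * N" m w] ue(4) N4 by (simp add: T_def)
    have "vm K m (1 / L) w (2 * N) = T / L"
      unfolding vmf[OF R(4)] x(4) v1(2) h(3) T_def[symmetric] z using nz L by (simp add: field_simps)
    moreover have "vm K m (1 / L) w 1 = T"
      using vmf[OF R(1)] x(1) v1 nz by (simp add: T_def)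
    ultimately show ?thesis using 2 swap[OF h(1,2)] c L by (simp add: lin_def)
  next
    case 3
    then have h: "\<And>j. j \<in> {1..N} \<Longrightarrow> w j = c * w (N + j)" "\<And>j. j \<in> {1..N} \<Longrightarrow> v m j = d * v m (N + j)"
      using w md by (auto simp: lin_def)
    have q: "w (N + k) * u m (N + k) = d / c * (w k * u m k)" if "k \<in> {1..N}" for k
      using h(1)[OF that] lin_u(1)[OF N i m d md 3 that] nz by simp
    define S where "S = Z m w (N + 1)"
    have T: "T = (1 + d / c) * S"
    proof -
      have "2 * N + 1 = N + (N + 1)" by simp
      then show ?thesis
        using Z_shift_2[of w m "d / c" "N + 1", OF q] unfolding T_def S_def by (simp only:) (simp add: algebra_simps)
    qed
    have alg: "d * b * (((1 + d / c) * S - z) / (d * d) + z / (c * c))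
        = c * (b * (((1 + d / c) * S - (S + d / c * z)) / (d * d) + (S + d / c * z) / (c * c)))" for b z
      using nz by (simp add: field_simps)
    have "vm K m (1 / L) w j = c * vm K m (1 / L) w (N + j)" if j: "j \<in> {1..N}" for j
    proof -
      have jR: "j \<in> R" "N + j \<in> R" "1 \<le> j" "j \<le> N + 1" using j by auto
      have xj: "xcor L w j = c * xcor L w (N + j)"
      proof -
        have "w 1 = c * w (N + 1)" using h(1)[of 1] N4 by simp
        then have "c * (w 1 / L) = w (N + 1)" using nz LK by simp
        then show ?thesis using h(1)[OF j] j N4 by (auto simp: xcor_def mult_2)
      qed
      have zj: "Z m w (N + j) = S + d / c * Z m w j"
        using Z_shift_2[of w m "d / c" j, OF q jR(3,4)] by (simp add: S_def)
      show ?thesis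
        unfolding vmf[OF jR(1)] vmf[OF jR(2)] xj T_def[symmetric] T h(2)[OF j] zj
        unfolding LK alg by (simp add: algebra_simps)
    qed
    then show ?thesis using 3 by (simp add: lin_def)
  next
    case 4
    then have h: "w 1 = c * w N" "w (N + 1) = c * w (2 * N)" "\<And>j. j \<in> {2..<N} \<Longrightarrow> w j = c * w (N + j)"
      and g: "v m 1 = d * v m N" "v m (N + 1) = d * v m (2 * N)" "\<And>j. j \<in> {2..<N} \<Longrightarrow> v m j = d * v m (N + j)"
      using w md by (auto simp: lin_def)
    have um: "u m (2 * N) = d * u m (N + 1)" "u m N = d * u m 1" "\<And>k. k \<in> {2..<N} \<Longrightarrow> u m (N + k) = d * u m k"
      using lin_u(2)[OF N i m d md 4] by auto
    have vN: "v m 1 = d * d" "v m N = d" using g(1) v_first[OF m] LK nz by auto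
    have un: "u m (N + 1) = d" using ue(3) vN LK nz by simp
    have q: "w (N + k) * u m (N + k) = d / c * (w k * u m k)" if "k \<in> {2..<N}" for k
      using h(3)[OF that] um(3)[OF that] nz by simp
    define y where "y = w (N + 1)"
    define q1 where "q1 = w 1 * u m 1"
    define S where "S = Z m w N - Z m w 2"
    define b where "b = v m (2 * N)"
    have bq: "b * q1 = w 1" using ue(1) by (simp add: b_def q1_def mult.commute)
    \<comment> \<open>The exceptional indices 1, N, N+1 and 2N interrupt the pairing of
      \<open>k\<close> with \<open>N + k\<close>. The partial sums next to them are therefore first
      expressed through \<open>q1\<close>, \<open>S\<close> and \<open>y\<close>.\<close>
    have z: "Z m w 2 = q1" "Z m w N = q1 + S" "Z m w (N + 1) = q1 + S + d / c * q1"
      "Z m w (N + 2) = q1 + S + d / c * q1 + d * y" "Z m w (2 * N) = q1 + S + d / c * q1 + d * y + d / c * S"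
      "T = q1 + S + d / c * q1 + d * y + d / c * S + d / c * (d * y)"
    proof -
      show 1: "Z m w 2 = q1" using Z_Suc[of 1 m w] by (simp add: q1_def numeral_2_eq_2)
      then show 2: "Z m w N = q1 + S" by (simp add: S_def)
      have "w N * u m N = d / c * q1" using h(1) um(2) nz by (simp add: q1_def)
      then show 3: "Z m w (N + 1) = q1 + S + d / c * q1" using Z_Suc[of N m w] 2 N4 by simp
      show 4: "Z m w (N + 2) = q1 + S + d / c * q1 + d * y" using Z_Suc[of "N + 1" m w] 3 un by (simp add: y_def)
      show 5: "Z m w (2 * N) = q1 + S + d / c * q1 + d * y + d / c * S"
        using Z_shift_4[of w m "d / c" N, OF q] 4 N4 by (simp add: S_def mult_2)
      have "w (2 * N) * u m (2 * N) = d / c * (d * y)" using h(2) um(1) un nz by (simp add: y_def)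
      then show "T = q1 + S + d / c * q1 + d * y + d / c * S + d / c * (d * y)"
        using Z_Suc[of "2 * N" m w] 5 N4 by (simp add: T_def)
    qed
    have "vm K m (1 / L) w 1 = c * vm K m (1 / L) w N"
    proof -
      have "d * d * ((T - 0) / (d * d) + 0 / (c * c))
        = c * (d * ((T - (q1 + S)) / (d * d) + (q1 + S) / (c * c)) - (1 - d * d / (c * c)) * y)"
        unfolding z(6) using nz by (simp add: field_simps)
      then show ?thesis
        unfolding vmf[OF R(1)] vmf[OF R(2)] x T_def[symmetric] z(2) vN y_def[symmetric]
        unfolding LK by simp
    qed
    moreover have "vm K m (1 / L) w (N + 1) = c * vm K m (1 / L) w (2 * N)"
    proof -
      have "d * b * ((T - (q1 + S + d / c * q1)) / (d * d) + (q1 + S + d / c * q1) / (c * c))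
        = c * (b * ((T - (q1 + S + d / c * q1 + d * y + d / c * S)) / (d * d)
             + (q1 + S + d / c * q1 + d * y + d / c * S) / (c * c)) - (1 - d * d / (c * c)) * (b * q1 / (c * c)))"
        unfolding z(6) using nz by (simp add: field_simps)
      then show ?thesis
        unfolding vmf[OF R(3)] vmf[OF R(4)] x T_def[symmetric] z(3,5) g(2) b_def[symmetric] bq
        unfolding LK by simp
    qed
    moreover have "vm K m (1 / L) w j = c * vm K m (1 / L) w (N + j)" if j: "j \<in> {2..<N}" for j
    proof -
      have jR: "j \<in> R" "N + j \<in> R" "2 \<le> j" "j \<le> N" using j by auto
      have xj: "xcor L w j = c * xcor L w (N + j)" using h(3)[OF j] j by (auto simp: xcor_def)
      have zj: "Z m w (N + j) = q1 + S + d / c * q1 + d * y + d / c * (Z m w j - q1)"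
        using Z_shift_4[of w m "d / c" j, OF q jR(3,4)] z by simp
      have alg: "d * a * ((T - z) / (d * d) + z / (c * c))
        = c * (a * ((T - (q1 + S + d / c * q1 + d * y + d / c * (z - q1))) / (d * d)
             + (q1 + S + d / c * q1 + d * y + d / c * (z - q1)) / (c * c)))" for a z
        unfolding z(6) using nz by (simp add: field_simps)
      show ?thesis
        unfolding vmf[OF jR(1)] vmf[OF jR(2)] xj T_def[symmetric] g(3)[OF j] zj
        unfolding LK alg by (simp add: algebra_simps)
    qed
    ultimately show ?thesis using 4 by (simp add: lin_def)
  qed
qed

end

section \<open>Fixed points of Sigma_2\<close>

lemma frac_eq_iff:
  fixes a b h s x :: complex
  shows "b \<noteq> 0 \<Longrightarrow> s \<noteq> 0 \<Longrightarrow> a / b * (h / s) = x \<longleftrightarrow> a * h = x * b * s"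
  by (auto simp: field_simps)

lemma ratio_simps:
  fixes a b x :: complex
  shows "b \<noteq> 0 \<Longrightarrow> a \<noteq> 0 \<Longrightarrow> x * b / a * (a / b + 1) = x * (a + b) / a"
    and "b \<noteq> 0 \<Longrightarrow> x * (a / b + 1) = x * (a + b) / b"
  by (simp_all add: field_simps)

lemma cancel_common:
  fixes a b d n s :: complex
  assumes "n \<noteq> 0"
  shows "a / (b * n) * ((b * n + n * d) / s) = a / b * ((b + d) / s)"
    "a / (n * d) * ((b * n + n * d) / s) = a / d * ((b + d) / s)"
    "b * n * (n * d) / (b * n + n * d) = n * b * d / (b + d)"
    "1 / n * (b * n) * (n * d) / (b * n + n * d) = b * d / (b + d)"
proof -
  have e: "b * n + n * d = n * (b + d)" by (simp add: algebra_simps)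
  show "a / (b * n) * ((b * n + n * d) / s) = a / b * ((b + d) / s)"
    "a / (n * d) * ((b * n + n * d) / s) = a / d * ((b + d) / s)"
    "b * n * (n * d) / (b * n + n * d) = n * b * d / (b + d)"
    "1 / n * (b * n) * (n * d) / (b * n + n * d) = b * d / (b + d)"
    unfolding e using assms by simp_all
qed

context D_rank begin

abbreviation lsum :: "pt \<Rightarrow> nat \<Rightarrow> complex" where "lsum l i \<equiv> l i + lb l i"

lemma Sigma2_fixed_iff:
  assumes l: "l \<in> BD N L"
  shows "Sigma2 N l = l \<longleftrightarrow>
     l (N - 1) * lb l (N - 1) / lsum l (N - 1) = l 1 \<and> lb l 1 / l 1 = l N \<and>
     (l 1 * lb l 2 / l 2) * (l 2 / lb l 2 + 1) = l (N - 1) \<and>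
     (\<forall>j\<in>{2..N-2}. (l (N - j) * lb l (N - j) / l (N - j + 1)) * (lsum l (N - j + 1) / lsum l (N - j)) = l j) \<and>
     l N * l (N - 1) * lb l (N - 1) / lsum l (N - 1) = lb l 1 \<and>
     l 1 * (l 2 / lb l 2 + 1) = lb l (N - 1) \<and>
     (\<forall>j\<in>{2..N-2}. (l (N - j) * lb l (N - j) / lb l (N - j + 1)) * (lsum l (N - j + 1) / lsum l (N - j)) = lb l j)"
    (is "_ \<longleftrightarrow> ?C")
proof -
  have 1: "{1..N} = {1, N, N - 1} \<union> {2..N-2}" "{1..<N} = {1, N - 1} \<union> {2..N-2}" using N4 by auto
  have 2: "N \<noteq> 1" "N - 1 \<noteq> 1" "N - 1 \<noteq> N" "\<And>j. j \<in> {2..N-2} \<Longrightarrow> j \<noteq> 1 \<and> j \<noteq> N \<and> j \<noteq> N - 1"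
    using N4 by auto
  show ?thesis
    unfolding Sigma2_def Let_def mk_pt_eq_iff[OF l] 1 ball_Un using 2 by (auto simp del: atLeastAtMost_iff)
qed

text \<open>Denominators are cleared, and \<open>j\<close> is replaced by
  \<open>i = N + 1 - j\<close>: the entry at \<open>N + j\<close> is the one at \<open>rv i\<close>,
  which brings in \<open>lsum l i\<close>.\<close>

lemma lin_2_iff:
  assumes l: "l \<in> BD N L" and c: "c\<^sup>2 = L"
  shows "lin 2 c (v l) \<longleftrightarrow> Q l (N - 1) = c \<and> c * l 1 = lb l 1 * P l (N - 1) \<and>
    (\<forall>i\<in>{2..N-1}. c * l i = Q l (i - 1) * P l (N - i) * lsum l i)"
proof -
  have c0: "c \<noteq> 0" using c L0[OF l] by auto
  have "lin 2 c (v l) \<longleftrightarrow> (\<forall>j\<in>{1..N}. v l j = c * v l (N + j))" by (simp add: lin_def)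
  also have "\<dots> \<longleftrightarrow> v l 1 = c * v l (N + 1) \<and> v l N = c * v l (2 * N) \<and> (\<forall>j\<in>{2..N-1}. v l j = c * v l (N + j))"
  proof -
    have "{1..N} = {1, N} \<union> {2..N-1}" using N4 by auto
    then show ?thesis unfolding ball_Un by (simp add: mult_2)
  qed
  also have "v l 1 = c * v l (N + 1) \<longleftrightarrow> Q l (N - 1) = c"
    using v_first[OF l] v_mid[OF l] c c0 by (auto simp: power2_eq_square)
  also have "v l N = c * v l (2 * N) \<longleftrightarrow> c * l 1 = lb l 1 * P l (N - 1)"
  proof -
    have e: "v l N = L / P l (N - 1)" "v l (2 * N) = lb l 1 / l 1" using v_low[OF l, of N] v_last[OF l] N4 by auto
    have "v l N = c * v l (2 * N) \<longleftrightarrow> c * (c * l 1) = c * (lb l 1 * P l (N - 1))"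
      unfolding e c[symmetric] using P_nonzero[OF l, of "N - 1"] BD_nonzero[OF l, of 1] N4
      by (auto simp: power2_eq_square field_simps)
    then show ?thesis using c0 by simp
  qed
  also have "(\<forall>j\<in>{2..N-1}. v l j = c * v l (N + j)) \<longleftrightarrow> (\<forall>i\<in>{2..N-1}. v l (N + 1 - i) = c * v l (rv i))"
  proof -
    have *: "j \<in> {2..N-1} \<Longrightarrow> N + 1 - j \<in> {2..N-1} \<and> rv (N + 1 - j) = N + j \<and> N + 1 - (N + 1 - j) = j \<and> rv j = N + (N + 1 - j)" for j
      by (auto simp: rv_def)
    show ?thesis using * by metis
  qed
  also have "\<dots> \<longleftrightarrow> (\<forall>i\<in>{2..N-1}. c * l i = Q l (i - 1) * P l (N - i) * lsum l i)"
  proof (rule ball_cong)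
    fix i assume i: "i \<in> {2..N-1}"
    then have e: "v l (N + 1 - i) = L / P l (N - i)" "v l (rv i) = Q l (i - 1) * (1 + lb l i / l i)"
      using v_low[OF l, of "N + 1 - i"] v_high[OF l, of i] by auto
    have "i < 2 * N" "1 \<le> i" using i by auto
    then have nz: "P l (N - i) \<noteq> 0" "l i \<noteq> 0" using P_nonzero[OF l] BD_nonzero[OF l, of i] by auto
    have "v l (N + 1 - i) = c * v l (rv i) \<longleftrightarrow> c * (c * l i) = c * (Q l (i - 1) * P l (N - i) * lsum l i)"
      unfolding e c[symmetric] using nz by (auto simp: power2_eq_square field_simps)
    then show "v l (N + 1 - i) = c * v l (rv i) \<longleftrightarrow> c * l i = Q l (i - 1) * P l (N - i) * lsum l i"
      using c0 by simp
  qed simp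
  finally show ?thesis .
qed

text \<open>The choice \<open>c = Q l (N - 1)\<close> is forced by \<open>lin_2_iff\<close>. The
  fixed-point equations relate neighbouring indices, so the conditions follow by descending
  induction from \<open>N - 1\<close>. The one at 2 then yields the condition on the first
  coordinate, and with it \<open>c\<^sup>2 = L\<close>.\<close>

lemma Sigma2_fixed_lin:
  assumes N: "even N" and l: "l \<in> BD N L" and s: "Sigma2 N l = l"
  shows "\<exists>c. c\<^sup>2 = L \<and> lin 2 c (v l)"
proof -
  define c where "c = Q l (N - 1)"
  have s1: "l (N - 1) * lb l (N - 1) / lsum l (N - 1) = l 1" "lb l 1 / l 1 = l N"
     "(l 1 * lb l 2 / l 2) * (l 2 / lb l 2 + 1) = l (N - 1)"
    and s2: "\<And>j. j \<in> {2..N-2} \<Longrightarrow> (l (N - j) * lb l (N - j) / l (N - j + 1)) * (lsum l (N - j + 1) / lsum l (N - j)) = l j"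
    using s unfolding Sigma2_fixed_iff[OF l] by blast+
  have nz: "l k \<noteq> 0" "lb l k \<noteq> 0" if "1 \<le> k" "k < 2 * N" for k
    using that BD_nonzero[OF l, of k] BD_bar_nonzero[OF l, of k] by auto
  have E: "c * l i = Q l (i - 1) * P l (N - i) * lsum l i" if "2 \<le> i" "i \<le> N - 1" for i
    using that(2,1)
  proof (induction i rule: inc_induct)
    case base
    \<comment> \<open>If the sum were zero, the quotient in the fixed-point equation would be 0
      because \<open>x / 0 = 0\<close>, whereas \<open>l 1\<close> is nonzero.\<close>
    have h: "lsum l (N - 1) \<noteq> 0" using s1(1) nz(1)[of 1] N4 by auto
    have "Q l (N - 1) = Q l (N - 2) * lb l (N - 1)" "P l (N - (N - 1)) = l 1"
      using Q_step[of "N - 1" l] N4 by (auto simp: P_def numeral_2_eq_2)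
    moreover have "l (N - 1) * lb l (N - 1) = l 1 * lsum l (N - 1)" using s1(1) h by (simp add: field_simps)
    ultimately show ?case by (simp add: c_def numeral_2_eq_2) (metis mult.commute mult.left_commute)
  next
    case (step i)
    have i: "2 \<le> i" "i < N - 1" using step by auto
    then have "N - i \<in> {2..N-2}" "N - (N - i) = i" by auto
    from s2[OF this(1)] this(2)
    have e: "l i * lb l i / l (i + 1) * (lsum l (i + 1) / lsum l i) = l (N - i)" by simp
    have n: "l (N - i) \<noteq> 0" "l (i + 1) \<noteq> 0" "lb l i \<noteq> 0" using nz i by auto
    then have "lsum l i \<noteq> 0" using e by auto
    then have e': "l i * lb l i * lsum l (i + 1) = l (N - i) * l (i + 1) * lsum l i" by (rule frac_eq_iff[THEN iffD1, OF n(2) _ e])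
    have IH: "c * l (i + 1) = Q l i * P l (N - Suc i) * lsum l (i + 1)" using step.IH i by simp
    have st: "Q l i = Q l (i - 1) * lb l i" "P l (N - i) = P l (N - Suc i) * l (N - i)"
      using Q_step[of i l] P_step[of "N - i" l] i by auto
    have "(c * l i) * (l (i + 1) * lb l i) = Q l i * P l (N - Suc i) * (l i * lb l i * lsum l (i + 1))"
      using IH by (simp add: mult_ac)
    also have "\<dots> = (Q l (i - 1) * P l (N - i) * lsum l i) * (l (i + 1) * lb l i)"
      unfolding e' st by (simp add: mult_ac)
    finally show ?case using n by simp
  qed
  have n: "l 1 \<noteq> 0" "l 2 \<noteq> 0" "lb l 2 \<noteq> 0" "P l (N - 1) \<noteq> 0" "l N \<noteq> 0"
    using nz N4 P_nonzero[OF l, of "N - 1"] by auto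
  have h: "l 1 * lsum l 2 = l (N - 1) * l 2" using s1(3) n unfolding ratio_simps(1)[OF n(3,2)] by (simp add: field_simps del: distrib_left distrib_right)
  have PN: "P l (N - 1) = P l (N - 2) * l (N - 1)" "Q l 1 = lb l 1"
    using P_step[of "N - 1" l] N4 by (auto simp: numeral_2_eq_2 Q_def)
  have "(c * l 1) * l 2 = l 1 * (c * l 2)" by simp
  also have "\<dots> = (lb l 1 * P l (N - 2)) * (l 1 * lsum l 2)" using E[of 2] N4 PN(2) by (simp add: mult_ac)
  also have "\<dots> = (lb l 1 * P l (N - 1)) * l 2" unfolding h PN(1) by (simp add: mult_ac)
  finally have E1: "c * l 1 = lb l 1 * P l (N - 1)" using n by simp
  have "L = c * (P l (N - 1) * l N)" using PQ_total(1)[OF l] by (simp add: c_def mult_ac)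
  also have "P l (N - 1) * l N = c"
    using E1 s1(2) n by (simp add: field_simps)
  finally have "c\<^sup>2 = L" by (simp add: power2_eq_square)
  then show ?thesis using lin_2_iff[OF l] E1 E c_def by auto
qed

lemma lin_Sigma2_fixed:
  assumes N: "even N" and l: "l \<in> BD N L" and c: "c\<^sup>2 = L" and s: "lin 2 c (v l)"
  shows "Sigma2 N l = l"
proof -
  have c0: "c \<noteq> 0" using c L0[OF l] by auto
  have nz: "l k \<noteq> 0" "lb l k \<noteq> 0" if "1 \<le> k" "k < 2 * N" for k
    using that BD_nonzero[OF l, of k] BD_bar_nonzero[OF l, of k] by auto
  have E1: "Q l (N - 1) = c" "c * l 1 = lb l 1 * P l (N - 1)"
    and E: "\<And>i. i \<in> {2..N-1} \<Longrightarrow> c * l i = Q l (i - 1) * P l (N - i) * lsum l i"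
    using s unfolding lin_2_iff[OF l c] by auto
  \<comment> \<open>The counterpart of \<open>E\<close> for the barred coordinates. It expresses the
    condition on the first column \<open>u\<close>, and it supplies the barred half of the
    fixed-point equations.\<close>
  have F: "c * lb l k = Q l (N - k) * P l (k - 1) * lsum l k" if k: "k \<in> {2..N-1}" for k
  proof -
    have "u l (N + k) = c * u l k" using k N4 by (intro lin_u_mid[OF N _ l c s]) auto
    moreover have "u l k = P l (k - 1) * (1 + l k / lb l k)" using u_low[OF l, of k] k by auto
    moreover have "u l (N + k) = L / Q l (N - k)"
    proof -
      have "rv (N + 1 - k) = N + k" "N + 1 - k < N" "1 \<le> N + 1 - k" using k by (auto simp: rv_def)
      then show ?thesis using u_high[OF l, of "N + 1 - k"] by simp
    qed
    ultimately have "c * c / Q l (N - k) = c * (P l (k - 1) * (1 + l k / lb l k))"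
      using c by (simp add: power2_eq_square)
    moreover have "k < 2 * N" "1 \<le> k" using k by auto
    then have n: "lb l k \<noteq> 0" "Q l (N - k) \<noteq> 0" using nz(2)[of k] Q_nonzero[OF l, of "N - k"] by auto
    ultimately have "c * c = c * (P l (k - 1) * (1 + l k / lb l k) * Q l (N - k))" by (simp add: field_simps)
    then have "c = P l (k - 1) * (1 + l k / lb l k) * Q l (N - k)" using c0 by simp
    then have "c * lb l k = P l (k - 1) * ((1 + l k / lb l k) * lb l k) * Q l (N - k)" by (simp add: mult_ac)
    also have "(1 + l k / lb l k) * lb l k = lsum l k" using n by (simp add: field_simps)
    finally show ?thesis by (simp add: mult_ac)
  qed
  have hz: "lsum l i \<noteq> 0" if "i \<in> {2..N-1}" for i using E[OF that] nz(1)[of i] that c0 by auto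
  have pq: "P l i \<noteq> 0" "Q l i \<noteq> 0" if "i \<le> N" for i using that P_nonzero[OF l] Q_nonzero[OF l] by auto
  have P1: "P l 1 = l 1" "Q l 1 = lb l 1" by (auto simp: P_def Q_def)
  have PN: "P l (N - 1) = P l (N - 2) * l (N - 1)" "Q l (N - 1) = Q l (N - 2) * lb l (N - 1)"
    using P_step[of "N - 1" l] Q_step[of "N - 1" l] N4 by (auto simp: numeral_2_eq_2)
  have two: "2 \<in> {2..N-1}" "N - 1 \<in> {2..N-1}" "N - (N - 1) = 1" "N - 1 - 1 = N - 2" "2 - 1 = (1::nat)" using N4 by auto
  have lN: "lb l 1 = l N * l 1"
  proof -
    have "c * (P l (N - 1) * l N) = c * c" using PQ_total(1)[OF l] E1 c by (simp add: mult_ac power2_eq_square)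
    then have "P l (N - 1) * l N = c" using c0 by simp
    moreover have "P l (N - 1) * (l N * l 1) = (P l (N - 1) * l N) * l 1" by simp
    ultimately have "P l (N - 1) * (l N * l 1) = P l (N - 1) * lb l 1" using E1(2) by (simp only: mult.commute)
    then show ?thesis using pq(1)[of "N - 1"] by simp
  qed
  have a: "l (N - 1) * lb l (N - 1) = l 1 * lsum l (N - 1)"
  proof -
    have "Q l (N - 2) * (lb l (N - 1) * l (N - 1)) = Q l (N - 2) * (l 1 * lsum l (N - 1))"
      using E[OF two(2)] E1(1) PN(2) P1 two by (simp add: mult_ac)
    then show ?thesis using pq(2)[of "N - 2"] by (simp add: mult.commute)
  qed
  have b: "l 1 * lsum l 2 = l (N - 1) * l 2"
  proof -
    have "(lb l 1 * P l (N - 2)) * (l 1 * lsum l 2) = l 1 * (c * l 2)"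
      using E[OF two(1)] P1 by (simp add: mult_ac)
    also have "\<dots> = (lb l 1 * P l (N - 2)) * (l (N - 1) * l 2)" using E1(2) PN(1) by (simp add: mult_ac)
    finally show ?thesis using pq(1)[of "N - 2"] nz(2)[of 1] N4 by simp
  qed
  have b': "l 1 * lsum l 2 = lb l (N - 1) * lb l 2"
  proof -
    have "Q l (N - 2) * (l 1 * lsum l 2) = c * lb l 2" using F[OF two(1)] P1 two(5) by (simp add: mult_ac)
    also have "\<dots> = Q l (N - 2) * (lb l (N - 1) * lb l 2)" unfolding E1(1)[symmetric] PN(2) by simp
    finally have "Q l (N - 2) * (l 1 * lsum l 2) = Q l (N - 2) * (lb l (N - 1) * lb l 2)" .
    then show ?thesis using pq(2)[of "N - 2"] by (simp add: mult.commute)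
  qed
  \<comment> \<open>Comparing the conditions at \<open>i\<close> and at \<open>i + 1\<close> cancels
    the partial products up to one factor each.\<close>
  have d: "l j * l (i + 1) * lsum l i = l i * lb l i * lsum l (i + 1)" and d': "lb l j * lb l (i + 1) * lsum l i = l i * lb l i * lsum l (i + 1)"
    if ij: "j \<in> {2..N-2}" "i = N - j" for i j
  proof -
    have i: "i \<in> {2..N-1}" "i + 1 \<in> {2..N-1}" "N - i = j" "N - (i + 1) = j - 1" "1 \<le> i" "1 \<le> j" using ij by auto
    have st: "P l j = P l (j - 1) * l j" "Q l i = Q l (i - 1) * lb l i" "Q l j = Q l (j - 1) * lb l j" "P l i = P l (i - 1) * l i"
      using P_step[OF i(6)] Q_step[OF i(6)] P_step[OF i(5)] Q_step[OF i(5)] by auto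
    have n: "Q l (i - 1) \<noteq> 0" "P l (j - 1) \<noteq> 0" "P l (i - 1) \<noteq> 0" "Q l (j - 1) \<noteq> 0" using pq ij by auto
    have "(Q l (i - 1) * P l (j - 1)) * (l j * l (i + 1) * lsum l i) = (c * l i) * l (i + 1)"
      using E[OF i(1)] i st by (simp add: mult_ac)
    also have "\<dots> = l i * (c * l (i + 1))" by simp
    also have "\<dots> = (Q l (i - 1) * P l (j - 1)) * (l i * lb l i * lsum l (i + 1))"
      using E[OF i(2)] i st by (simp add: mult_ac)
    finally show "l j * l (i + 1) * lsum l i = l i * lb l i * lsum l (i + 1)" using n by simp
    have "(Q l (j - 1) * P l (i - 1)) * (lb l j * lb l (i + 1) * lsum l i) = (c * lb l i) * lb l (i + 1)"
      using F[OF i(1)] i st by (simp add: mult_ac)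
    also have "\<dots> = lb l i * (c * lb l (i + 1))" by simp
    also have "\<dots> = (Q l (j - 1) * P l (i - 1)) * (l i * lb l i * lsum l (i + 1))"
      using F[OF i(2)] i st by (simp add: mult_ac)
    finally show "lb l j * lb l (i + 1) * lsum l i = l i * lb l i * lsum l (i + 1)" using n by simp
  qed
  show ?thesis
    unfolding Sigma2_fixed_iff[OF l]
  proof (intro conjI ballI)
    have n: "l 1 \<noteq> 0" "l 2 \<noteq> 0" "lb l 2 \<noteq> 0" "lsum l (N - 1) \<noteq> 0" "l N \<noteq> 0"
      using nz N4 hz[OF two(2)] by auto
    show "l (N - 1) * lb l (N - 1) / lsum l (N - 1) = l 1" using a n by (simp add: field_simps)
    show "lb l 1 / l 1 = l N" using lN n by simp
    show "l 1 * lb l 2 / l 2 * (l 2 / lb l 2 + 1) = l (N - 1)"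
      unfolding ratio_simps(1)[OF n(3,2)] b using n by simp
    show "l N * l (N - 1) * lb l (N - 1) / lsum l (N - 1) = lb l 1"
      using a n lN by (simp add: mult.assoc)
    show "l 1 * (l 2 / lb l 2 + 1) = lb l (N - 1)"
      unfolding ratio_simps(2)[OF n(3)] b' using n by simp
  next
    fix j assume j: "j \<in> {2..N-2}"
    then have "N - j \<in> {2..N-1}" "N - j + 1 < 2 * N" by auto
    then have n: "lsum l (N - j) \<noteq> 0" "l (N - j + 1) \<noteq> 0" "lb l (N - j + 1) \<noteq> 0" using hz nz[of "N - j + 1"] by auto
    show "l (N - j) * lb l (N - j) / l (N - j + 1) * (lsum l (N - j + 1) / lsum l (N - j)) = l j"
      by (rule frac_eq_iff[THEN iffD2, OF n(2,1) d[OF j refl, symmetric]])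
    show "l (N - j) * lb l (N - j) / lb l (N - j + 1) * (lsum l (N - j + 1) / lsum l (N - j)) = lb l j"
      by (rule frac_eq_iff[THEN iffD2, OF n(3,1) d'[OF j refl, symmetric]])
  qed
qed

section \<open>Rescaling the first coordinates, and fixed points of Sigma_4\<close>

definition rescale :: "complex \<Rightarrow> pt \<Rightarrow> pt" where
  "rescale s l = mk_pt N (l(1 := l 1 * s)) ((lb l)(1 := lb l 1 / s))"

lemma rescale_BD: assumes l: "l \<in> BD N L" and s: "s \<noteq> 0" shows "rescale s l \<in> BD N L"
  unfolding rescale_def
proof (rule mk_pt_BD)
  fix k assume "1 \<le> k" "k \<le> N"
  then show "(l(1 := l 1 * s)) k \<noteq> 0" using s BD_nonzero[OF l, of k] N4 by auto
next
  fix k assume "1 \<le> k" "k < N"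
  then show "((lb l)(1 := lb l 1 / s)) k \<noteq> 0" using s BD_bar_nonzero[OF l, of k] N4 by auto
next
  have e: "{1..N} = insert 1 {2..N}" "{1..N-1} = insert 1 {2..N-1}" using N4 by auto
  have "(\<Prod>k=2..N. mk_pt N (l(1 := l 1 * s)) ((lb l)(1 := lb l 1 / s)) k) = (\<Prod>k=2..N. l k)"
    "(\<Prod>k=2..N-1. lb (mk_pt N (l(1 := l 1 * s)) ((lb l)(1 := lb l 1 / s))) k) = (\<Prod>k=2..N-1. lb l k)"
    by (intro prod.cong; auto)+
  then show "P (mk_pt N (l(1 := l 1 * s)) ((lb l)(1 := lb l 1 / s))) N
      * Q (mk_pt N (l(1 := l 1 * s)) ((lb l)(1 := lb l 1 / s))) (N - 1) = L"
    using BD_prod[OF l] N4 s unfolding P_def Q_def e by (simp add: mult_ac)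
qed

text \<open>Up to the common factor \<open>1/s\<close> this is the action of the diagonal orthogonal
  matrix with entries \<open>s\<close>, 1, ..., 1, \<open>1/s\<close>. One value of \<open>s\<close>
  gives \<open>Sigma0\<close>; with \<open>s\<close> variable it provides the curves for equal
  parameters.\<close>

lemma v_rescale:
  assumes l: "l \<in> BD N L" and s: "s \<noteq> 0"
  shows "v (rescale s l) 1 = L" "v (rescale s l) (2 * N) = v l (2 * N) / s\<^sup>2"
    "\<And>j. 1 < j \<Longrightarrow> j < 2 * N \<Longrightarrow> v (rescale s l) j = v l j / s"
proof -
  note B = rescale_BD[OF l s]
  have a: "rescale s l i = (if i = 1 then l 1 * s else l i)" if "1 \<le> i" "i \<le> N" for i
    using that by (auto simp: rescale_def)
  have b: "lb (rescale s l) i = (if i = 1 then lb l 1 / s else lb l i)" if "1 \<le> i" "i < N" for i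
    using that by (auto simp: rescale_def)
  show "v (rescale s l) 1 = L" by (rule v_first[OF B])
  show "v (rescale s l) (2 * N) = v l (2 * N) / s\<^sup>2"
    using v_last[OF B] v_last[OF l] a[of 1] b[of 1] N4 by (simp add: power2_eq_square)
  have P: "P (rescale s l) k = P l k * s" if "1 \<le> k" "k \<le> N" for k
    using that
  proof (induction k rule: nat_induct_at_least)
    case base
    then show ?case using a[of 1] N4 by (simp add: P_def)
  next
    case (Suc k)
    then show ?case using P_step[of "Suc k"] a[of "Suc k"] by simp
  qed
  have Q: "Q (rescale s l) k = Q l k / s" if "1 \<le> k" "k < N" for k
    using that
  proof (induction k rule: nat_induct_at_least)
    case base
    then show ?case using b[of 1] N4 by (simp add: Q_def)
  next
    case (Suc k)
    then show ?case using Q_step[of "Suc k"] b[of "Suc k"] by simp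
  qed
  fix j assume "1 < j" "j < 2 * N"
  then consider "j \<le> N" | "j = N + 1" | "N + 1 < j" by linarith
  then show "v (rescale s l) j = v l j / s"
  proof cases
    case 1
    then show ?thesis using \<open>1 < j\<close> v_low[OF B, of j] v_low[OF l, of j] P[of "j - 1"] by simp
  next
    case 2
    then show ?thesis using v_mid[OF B] v_mid[OF l] Q[of "N - 1"] N4 by simp
  next
    case 3
    define i where "i = rv j"
    have i: "1 < i" "i < N" "j = rv i" using 3 \<open>j < 2 * N\<close> by (auto simp: i_def rv_def)
    then show ?thesis using v_high[OF B i(1,2)] v_high[OF l i(1,2)] Q[of "i - 1"] a[of i] b[of i] by simp
  qed
qed

lemma Sigma0_rescale:
  assumes l: "l \<in> BD N L"
  shows "Sigma0 N l = rescale (lb l 1 / l 1) l" "lb l 1 / l 1 \<noteq> 0"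
  using BD_nonzero[OF l, of 1] BD_bar_nonzero[OF l, of 1] N4 by (simp_all add: Sigma0_def rescale_def)

lemma Sigma0_BD: "l \<in> BD N L \<Longrightarrow> Sigma0 N l \<in> BD N L"
  using rescale_BD Sigma0_rescale by metis

lemma Sigma0_Sigma0: assumes l: "l \<in> BD N L" shows "Sigma0 N (Sigma0 N l) = l"
  unfolding Sigma0_def[of N "Sigma0 N l"] mk_pt_eq_iff[OF l] using N4 by (auto simp: Sigma0_def)

lemma Sigma2_low:
  assumes "1 \<le> j" "j \<le> N"
  shows "Sigma2 N k j = (if j = 1 then k (N - 1) * lb k (N - 1) / lsum k (N - 1)
       else if j = N then lb k 1 / k 1
       else if j = N - 1 then k 1 * lb k 2 / k 2 * (k 2 / lb k 2 + 1)
       else k (N - j) * lb k (N - j) / k (N - j + 1) * (lsum k (N - j + 1) / lsum k (N - j)))"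
  using assms by (simp add: Sigma2_def Let_def)

lemma Sigma2_bar:
  assumes "1 \<le> j" "j < N"
  shows "lb (Sigma2 N k) j = (if j = 1 then k N * k (N - 1) * lb k (N - 1) / lsum k (N - 1)
       else if j = N - 1 then k 1 * (k 2 / lb k 2 + 1)
       else k (N - j) * lb k (N - j) / lb k (N - j + 1) * (lsum k (N - j + 1) / lsum k (N - j)))"
  using assms by (simp add: Sigma2_def Let_def)

text \<open>Consequently Sigma_4 is the conjugate of Sigma_2 by Sigma_0, and its fixed points reduce
  to those of Sigma_2. The factor \<open>k N\<close> cancels from each quotient concerned, and this
  remains correct under \<open>x / 0 = 0\<close> when a sum in a denominator vanishes.\<close>

lemma Sigma2_Sigma1:
  assumes k: "k N \<noteq> 0"
  shows "Sigma2 N (Sigma1 N k) = Sigma0 N (Sigma2 N k)"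
proof -
  define k' where "k' = Sigma1 N k"
  have a: "k' i = k i" if "1 \<le> i" "i < N - 1" for i
    using that N4 by (auto simp: k'_def Sigma1_def)
  have b: "lb k' i = lb k i" if "1 \<le> i" "i < N - 1" for i
    using that by (auto simp: k'_def Sigma1_def)
  have ab: "k' (N - 1) = k (N - 1) * k N" "k' N = 1 / k N" "lb k' (N - 1) = k N * lb k (N - 1)"
    using N4 unfolding k'_def Sigma1_def by (subst mk_pt_low bar_mk_pt; auto)+
  have 1: "Sigma2 N k' j = (if j = 1 then lb (Sigma2 N k) 1 else Sigma2 N k j)" if j: "1 \<le> j" "j \<le> N" for j
  proof -
    consider "j = 1" | "j = N" | "j = N - 1" | "j = 2" | "2 < j" "j < N - 1" using j by linarith
    then show ?thesis
    proof cases
      case 1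
      have "Sigma2 N k' 1 = k' (N - 1) * lb k' (N - 1) / lsum k' (N - 1)" using Sigma2_low[of 1 k'] N4 by simp
      then have "Sigma2 N k' 1 = k N * k (N - 1) * lb k (N - 1) / lsum k (N - 1)"
        unfolding ab cancel_common(3)[OF k] .
      then show ?thesis using 1 Sigma2_bar[of 1 k] N4 by simp
    next
      case 2
      then show ?thesis using Sigma2_low[of N k'] Sigma2_low[of N k] N4 a[of 1] b[of 1] by simp
    next
      case 3
      then show ?thesis
        using Sigma2_low[of "N - 1" k'] Sigma2_low[of "N - 1" k] N4 a[of 1] a[of 2] b[of 2] by auto
    next
      case 4
      have *: "N - 2 + 1 = N - 1" "2 \<noteq> N - 1" "2 \<noteq> N" "2 \<noteq> (1::nat)" using N4 by auto
      show ?thesis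
        unfolding 4 Sigma2_low[OF j(1)[unfolded 4] j(2)[unfolded 4]]
        using * a[of "N - 2"] b[of "N - 2"] N4 cancel_common(1)[OF k, of "k (N - 2) * lb k (N - 2)" "k (N - 1)" "lb k (N - 1)" "lsum k (N - 2)"]
        by (simp only: ab if_False)
    next
      case 5
      have *: "1 \<le> N - j" "N - j < N - 1" "1 \<le> N - j + 1" "N - j + 1 < N - 1" using 5 by auto
      show ?thesis
        unfolding Sigma2_low[OF j] a[OF *(1,2)] a[OF *(3,4)] b[OF *(1,2)] b[OF *(3,4)] using 5 by auto
    qed
  qed
  have 2: "lb (Sigma2 N k') j = (if j = 1 then Sigma2 N k 1 else lb (Sigma2 N k) j)" if j: "1 \<le> j" "j < N" for j
  proof -
    consider "j = 1" | "j = N - 1" | "j = 2" | "2 < j" "j < N - 1" using j by linarith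
    then show ?thesis
    proof cases
      case 1
      have "lb (Sigma2 N k') 1 = k' N * k' (N - 1) * lb k' (N - 1) / lsum k' (N - 1)" using Sigma2_bar[of 1 k'] N4 by simp
      then have "lb (Sigma2 N k') 1 = k (N - 1) * lb k (N - 1) / lsum k (N - 1)"
        unfolding ab cancel_common(4)[OF k] .
      then show ?thesis using 1 Sigma2_low[of 1 k] N4 by simp
    next
      case 2
      then show ?thesis
        using Sigma2_bar[of "N - 1" k'] Sigma2_bar[of "N - 1" k] N4 a[of 1] a[of 2] b[of 2] by auto
    next
      case 3
      have *: "N - 2 + 1 = N - 1" "2 \<noteq> N - 1" "2 \<noteq> N" "2 \<noteq> (1::nat)" using N4 by auto
      show ?thesis
        unfolding 3 Sigma2_bar[OF j(1)[unfolded 3] j(2)[unfolded 3]]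
        using * a[of "N - 2"] b[of "N - 2"] N4 cancel_common(2)[OF k, of "k (N - 2) * lb k (N - 2)" "lb k (N - 1)" "k (N - 1)" "lsum k (N - 2)"]
        by (simp only: ab if_False)
    next
      case 4
      have *: "1 \<le> N - j" "N - j < N - 1" "1 \<le> N - j + 1" "N - j + 1 < N - 1" using 4 by auto
      show ?thesis
        unfolding Sigma2_bar[OF j] a[OF *(1,2)] a[OF *(3,4)] b[OF *(1,2)] b[OF *(3,4)] using 4 by simp
    qed
  qed
  obtain f g where fg: "Sigma2 N k' = mk_pt N f g" by (auto simp: Sigma2_def Let_def)
  show ?thesis
    unfolding k'_def[symmetric] Sigma0_def fg
    by (rule mk_pt_cong) (use 1 2 in \<open>auto simp: fg\<close>)
qed

lemma v_Sigma0:
  assumes l: "l \<in> BD N L"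
  defines "r \<equiv> l 1 / lb l 1"
  shows "v (Sigma0 N l) 1 = L" "v (Sigma0 N l) (2 * N) = r"
    "\<And>j. 1 < j \<Longrightarrow> j < 2 * N \<Longrightarrow> v (Sigma0 N l) j = r * v l j"
  using v_rescale[OF l Sigma0_rescale(2)[OF l]] v_last[OF l] unfolding Sigma0_rescale(1)[OF l] r_def
  by (simp_all add: power2_eq_square)

text \<open>\<open>Sigma0\<close> multiplies the entries strictly between 1 and 2N by
  \<open>r\<close>, keeps the first one and replaces the last one by \<open>r\<close>. The relation
  \<open>r * v l (2 * N) = 1\<close> then turns one set of equations into the other.\<close>

lemma lin_4_iff:
  assumes l: "l \<in> BD N L" and c: "c\<^sup>2 = L"
  shows "lin 4 c (v l) \<longleftrightarrow> lin 2 c (v (Sigma0 N l))"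
proof -
  have c0: "c \<noteq> 0" using c L0[OF l] by auto
  define r where "r = l 1 / lb l 1"
  have r: "r \<noteq> 0" "r * v l (2 * N) = 1"
    using BD_nonzero[OF l, of 1] BD_bar_nonzero[OF l, of 1] v_last[OF l] N4 by (auto simp: r_def)
  note s = v_Sigma0[OF l, folded r_def]
  have "{1..N} = {1, N} \<union> {2..<N}" using N4 by auto
  then have "lin 2 c (v (Sigma0 N l)) \<longleftrightarrow> L = c * (r * v l (N + 1)) \<and> r * v l N = c * r \<and> (\<forall>j\<in>{2..<N}. r * v l j = c * (r * v l (N + j)))"
    unfolding lin_def using s N4 by (auto simp: mult_2[symmetric])
  also have "r * v l N = c * r \<longleftrightarrow> v l 1 = c * v l N"
    using r(1) c0 c v_first[OF l] by (auto simp: power2_eq_square)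
  also have "L = c * (r * v l (N + 1)) \<longleftrightarrow> v l (N + 1) = c * v l (2 * N)"
  proof -
    have "L = c * (r * v l (N + 1)) \<longleftrightarrow> c * (r * (c * v l (2 * N))) = c * (r * v l (N + 1))"
      using r(2) c by (simp add: power2_eq_square mult.left_commute[of r])
    then show ?thesis using r(1) c0 by auto
  qed
  also have "(\<forall>j\<in>{2..<N}. r * v l j = c * (r * v l (N + j))) \<longleftrightarrow> (\<forall>j\<in>{2..<N}. v l j = c * v l (N + j))"
    using r(1) by (simp add: mult.left_commute[of c r])
  finally show ?thesis by (auto simp: lin_def)
qed

lemma X_var_eq:
  assumes i: "i \<in> {1,2,3,4}" and N: "N = rankN i n"
  shows "X_var i n L = Xset i L"
proof -
  have ev: "even N" if "i = 2 \<or> i = 4" using that N by (auto simp: rankN_def)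
  have "Sigma_inv i N l = l \<longleftrightarrow> (\<exists>c. c\<^sup>2 = L \<and> lin i c (v l))" if l: "l \<in> BD N L" for l
  proof -
    have sq: "\<exists>c. c\<^sup>2 = L" using power2_csqrt[of L] by blast
    consider "i = 1" | "i = 3" | "i = 2" | "i = 4" using i by auto
    then show ?thesis
    proof cases
      case 1
      then show ?thesis using Sigma1_fixed[OF l] v_N_eq_iff[OF l] sq by (auto simp: Sigma_inv_def lin_def)
    next
      case 2
      then show ?thesis using Sigma3_fixed[OF l] v_N_eq_iff[OF l] v_first_eq_iff[OF l] sq by (auto simp: Sigma_inv_def lin_def)
    next
      case 3
      then show ?thesis
        using Sigma2_fixed_lin[OF ev l] lin_Sigma2_fixed[OF ev l] by (auto simp: Sigma_inv_def)
    next
      case 4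
      note B = Sigma0_BD[OF l]
      have "Sigma_inv i N l = Sigma0 N (Sigma2 N (Sigma0 N l))"
        using 4 Sigma2_Sigma1[of "Sigma0 N l"] BD_nonzero[OF B, of N] N4 by (simp add: Sigma_inv_def)
      moreover have "Sigma0 N (Sigma2 N (Sigma0 N l)) = l \<longleftrightarrow> Sigma2 N (Sigma0 N l) = Sigma0 N l"
      proof
        assume *: "Sigma0 N (Sigma2 N (Sigma0 N l)) = l"
        obtain f g where fg: "Sigma2 N (Sigma0 N l) = mk_pt N f g" by (auto simp: Sigma2_def Let_def)
        \<comment> \<open>The value of \<open>Sigma2\<close> is not known to lie in
          \<open>BD N L\<close>, so the involution property is derived from its shape as an
          \<open>mk_pt\<close> instead.\<close>
        have "Sigma0 N (Sigma0 N (mk_pt N f g)) = mk_pt N f g"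
          unfolding Sigma0_def by (rule mk_pt_cong) (use N4 in auto)
        then show "Sigma2 N (Sigma0 N l) = Sigma0 N l" using * unfolding fg by simp
      qed (simp add: Sigma0_Sigma0[OF l])
      ultimately show ?thesis
        using Sigma2_fixed_lin[OF ev B] lin_Sigma2_fixed[OF ev B] lin_4_iff[OF l] 4 by auto
    qed
  qed
  then show ?thesis unfolding X_var_def Xset_def N[symmetric] by blast
qed

end

section \<open>Density of the generic points\<close>

definition polyf :: "(complex \<Rightarrow> complex) \<Rightarrow> bool" where
  "polyf f \<longleftrightarrow> (\<exists>p. \<forall>t. f t = poly p t)"

lemma polyf_const: "polyf (\<lambda>t. c)"
  unfolding polyf_def by (rule exI[of _ "[:c:]"]) simp

lemma polyf_id: "polyf (\<lambda>t. t)"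
  unfolding polyf_def by (rule exI[of _ "[:0, 1:]"]) simp

lemma polyf_add: "polyf f \<Longrightarrow> polyf g \<Longrightarrow> polyf (\<lambda>t. f t + g t)"
  unfolding polyf_def by (metis poly_add)

lemma polyf_mult: "polyf f \<Longrightarrow> polyf g \<Longrightarrow> polyf (\<lambda>t. f t * g t)"
  unfolding polyf_def by (metis poly_mult)

lemma polyf_diff: "polyf f \<Longrightarrow> polyf g \<Longrightarrow> polyf (\<lambda>t. f t - g t)"
  unfolding polyf_def by (metis poly_diff)

lemma polyf_power: "polyf f \<Longrightarrow> polyf (\<lambda>t. f t ^ n)"
  unfolding polyf_def by (metis poly_power)

lemma polyf_sum: "(\<And>i. i \<in> A \<Longrightarrow> polyf (f i)) \<Longrightarrow> polyf (\<lambda>t. \<Sum>i\<in>A. f i t)"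
  by (induction A rule: infinite_finite_induct) (auto intro: polyf_const polyf_add)

lemma polyf_prod: "(\<And>i. i \<in> A \<Longrightarrow> polyf (f i)) \<Longrightarrow> polyf (\<lambda>t. \<Prod>i\<in>A. f i t)"
  by (induction A rule: infinite_finite_induct) (auto intro: polyf_const polyf_mult)

lemma polyf_tendsto: "polyf f \<Longrightarrow> (f \<longlongrightarrow> f a) (at a)"
proof -
  assume "polyf f"
  then obtain p where p: "\<And>t. f t = poly p t" unfolding polyf_def by blast
  then have "f = poly p" by auto
  moreover have "isCont (poly p) a" by simp
  ultimately show ?thesis using isContD by blast
qed

text \<open>A nonzero polynomial has finitely many roots. Thus a condition verified at one end of a
  curve holds close to the other end.\<close>

lemma polyf_eventually_nonzero:
  assumes "polyf f" "f b \<noteq> 0" shows "\<forall>\<^sub>F t in at a. f t \<noteq> 0"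
proof -
  from assms(1) obtain p where p: "\<And>t. f t = poly p t" unfolding polyf_def by blast
  then have "p \<noteq> 0" using assms(2) by auto
  then have "finite {t. f t = 0}" using poly_roots_finite p by simp
  then have "open (- ({t. f t = 0} - {a}))" by (intro open_Compl finite_imp_closed) auto
  then show ?thesis unfolding eventually_at_topological by (intro exI[of _ "- ({t. f t = 0} - {a})"]) auto
qed

context D_rank begin

section \<open>Curves of isotropic vectors in the linear spaces\<close>

lemma lin_cong:
  assumes "\<And>j. j \<in> R \<Longrightarrow> w j = w' j" "lin i c w" shows "lin i c w'"
proof -
  have e: "w 1 = w' 1" "w N = w' N" "w (N + 1) = w' (N + 1)" "w (2 * N) = w' (2 * N)"
    by (rule assms(1), use N4 in simp)+
  have m: "w j = w' j" "w (N + j) = w' (N + j)" if "j \<in> {1..N}" for j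
    by (rule assms(1), use that in simp)+
  have "(\<forall>j\<in>{1..N}. w j = c * w (N + j)) \<longleftrightarrow> (\<forall>j\<in>{1..N}. w' j = c * w' (N + j))"
    by (intro ball_cong refl) (simp only: m)
  moreover have "(\<forall>j\<in>{2..<N}. w j = c * w (N + j)) \<longleftrightarrow> (\<forall>j\<in>{2..<N}. w' j = c * w' (N + j))"
    by (intro ball_cong refl) (simp add: m)
  ultimately show ?thesis using assms(2) unfolding lin_def e by (simp only:)
qed

lemma lin_combine:
  assumes "lin i c x" "lin i c y" shows "lin i c (\<lambda>j. a * x j + b * y j)"
proof -
  have e: "a * x j + b * y j = k * (a * x q + b * y q)" if "x j = k * x q" "y j = k * y q" for j q k
    unfolding that by (simp add: algebra_simps)
  consider "i = 1" | "i = 3" | "i = 2" | "i \<noteq> 1" "i \<noteq> 3" "i \<noteq> 2" by blast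
  then show ?thesis
  proof cases
    case 1
    then show ?thesis using assms by (simp add: lin_def)
  next
    case 2
    then show ?thesis using assms e[of 1 "c\<^sup>2" "2 * N"] by (simp add: lin_def)
  next
    case 3
    then have "x j = c * x (N + j)" "y j = c * y (N + j)" if "j \<in> {1..N}" for j
      using assms that by (simp_all add: lin_def)
    then have "\<forall>j\<in>{1..N}. a * x j + b * y j = c * (a * x (N + j) + b * y (N + j))"
      using e by blast
    then show ?thesis using 3 by (simp add: lin_def)
  next
    case 4
    then have "x j = c * x (N + j)" "y j = c * y (N + j)" if "j \<in> {2..<N}" for j
      using assms that by (simp_all add: lin_def)
    then have "\<forall>j\<in>{2..<N}. a * x j + b * y j = c * (a * x (N + j) + b * y (N + j))"
      using e by blast
    then show ?thesis
      using 4 assms e[of 1 c N] e[of "N + 1" c "2 * N"] by (simp add: lin_def)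
  qed
qed

lemma lin_scale:
  assumes "lin i c x" shows "lin i c (\<lambda>j. a * x j)"
  using lin_combine[OF assms assms, of a 0] by simp

lemma sg_mid: "sg N = sg (N + 1)" "sg 1 = sg (2 * N)"
  using sg_rv[of N] sg_rv[of 1] N4 by (auto simp: rv_def)

text \<open>For i = 2 and i = 4 paired indices carry opposite signs because N is even, so the twist
  exchanges the spaces of \<open>c\<close> and \<open>- c\<close>. For i = 1 and i = 3 paired
  indices carry equal signs, and only the square of \<open>c\<close> matters.\<close>

lemma lin_twist:
  assumes N: "i = 2 \<or> i = 4 \<Longrightarrow> even N" and i: "i \<in> {1,2,3,4}" and w: "lin i c w"
  shows "lin i (- c) (\<lambda>j. sg j * w j)"
proof -
  consider "i = 1" | "i = 3" | "i = 2" | "i = 4" using i by auto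
  then show ?thesis
  proof cases
    case 3
    then have e: "even N" using N by blast
    show ?thesis using w 3 sg_shift[OF e] by (auto simp: lin_def)
  next
    case 4
    then have e: "even N" using N by blast
    have s: "sg (2 * N) = -1" "sg 1 = -1" "sg N = 1" "sg (N + 1) = 1"
      using sg_mid e N4 by (auto simp: sg_def)
    show ?thesis using w 4 sg_shift[OF e] s by (auto simp: lin_def)
  qed (use w sg_mid in \<open>auto simp: lin_def\<close>)
qed

lemma iso_twist: assumes "iso w" shows "iso (\<lambda>j. sg j * w j)"
proof -
  have "(\<Sum>k\<in>R. sg k * (sg k * w k) * (sg (rv k) * w (rv k))) = (\<Sum>k\<in>R. sg k * w k * w (rv k))"
    by (intro sum.cong refl) (simp add: mult_ac)
  then show ?thesis using assms by (simp add: iso_iff)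
qed

definition B2 :: "(nat \<Rightarrow> complex) \<Rightarrow> (nat \<Rightarrow> complex) \<Rightarrow> complex" where
  "B2 x y = (\<Sum>k\<in>R. sg k * x k * y (rv k))"

lemma B2_combine_left: "B2 (\<lambda>j. a * x j + b * y j) z = a * B2 x z + b * B2 y z"
proof -
  have "B2 (\<lambda>j. a * x j + b * y j) z = (\<Sum>k\<in>R. a * (sg k * x k * z (rv k)) + b * (sg k * y k * z (rv k)))"
    unfolding B2_def by (intro sum.cong refl) (simp add: algebra_simps)
  then show ?thesis unfolding B2_def by (simp only: sum.distrib sum_distrib_left)
qed

lemma B2_sym: "B2 x y = B2 y x"
  unfolding B2_def by (subst sum_rv[symmetric], rule sum.cong) auto

lemma B2_combine_right: "B2 z (\<lambda>j. a * x j + b * y j) = a * B2 z x + b * B2 z y"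
  unfolding B2_sym[of z] by (rule B2_combine_left)

lemma iso_B2: "iso w \<longleftrightarrow> B2 w w = 0"
  by (simp add: iso_iff B2_def)

definition E :: "nat \<Rightarrow> nat \<Rightarrow> complex" where "E p j = (if j = p then 1 else 0)"

lemma B2_E: assumes "p \<in> R" shows "B2 (E p) w = sg p * w (rv p)"
proof -
  have "B2 (E p) w = (\<Sum>k\<in>R. if k = p then sg p * w (rv p) else 0)"
    unfolding B2_def by (intro sum.cong) (auto simp: E_def)
  then show ?thesis using assms by simp
qed

text \<open>The quadratic form \<open>B2 w0 w1 * B2 x x - 2 * B2 x w0 * B2 x w1\<close> cannot vanish on the span of the
  unit vectors \<open>2\<close>, \<open>3\<close>, \<open>rv 2\<close>, \<open>rv 3\<close>: there \<open>B2\<close> has rank four, the product of linear forms at most two.\<close>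

lemma exists_nondegenerate:
  assumes i: "i = 1 \<or> i = 3" and g: "good w0" and b: "B2 w0 w1 \<noteq> 0"
  shows "\<exists>x. lin i c x \<and> B2 w0 w1 * B2 x x - 2 * B2 x w0 * B2 x w1 \<noteq> 0"
proof (rule ccontr)
  assume "\<not> ?thesis"
  then have *: "B2 w0 w1 * B2 x x = 2 * B2 x w0 * B2 x w1" if "lin i c x" for x using that by auto
  define p q where "p = rv 2" and "q = rv 3"
  have pq: "p = 2 * N - 1" "q = 2 * N - 2" "rv p = 2" "rv q = 3" "rv 2 = p" "rv 3 = q"
    "p \<in> R" "q \<in> R" "2 \<in> R" "3 \<in> R"
    using N4 by (auto simp: p_def q_def rv_def)
  have linE: "lin i c (E k)" if "k \<in> {2, 3, p, q}" for k
  proof -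
    have "E k N = 0" "E k (N + 1) = 0" "E k 1 = 0" "E k (2 * N) = 0"
      using that N4 unfolding pq(1,2) by (auto simp: E_def)
    then show ?thesis using i by (auto simp: lin_def)
  qed
  note E = B2_E[OF pq(7)] B2_E[OF pq(8)] B2_E[OF pq(9)] B2_E[OF pq(10)]
  have ne: "(p::nat) \<noteq> 2" "p \<noteq> 3" "q \<noteq> 2" "q \<noteq> 3" "p \<noteq> q" using pq N4 by auto
  have w0: "w0 2 \<noteq> 0" "w0 3 \<noteq> 0" using goodD(1)[OF g] N4 by auto
  \<comment> \<open>\<open>E p\<close> is isotropic, and its pairing with \<open>w0\<close> is a
    nonzero multiple of \<open>w0 2\<close>; hence its pairing with \<open>w1\<close> must vanish.
    The vector \<open>E q\<close> serves in the same way below.\<close>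
  have 1: "w1 2 = 0"
    using *[OF linE, of p] w0 ne unfolding E pq(3-6) by (auto simp: E_def)
  have 2: "w1 3 = 0"
    using *[OF linE, of q] w0 ne unfolding E pq(3-6) by (auto simp: E_def)
  have s: "sg p = sg 2" "sg q = sg 3" using pq sg_rv[of 2] sg_rv[of 3] by auto
  have 3: "w1 q = 0"
  proof -
    define X Y W where "X = sg p * w0 2" and "Y = sg 3 * w0 q" and "W = sg 3 * w1 q"
    have EE: "E p 2 = 0" "E p q = 0" "E 3 2 = 0" "E 3 q = 0" using ne by (auto simp: E_def)
    have "2 * (1 * X + a * Y) * (1 * (sg p * w1 2) + a * W) = 0" for a
      using *[OF lin_combine[OF linE linE, of p 3 1 a]] EE
      unfolding B2_combine_left B2_combine_right E pq(3-6) X_def Y_def W_def by simp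
    from this[of 1] this[of "-1"] have z: "(2 * X + 2 * Y) * W = 0" "(X - Y) * W = 0" using 1 by simp_all
    have "4 * (X * W) = (2 * X + 2 * Y) * W + 2 * ((X - Y) * W)" by (simp add: algebra_simps)
    then have "X * W = 0" unfolding z by simp
    then show ?thesis using w0 by (simp add: X_def W_def)
  qed
  \<comment> \<open>On \<open>E 3 + E q\<close> the form takes the value \<open>2 * sg 3\<close>,
    while the pairing with \<open>w1\<close> only involves the two entries just shown to be
    zero.\<close>
  have "B2 w0 w1 * (2 * sg 3) = 0"
    using *[OF lin_combine[OF linE linE, of 3 q 1 1]] ne 2 3 s unfolding B2_combine_left B2_combine_right E pq(3-6)
    by (auto simp: E_def)
  then show False using b by simp
qed

text \<open>A conic through two isotropic vectors; the factor \<open>1\<close> makes the expression an instance of the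
  linear combinations in \<open>lin_combine\<close> and \<open>B2_combine_left\<close>.\<close>

lemma isotropic_curve:
  assumes N: "i = 2 \<or> i = 4 \<Longrightarrow> even N" and i: "i \<in> {1,2,3,4}" and c: "c \<noteq> 0"
    and w0: "lin i c w0" "iso w0" "good w0" and w1: "lin i c w1" "iso w1"
  obtains b e where "b \<noteq> 0"
    "\<forall>t. lin i c (\<lambda>j. (1 - t)\<^sup>2 * w0 j + 1 * (t * (1 - t) * e j + t\<^sup>2 * b * w1 j))"
    "\<forall>t. iso (\<lambda>j. (1 - t)\<^sup>2 * w0 j + 1 * (t * (1 - t) * e j + t\<^sup>2 * b * w1 j))"
proof (cases "i = 2 \<or> i = 4")
  case True
  have l: "lin i c (\<lambda>j. (1 - t)\<^sup>2 * w0 j + 1 * (t * (1 - t) * 0 + t\<^sup>2 * 1 * w1 j))" for t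
    using lin_combine[OF w0(1) w1(1), of "(1 - t)\<^sup>2" "t\<^sup>2"] by simp
  show thesis
    by (rule that[of 1 "\<lambda>_. 0"]) (use l lin_iso[OF N True c l] True in auto)
next
  case False
  then have i': "i = 1 \<or> i = 3" using i by auto
  have iso0: "B2 w0 w0 = 0" "B2 w1 w1 = 0" using w0(2) w1(2) by (auto simp: iso_B2)
  have Q: "B2 (\<lambda>j. (1 - t)\<^sup>2 * w0 j + 1 * (t * (1 - t) * e j + t\<^sup>2 * b * w1 j)) (\<lambda>j. (1 - t)\<^sup>2 * w0 j + 1 * (t * (1 - t) * e j + t\<^sup>2 * b * w1 j))
      = t\<^sup>2 * (1 - t)\<^sup>2 * (B2 e e + 2 * b * B2 w0 w1)" if "B2 e w0 = 0" "B2 e w1 = 0" for t e b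
    unfolding B2_combine_left B2_combine_right
    using that iso0 B2_sym[of w1 w0] B2_sym[of w0 e] B2_sym[of w1 e] by (simp add: algebra_simps power2_eq_square)
  have L: "lin i c (\<lambda>j. (1 - t)\<^sup>2 * w0 j + 1 * (t * (1 - t) * e j + t\<^sup>2 * b * w1 j))" if "lin i c e" for t e b
    by (intro lin_combine w0(1) w1(1) that)
  show thesis
  proof (cases "B2 w0 w1 = 0")
    case True
    have "lin i c (\<lambda>_. 0)" using lin_scale[OF w0(1), of 0] by simp
    moreover have "B2 (\<lambda>_. 0) y = 0" for y by (simp add: B2_def)
    ultimately show thesis
      using Q[of "\<lambda>_. 0" _ 1] L[of "\<lambda>_. 0" _ 1] True by (intro that[of 1 "\<lambda>_. 0"]) (auto simp: iso_B2)
  next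
    case False
    define b0 where "b0 = B2 w0 w1"
    obtain x where x: "lin i c x" "b0 * B2 x x - 2 * B2 x w0 * B2 x w1 \<noteq> 0"
      using exists_nondegenerate[OF i' w0(3) False] b0_def by blast
    \<comment> \<open>Up to the factor \<open>b0\<close> this is the projection of \<open>x\<close>
      to the orthogonal complement of the plane spanned by \<open>w0\<close> and \<open>w1\<close>.
      The choice of \<open>x\<close> ensures that \<open>e\<close> itself is not isotropic.\<close>
    define e where "e = (\<lambda>j. b0 * x j + 1 * (- B2 x w1 * w0 j + - B2 x w0 * w1 j))"
    have e: "B2 e w0 = 0" "B2 e w1 = 0" "B2 e e = b0 * (b0 * B2 x x - 2 * B2 x w0 * B2 x w1)"
      unfolding e_def B2_combine_left B2_combine_right
      using iso0 B2_sym[of w1 w0] B2_sym[of w0 x] B2_sym[of w1 x] by (simp_all add: b0_def algebra_simps)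
    have "b0 \<noteq> 0" using False b0_def by simp
    then have ee: "B2 e e \<noteq> 0" unfolding e(3) using x(2) by simp
    have le: "lin i c e" unfolding e_def by (intro lin_combine x(1) w0(1) w1(1))
    show thesis
    \<comment> \<open>By \<open>Q\<close> the form along the curve is
      \<open>t\<^sup>2 * (1 - t)\<^sup>2\<close> times a constant, and this value of
      \<open>b\<close> makes the constant zero.\<close>
    proof (intro that[of "- B2 e e / (2 * b0)" e] allI)
      show "- B2 e e / (2 * b0) \<noteq> 0" using ee \<open>b0 \<noteq> 0\<close> by simp
      show "iso (\<lambda>j. (1 - t)\<^sup>2 * w0 j + 1 * (t * (1 - t) * e j + t\<^sup>2 * (- B2 e e / (2 * b0)) * w1 j))" for t
        unfolding iso_B2 Q[OF e(1,2)] using \<open>b0 \<noteq> 0\<close> by (simp add: b0_def[symmetric])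
    qed (rule L[OF le])
  qed
qed

lemma Xset_dual:
  assumes N: "i = 2 \<or> i = 4 \<Longrightarrow> even N" and i: "i \<in> {1,2,3,4}" and l: "l \<in> Xset i L"
  shows "dual l \<in> Xset i L"
  using l lin_dual[OF N i] dual_BD by (auto simp: Xset_def)

section \<open>Generic points close to a given point\<close>

definition good_poly :: "(nat \<Rightarrow> complex) \<Rightarrow> complex" where
  "good_poly w = (\<Prod>j\<in>{1..N+1}. w j) * w (2 * N) * (\<Prod>k\<in>{2..<N}. G w k)"

lemma good_poly_iff: "good_poly w \<noteq> 0 \<longleftrightarrow> good w"
  unfolding good_poly_def good_def mult_eq_0_iff prod_zero_iff[OF finite_atLeastAtMost] prod_zero_iff[OF finite_atLeastLessThan]
  by blast

lemma polyf_good_poly: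
  assumes "\<And>j. polyf (\<lambda>t. w t j)" shows "polyf (\<lambda>t. good_poly (w t))"
  unfolding good_poly_def G_def by (intro polyf_mult polyf_prod polyf_sum polyf_const assms)

lemma ptv_tendsto:
  assumes w: "\<And>j. ((\<lambda>t. w t j) \<longlongrightarrow> w0 j) A" and g: "good w0"
  shows "((\<lambda>t. ptv L (w t) k) \<longlongrightarrow> ptv L w0 k) A"
proof (cases "k \<in> {1..2*N-1}")
  case False
  show ?thesis unfolding ptv_def mk_pt_def restrict_apply if_not_P[OF False] by simp
next
  case True
  have G: "((\<lambda>t. G (w t) k) \<longlongrightarrow> G w0 k) A" for k
    unfolding G_def by (intro tendsto_intros w)
  note nz = goodD[OF g]
  show ?thesis
  proof (cases "k \<le> N")
    case le: True
    have "((\<lambda>t. w t k / w t (k + 1)) \<longlongrightarrow> w0 k / w0 (k + 1)) A"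
      using nz(1)[of "k + 1"] le by (intro tendsto_intros w) auto
    then show ?thesis using True le by (simp add: ptv_def mk_pt_def)
  next
    case gt: False
    define q where "q = 2 * N - k"
    have q: "1 \<le> q" "q < N" using True gt by (auto simp: q_def)
    have "((\<lambda>t. if q = 1 then L * w t (2 * N) / w t 2 else - (G (w t) q * w t q) / (w t (q + 1) * G (w t) (q - 1)))
       \<longlongrightarrow> (if q = 1 then L * w0 (2 * N) / w0 2 else - (G w0 q * w0 q) / (w0 (q + 1) * G w0 (q - 1)))) A"
    proof (cases "q = 1")
      case True
      then show ?thesis using nz(1)[of 2] N4 by (auto intro!: tendsto_intros w)
    next
      case False
      then have "w0 (q + 1) * G w0 (q - 1) \<noteq> 0" using nz(1)[of "q + 1"] nz(3)[of "q - 1"] q by simp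
      then show ?thesis using False by (auto intro!: tendsto_intros w G)
    qed
    then show ?thesis using True gt unfolding ptv_def mk_pt_def q_def by simp
  qed
qed

text \<open>Only \<open>l\<close> is moved, and only one of the two conditions of \<open>gen\<close>
  is reached; moving \<open>m\<close> through its reflection yields the other. Since
  \<open>v l\<close> is good, \<open>ptv\<close> turns the curve of isotropic vectors near
  \<open>t = 0\<close> into a curve of points that tends to \<open>l\<close>.\<close>

lemma generic_approximation:
  assumes N: "i = 2 \<or> i = 4 \<Longrightarrow> even N" and i: "i \<in> {1,2,3,4}" and LK: "L \<noteq> K"
    and l: "l \<in> Xset i L" and m: "m \<in> Xset i K"
  obtains lt where "\<And>k. ((\<lambda>t. lt t k) \<longlongrightarrow> l k) (at 0)"
    "\<forall>\<^sub>F t in at (0::complex). lt t \<in> Xset i L \<and> good (vm K m (1 / L) (v (lt t)))"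
proof -
  obtain c d where lB: "l \<in> BD N L" and mB: "m \<in> BD N K" and c: "c\<^sup>2 = L" "lin i c (v l)" and d: "d\<^sup>2 = K" "lin i d (v m)"
    using l m by (auto simp: Xset_def)
  note L0 = L0[OF lB]
  have c0: "c \<noteq> 0" using c L0 by auto
  \<comment> \<open>\<open>M\<^sub>K(m, 1/L)\<close> maps \<open>w1\<close> to a nonzero multiple of \<open>v l\<close>, so the curve has a good image at \<open>t = 1\<close>.\<close>
  define w1 where "w1 = (\<lambda>j. sg j * vm K (dual m) (1 / L) (\<lambda>i. sg i * v l i) j)"
  have w1: "lin i c w1"
  proof -
    \<comment> \<open>The first sign twist leads to the space of \<open>- c\<close>, which also
      squares to \<open>L\<close>, so \<open>lin_vm\<close> applies there. The second twist leads
      back to \<open>c\<close>.\<close>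
    have "lin i (- c) (vm K (dual m) (1 / L) (\<lambda>i. sg i * v l i))"
      by (rule lin_vm[OF N i dual_BD[OF mB] d(1) lin_dual[OF N i mB d] _ L0 lin_twist[OF N i c(2)]]) (simp_all add: c(1))
    from lin_twist[OF N i this] show ?thesis by (simp add: w1_def)
  qed
  have iw1: "iso w1" unfolding w1_def by (intro iso_twist iso_vm[OF dual_BD[OF mB]] iso_v[OF lB])
  have vw1: "vm K m (1 / L) w1 j = poly (qd K) (1 / L) * v l j" if "j \<in> R" for j
    unfolding w1_def by (rule vm_inverse[OF mB that])
  have q0: "poly (qd K) (1 / L) \<noteq> 0" using LK L0 by (simp add: qd_def)
  obtain b e where b: "b \<noteq> 0"
    and lin: "\<forall>t. lin i c (\<lambda>j. (1 - t)\<^sup>2 * v l j + 1 * (t * (1 - t) * e j + t\<^sup>2 * b * w1 j))"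
    and iso: "\<forall>t. iso (\<lambda>j. (1 - t)\<^sup>2 * v l j + 1 * (t * (1 - t) * e j + t\<^sup>2 * b * w1 j))"
    by (rule isotropic_curve[OF N i c0 c(2) iso_v[OF lB] good_v[OF lB] w1 iw1], assumption)
  define V where "V t j = (1 - t)\<^sup>2 * v l j + 1 * (t * (1 - t) * e j + t\<^sup>2 * b * w1 j)" for t j
  have VE: "V t = (\<lambda>j. (1 - t)\<^sup>2 * v l j + 1 * (t * (1 - t) * e j + t\<^sup>2 * b * w1 j))" for t
    by (intro ext) (simp only: V_def)
  have VR: "lin i c (V t)" "iso (V t)" for t unfolding VE using lin iso by blast+
  have pV: "polyf (\<lambda>t. V t j)" for j
    unfolding V_def by (intro polyf_add polyf_mult polyf_power polyf_diff polyf_const polyf_id)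
  have V0: "V 0 = v l" by (auto simp: V_def)
  have "polyf (\<lambda>t. good_poly (vm K m (1 / L) (V t)))"
    by (rule polyf_good_poly) (unfold vm_def, intro polyf_sum polyf_mult polyf_const pV)
  moreover have "good_poly (vm K m (1 / L) (V 1)) \<noteq> 0"
  proof -
    have "vm K m (1 / L) (V 1) j = (b * poly (qd K) (1 / L)) * v l j" if "j \<in> R" for j
      using vw1[OF that] by (simp add: V_def vm_def sum_distrib_left[symmetric] mult.assoc)
    then show ?thesis
      unfolding good_poly_iff using good_cong[of "vm K m (1 / L) (V 1)" "\<lambda>j. (b * poly (qd K) (1 / L)) * v l j"]
        good_scale[of "b * poly (qd K) (1 / L)" "v l"] good_v[OF lB] b q0 by auto
  qed
  ultimately have ev1: "\<forall>\<^sub>F t in at 0. good_poly (vm K m (1 / L) (V t)) \<noteq> 0" by (rule polyf_eventually_nonzero)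
  have ev2: "\<forall>\<^sub>F t in at 0. good_poly (V t) \<noteq> 0"
    by (rule polyf_eventually_nonzero[OF polyf_good_poly[OF pV], of 0]) (simp add: good_poly_iff V0 good_v[OF lB])
  show thesis
  proof
    show "((\<lambda>t. ptv L (V t) k) \<longlongrightarrow> l k) (at 0)" for k
      using ptv_tendsto[of V "V 0" "at 0" L k] polyf_tendsto[OF pV, of _ 0] V0 good_v[OF lB] ptv_v[OF lB] by simp
    show "\<forall>\<^sub>F t in at 0. ptv L (V t) \<in> Xset i L \<and> good (vm K m (1 / L) (v (ptv L (V t))))"
      using ev1 ev2
    proof eventually_elim
      case (elim t)
      then have g: "good (V t)" "good (vm K m (1 / L) (V t))" by (simp_all add: good_poly_iff)
      have z: "L / V t 1 \<noteq> 0" using goodD(1)[OF g(1), of 1] L0 by simp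
      note vv = v_ptv[OF g(1) VR(2)[of t] L0]
      have "lin i c (v (ptv L (V t)))"
        by (rule lin_cong[OF _ lin_scale[OF VR(1)[of t], of "L / V t 1"]]) (simp add: vv)
      moreover have "good (vm K m (1 / L) (v (ptv L (V t))))"
      proof -
        have "vm K m (1 / L) (v (ptv L (V t))) j = (L / V t 1) * vm K m (1 / L) (V t) j" for j
          unfolding vm_def sum_distrib_left by (intro sum.cong refl) (simp add: vv)
        then have "vm K m (1 / L) (v (ptv L (V t))) = (\<lambda>j. (L / V t 1) * vm K m (1 / L) (V t) j)" by auto
        then show ?thesis using good_scale[OF z, of "vm K m (1 / L) (V t)"] g(2) by metis
      qed
      ultimately show ?case using ptv_BD[OF g(1) VR(2) L0] c(1) by (auto simp: Xset_def)
    qed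
  qed
qed

end

section \<open>The restricted map\<close>

lemma polyfun_tendsto:
  assumes "f \<in> polyfun"
    and "\<And>k. ((\<lambda>t. fst (q t) k) \<longlongrightarrow> fst p k) A" "\<And>k. ((\<lambda>t. snd (q t) k) \<longlongrightarrow> snd p k) A"
  shows "((\<lambda>t. f (q t)) \<longlongrightarrow> f p) A"
  using assms(1) by induction (auto intro!: tendsto_intros assms(2,3))

lemma polyfun_eventually_nonzero:
  assumes "f \<in> polyfun" "f p \<noteq> 0"
    and "\<And>k. ((\<lambda>t. fst (q t) k) \<longlongrightarrow> fst p k) A" "\<And>k. ((\<lambda>t. snd (q t) k) \<longlongrightarrow> snd p k) A"
  shows "\<forall>\<^sub>F t in A. f (q t) \<noteq> 0"
  by (rule tendsto_imp_eventually_ne[OF polyfun_tendsto[OF assms(1,3,4)] assms(2)])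

text \<open>The tropical map is known only through local representatives; regularity of its
  restriction is glued together from theirs.\<close>

lemma regular_fun_localI:
  assumes "\<And>p. p \<in> W \<Longrightarrow> \<exists>U h. p \<in> U \<and> U \<subseteq> W \<and> regular_fun X U h \<and> (\<forall>q\<in>U. f q = h q)"
  shows "regular_fun X W f"
  unfolding regular_fun_def
proof
  fix p assume "p \<in> W"
  then have "\<exists>U h. p \<in> U \<and> U \<subseteq> W \<and> regular_fun X U h \<and> (\<forall>q\<in>U. f q = h q)" by (rule assms)
  then obtain U h where U: "p \<in> U" "U \<subseteq> W" "regular_fun X U h" "\<forall>q\<in>U. f q = h q" by (elim exE conjE)
  have "\<exists>V a b. zopen X V \<and> p \<in> V \<and> V \<subseteq> U \<and> a \<in> polyfun \<and> b \<in> polyfun \<and> (\<forall>q\<in>V. b q \<noteq> 0 \<and> h q = a q / b q)"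
    using U(3) unfolding regular_fun_def by (rule bspec) (rule U(1))
  then obtain V a b where V: "zopen X V" "p \<in> V" "V \<subseteq> U" "a \<in> polyfun" "b \<in> polyfun"
      "\<forall>q\<in>V. b q \<noteq> 0 \<and> h q = a q / b q"
    by (elim exE conjE)
  have f: "\<forall>q\<in>V. b q \<noteq> 0 \<and> f q = a q / b q"
  proof
    fix q assume q: "q \<in> V"
    show "b q \<noteq> 0 \<and> f q = a q / b q"
      unfolding bspec[OF U(4) subsetD[OF V(3) q]] by (rule bspec[OF V(6) q])
  qed
  show "\<exists>V a b. zopen X V \<and> p \<in> V \<and> V \<subseteq> W \<and> a \<in> polyfun \<and> b \<in> polyfun \<and> (\<forall>q\<in>V. b q \<noteq> 0 \<and> f q = a q / b q)"
    by (intro exI[of _ V] exI[of _ a] exI[of _ b] conjI V(1,2,4,5) order_trans[OF V(3) U(2)] f)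
qed

context D_rank begin

section \<open>Regularity of the explicit formulas\<close>

context
  fixes X W :: "(pt \<times> pt) set"
  assumes W: "zopen X W"
begin

lemma W_subset: "W \<subseteq> X" by (rule zopen_subset[OF W])

lemmas reg = regular_const[OF W] regular_add[OF W_subset] regular_mult[OF W_subset] regular_sum[OF W] regular_prod[OF W]
lemmas reg_div = regular_divide[OF W_subset]

lemma reg_diff: "regular_fun X W f \<Longrightarrow> regular_fun X W g \<Longrightarrow> regular_fun X W (\<lambda>p. f p - g p)"
  by (rule regular_diff[OF W_subset _ _ W])

lemma reg_uminus: "regular_fun X W f \<Longrightarrow> regular_fun X W (\<lambda>p. - f p)"
  using reg_diff[OF regular_const[OF W, of 0]] by simp

lemma reg_if:
  "(b \<Longrightarrow> regular_fun X W g) \<Longrightarrow> (\<not> b \<Longrightarrow> regular_fun X W h) \<Longrightarrow> regular_fun X W (\<lambda>p. if b then g p else h p)"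
  by (cases b) simp_all

context
  fixes f :: "pt \<times> pt \<Rightarrow> pt" and L :: complex
  assumes f: "\<And>k. regular_fun X W (\<lambda>p. f p k)" and fB: "\<And>p. p \<in> W \<Longrightarrow> f p \<in> BD N L"
begin

lemma reg_bar: "regular_fun X W (\<lambda>p. lb (f p) k)"
  unfolding bar_def by (rule f)

lemma reg_A: assumes "i \<in> R" "j \<in> R" shows "regular_fun X W (\<lambda>p. A_entry N (f p) i j)"
proof -
  have nz: "f p k \<noteq> 0" "lb (f p) k \<noteq> 0" if "p \<in> W" "1 \<le> k" "k < 2 * N" for p k
    using BD_nonzero[OF fB] BD_bar_nonzero[OF fB] that by auto
  have P: "regular_fun X W (\<lambda>p. \<Prod>k\<in>S. f p k)" "regular_fun X W (\<lambda>p. \<Prod>k\<in>S. lb (f p) k)" for S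
    by (intro reg f reg_bar)+
  have q: "regular_fun X W (\<lambda>p. f p k / lb (f p) k)" "regular_fun X W (\<lambda>p. lb (f p) k / f p k)" if "1 \<le> k" "k < N" for k
    by (intro reg_div f reg_bar nz; use that in simp)+
  have N: "f p N \<noteq> 0" if "p \<in> W" for p using nz(1)[OF that, of N] N4 by simp
  have 1: "regular_fun X W (\<lambda>p. 1 / f p N)" by (rule reg_div[OF regular_const[OF W] f N])
  show ?thesis
  proof (cases "j \<le> i")
    case False
    then have "A_entry N (f p) i j = 0" if "p \<in> W" for p using A_upper[OF fB[OF that], of i j] assms by simp
    then show ?thesis by (subst regular_fun_cong[of W _ "\<lambda>_. 0"]) (simp_all add: regular_const[OF W])
  next
    case True
    show ?thesis
      unfolding A_entry_def Let_def
      by (intro reg_if; (rule P f 1 regular_const[OF W] | rule regular_mult[OF W_subset] regular_add[OF W_subset]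
            | rule q, use assms in force, use assms in force)+)
  qed
qed

lemma reg_v: "j \<in> R \<Longrightarrow> regular_fun X W (\<lambda>p. v (f p) j)"
  unfolding v_def using N4 by (intro reg_A) auto

lemma reg_u: "j \<in> R \<Longrightarrow> regular_fun X W (\<lambda>p. u (f p) j)"
  unfolding u_def using N4 by (intro reg_A) auto

lemma reg_vm:
  assumes w: "\<And>k. k \<in> R \<Longrightarrow> regular_fun X W (\<lambda>p. w p k)" and j: "j \<in> R"
  shows "regular_fun X W (\<lambda>p. vm K (f p) z (w p) j)"
  unfolding vm_def poly_M using j by (intro reg reg_diff w reg_A reg_u reg_v)

lemma reg_dual: "regular_fun X W (\<lambda>p. dual (f p) k)"
proof (cases "k \<in> {1..2*N-1}")
  case True
  have nz: "f p N \<noteq> 0" if "p \<in> W" for p using BD_nonzero[OF fB[OF that], of N] N4 by simp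
  show ?thesis
    unfolding dual_def mk_pt_def restrict_apply if_P[OF True] fun_upd_apply
    by (intro reg_if reg reg_div f reg_bar nz)
next
  case False
  show ?thesis unfolding dual_def mk_pt_def restrict_apply if_not_P[OF False] by (rule regular_const[OF W])
qed

end

lemma reg_G:
  assumes w: "\<And>k. k \<in> R \<Longrightarrow> regular_fun X W (\<lambda>p. w p k)" and k: "k \<le> 2 * N"
  shows "regular_fun X W (\<lambda>p. G (w p) k)"
  unfolding G_def using k by (intro reg w) (auto simp: rv_def)

lemma reg_good_poly:
  assumes w: "\<And>k. k \<in> R \<Longrightarrow> regular_fun X W (\<lambda>p. w p k)"
  shows "regular_fun X W (\<lambda>p. good_poly (w p))"
  unfolding good_poly_def by (intro reg w reg_G) (use N4 in auto)

lemma reg_ptv: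
  assumes w: "\<And>k. k \<in> R \<Longrightarrow> regular_fun X W (\<lambda>p. w p k)" and g: "\<And>p. p \<in> W \<Longrightarrow> good (w p)"
  shows "regular_fun X W (\<lambda>p. ptv L (w p) k)"
proof (cases "k \<in> {1..2*N-1}")
  case True
  note nz = goodD[OF g]
  show ?thesis
  proof (cases "k \<le> N")
    case le: True
    then show ?thesis
      unfolding ptv_def mk_pt_def restrict_apply if_P[OF True] if_P[OF le]
      using True by (intro reg_div w nz(1)) auto
  next
    case gt: False
    define q where "q = 2 * N - k"
    have q: "1 \<le> q" "q < N" using True gt by (auto simp: q_def)
    have "regular_fun X W (\<lambda>p. if q = 1 then L * w p (2 * N) / w p 2 else - (G (w p) q * w p q) / (w p (q + 1) * G (w p) (q - 1)))"
    proof (cases "q = 1")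
      case True
      have "regular_fun X W (\<lambda>p. L * w p (2 * N) / w p 2)"
        using N4 by (intro reg_div reg w nz(1)) auto
      then show ?thesis using True by simp
    next
      case False
      have "w p (q + 1) * G (w p) (q - 1) \<noteq> 0" if "p \<in> W" for p
        using nz(1)[OF that, of "q + 1"] nz(3)[OF that, of "q - 1"] q False by simp
      then have "regular_fun X W (\<lambda>p. - (G (w p) q * w p q) / (w p (q + 1) * G (w p) (q - 1)))"
        using q by (intro reg_div reg_uminus reg w reg_G) auto
      then show ?thesis using False by simp
    qed
    then show ?thesis
      unfolding ptv_def mk_pt_def restrict_apply if_P[OF True] if_not_P[OF gt] q_def .
  qed
next
  case False
  show ?thesis unfolding ptv_def mk_pt_def restrict_apply if_not_P[OF False] by (rule regular_const[OF W])
qed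

end

abbreviation BB :: "complex \<Rightarrow> complex \<Rightarrow> (pt \<times> pt) set" where "BB L K \<equiv> BD N L \<times> BD N K"

lemma reg_coords:
  "regular_fun (BB L K) (BB L K) (\<lambda>p. fst p k)" "regular_fun (BB L K) (BB L K) (\<lambda>p. snd p k)"
  by (auto intro!: regular_polyfun polyfun.intros)

lemma zopen_gen:
  "zopen (BB L K) {p \<in> BB L K. good (vm K (snd p) (1 / L) (v (fst p)))}" "zopen (BB L K) (gen L K)"
proof -
  let ?a = "\<lambda>p. good_poly (vm K (snd p) (1 / L) (v (fst p)))"
  let ?b = "\<lambda>p. good_poly (vm L (dual (fst p)) (1 / K) (v (dual (snd p))))"
  have B: "\<And>p. p \<in> BB L K \<Longrightarrow> fst p \<in> BD N L" "\<And>p. p \<in> BB L K \<Longrightarrow> snd p \<in> BD N K" by auto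
  note r = zopen_self[of "BB L K"]
  have ra: "regular_fun (BB L K) (BB L K) ?a"
    by (intro reg_good_poly[OF r] reg_vm[OF r reg_coords(2) B(2)] reg_v[OF r reg_coords(1) B(1)])
  have rb: "regular_fun (BB L K) (BB L K) ?b"
    by (intro reg_good_poly[OF r] reg_vm[OF r reg_dual[OF r reg_coords(1) B(1)] dual_BD[OF B(1)]]
        reg_v[OF r reg_dual[OF r reg_coords(2) B(2)] dual_BD[OF B(2)]])
  show 1: "zopen (BB L K) {p \<in> BB L K. good (vm K (snd p) (1 / L) (v (fst p)))}"
    using zopen_regular_nonzero[OF ra] by (simp add: good_poly_iff)
  have "gen L K = {p \<in> BB L K. ?a p \<noteq> 0} \<inter> {p \<in> BB L K. ?b p \<noteq> 0}"
    by (auto simp: gen_def good_poly_iff)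
  then show "zopen (BB L K) (gen L K)"
    using zopen_Int[OF zopen_regular_nonzero[OF ra] zopen_regular_nonzero[OF rb]] by simp
qed

lemma F_regular: "regular_map (BB L K) (gen L K) (F L K)"
proof -
  note W = zopen_gen(2)[of L K]
  have c: "regular_fun (BB L K) (gen L K) (\<lambda>p. fst p k)" "regular_fun (BB L K) (gen L K) (\<lambda>p. snd p k)" for k
    by (auto intro!: regular_polyfun polyfun.intros W)
  have B: "\<And>p. p \<in> gen L K \<Longrightarrow> fst p \<in> BD N L" "\<And>p. p \<in> gen L K \<Longrightarrow> snd p \<in> BD N K" by (auto simp: gen_def)
  have g: "\<And>p. p \<in> gen L K \<Longrightarrow> good (vm K (snd p) (1 / L) (v (fst p)))"
    "\<And>p. p \<in> gen L K \<Longrightarrow> good (vm L (dual (fst p)) (1 / K) (v (dual (snd p))))" by (auto simp: gen_def)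
  have P: "\<And>p. p \<in> gen L K \<Longrightarrow> ptv K (vm L (dual (fst p)) (1 / K) (v (dual (snd p)))) \<in> BD N K"
    using ptv_BD[OF g(2) iso_vm[OF dual_BD[OF B(1)] iso_v[OF dual_BD[OF B(2)]]] L0[OF B(2)]] by blast
  have 1: "regular_fun (BB L K) (gen L K) (\<lambda>p. ptv K (vm L (dual (fst p)) (1 / K) (v (dual (snd p)))) k)" for k
    by (intro reg_ptv[OF W _ g(2)] reg_vm[OF W reg_dual[OF W c(1) B(1)] dual_BD[OF B(1)]]
        reg_v[OF W reg_dual[OF W c(2) B(2)] dual_BD[OF B(2)]])
  have 2: "regular_fun (BB L K) (gen L K) (\<lambda>p. ptv L (vm K (snd p) (1 / L) (v (fst p))) k)" for k
    by (intro reg_ptv[OF W _ g(1)] reg_vm[OF W c(2) B(2)] reg_v[OF W c(1) B(1)])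
  show ?thesis
    unfolding regular_map_def F_def using 2 reg_dual[OF W 1 P] by simp
qed

lemma tropical_R_gen:
  assumes "L \<noteq> K" "p \<in> gen L K" shows "tropical_R N L K p = Some (F L K p)"
proof -
  have "F L K ` gen L K \<subseteq> BB K L" by (rule image_subsetI) (rule F_BD)
  then show ?thesis
    unfolding tropical_R_def
    by (rule rational_closure_on[OF zopen_gen(2) F_regular _ zopen_gen(2) zdense_self solution_map_gen assms(2)])
      (use assms(1) in simp_all)
qed

section \<open>Equal parameters\<close>

lemma vm_same_parameter: "l \<in> BD N L \<Longrightarrow> m \<in> BD N L \<Longrightarrow> j \<in> R \<Longrightarrow>
    vm L m (1 / L) (v l) j = (\<Sum>k\<in>R. v l k * u m k) / L * v m j"
  unfolding vm_def sum_divide_distrib sum_distrib_right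
  by (intro sum.cong) (simp_all add: poly_M_special[OF L0])

text \<open>At \<open>1/L\<close> the matrix of \<open>m\<close> has rank one, so the image of
  \<open>v l\<close> is a multiple of the good vector \<open>v m\<close>. Both conditions of
  \<open>gen\<close> ask for the same scalar to be nonzero, as reflection only reorders the
  sum.\<close>

lemma gen_diagonal_iff:
  assumes l: "l \<in> BD N L" and m: "m \<in> BD N L"
  shows "(l, m) \<in> gen L L \<longleftrightarrow> (\<Sum>k\<in>R. v l k * u m k) \<noteq> 0"
proof -
  have *: "good (vm L m (1 / L) (v l)) \<longleftrightarrow> (\<Sum>k\<in>R. v l k * u m k) \<noteq> 0" if l: "l \<in> BD N L" and m: "m \<in> BD N L" for l m
  proof -
    have "good (vm L m (1 / L) (v l)) \<longleftrightarrow> good (\<lambda>j. (\<Sum>k\<in>R. v l k * u m k) / L * v m j)"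
      by (rule good_cong) (rule vm_same_parameter[OF l m])
    also have "\<dots> \<longleftrightarrow> (\<Sum>k\<in>R. v l k * u m k) \<noteq> 0"
    proof (cases "(\<Sum>k\<in>R. v l k * u m k) = 0")
      case True
      show ?thesis unfolding True using goodD(2)[of "\<lambda>_. 0"] by auto
    next
      case False
      then show ?thesis using good_scale[of "(\<Sum>k\<in>R. v l k * u m k) / L" "v m"] good_v[OF m] L0[OF l] by simp
    qed
    finally show ?thesis .
  qed
  have "(\<Sum>k\<in>R. v (dual m) k * u (dual l) k) = (\<Sum>k\<in>R. v l (rv k) * u m (rv k))"
    using v_dual[OF m] u_dual[OF l] by (intro sum.cong) auto
  also have "\<dots> = (\<Sum>k\<in>R. v l k * u m k)" by (rule sum_rv)
  finally show ?thesis using *[OF l m] *[OF dual_BD[OF m] dual_BD[OF l]] l m by (simp add: gen_def)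
qed

text \<open>The point \<open>l\<close> is moved along \<open>rescale s l\<close>, starting from
  \<open>s = 1\<close>. Up to \<open>s\<^sup>2\<close> the decisive scalar becomes a polynomial
  \<open>h\<close> in \<open>s\<close> whose constant term is a product of two nonzero last
  entries.\<close>

lemma gen_diagonal_dense: "zdense (BB L L) (gen L L)"
  unfolding zdense_iff
proof (intro conjI ballI impI)
  show "gen L L \<subseteq> BB L L" by (auto simp: gen_def)
  fix p g assume p: "p \<in> BB L L" and g: "g \<in> polyfun" "g p \<noteq> 0"
  obtain l m where lm: "p = (l, m)" by fastforce
  have l: "l \<in> BD N L" and m: "m \<in> BD N L" using p lm by auto
  define h where "h s = L * u m 1 * s\<^sup>2 + (\<Sum>k=2..2*N-1. v l k * u m k) * s + v l (2 * N) * u m (2 * N)" for s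
  have hS: "s\<^sup>2 * (\<Sum>k\<in>R. v (rescale s l) k * u m k) = h s" if s: "s \<noteq> 0" for s
  proof -
    have R: "R = insert 1 (insert (2 * N) {2..2*N-1})" using N4 by auto
    have "(\<Sum>k=2..2*N-1. v (rescale s l) k * u m k) = (\<Sum>k=2..2*N-1. v l k * u m k) / s"
      unfolding sum_divide_distrib using v_rescale(3)[OF l s] by (intro sum.cong) auto
    then have "(\<Sum>k\<in>R. v (rescale s l) k * u m k) = L * u m 1 + (v l (2 * N) / s\<^sup>2 * u m (2 * N) + (\<Sum>k=2..2*N-1. v l k * u m k) / s)"
      unfolding R using N4 v_rescale(1,2)[OF l s] by (subst sum.insert, simp, simp)+ simp
    then show ?thesis using s by (simp add: h_def field_simps power2_eq_square)
  qed
  have "polyf h" unfolding h_def by (intro polyf_add polyf_mult polyf_const polyf_power polyf_id)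
  moreover have "h 0 \<noteq> 0" using goodD(2)[OF good_v[OF l]] u_last[OF m] L0[OF m] by (simp add: h_def)
  ultimately have 1: "\<forall>\<^sub>F s in at 1. h s \<noteq> 0" by (rule polyf_eventually_nonzero)
  have 2: "\<forall>\<^sub>F s in at 1. s \<noteq> (0::complex)"
    by (rule tendsto_imp_eventually_ne[OF tendsto_ident_at]) simp
  have l1: "rescale 1 l = l"
    unfolding rescale_def mk_pt_eq_iff[OF l] by auto
  have "((\<lambda>s. rescale s l k) \<longlongrightarrow> rescale 1 l k) (at 1)" for k
    unfolding rescale_def mk_pt_def restrict_apply fun_upd_apply
    by (cases "k \<in> {1..2*N-1}"; cases "k \<le> N"; cases "k = 1"; cases "2 * N - k = 1") (auto intro!: tendsto_eq_intros)
  then have "\<forall>\<^sub>F s in at 1. g (rescale s l, m) \<noteq> 0"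
    by (intro polyfun_eventually_nonzero[OF g]) (simp_all add: lm l1)
  with 1 2 have "\<forall>\<^sub>F s in at 1. (rescale s l, m) \<in> gen L L \<and> g (rescale s l, m) \<noteq> 0"
  proof eventually_elim
    case (elim s)
    then have "(\<Sum>k\<in>R. v (rescale s l) k * u m k) \<noteq> 0" using hS[of s] by auto
    then show ?case using gen_diagonal_iff[OF rescale_BD[OF l] m] elim by simp
  qed
  then obtain s where "(rescale s l, m) \<in> gen L L \<and> g (rescale s l, m) \<noteq> 0"
    using eventually_happens'[of "at (1::complex)"] by auto
  then show "\<exists>q\<in>gen L L. g q \<noteq> 0" by blast
qed

text \<open>The identity is regular everywhere and agrees with the unique solution on a dense set.
  The extension is therefore the identity even at points where the matrix equation has several
  solutions.\<close>

lemma tropical_R_diagonal: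
  assumes "p \<in> BB L L" shows "tropical_R N L L p = Some p"
  unfolding tropical_R_def
  by (rule rational_closure_on[where F = "\<lambda>p. p", OF zopen_self _ _ zopen_gen(2) gen_diagonal_dense solution_map_diagonal assms])
    (auto simp: regular_map_def intro!: reg_coords)

section \<open>Density and invariance on the fixed-point varieties\<close>

lemma Xset_BD: "Xset i L \<subseteq> BD N L"
  by (auto simp: Xset_def)

text \<open>The two conditions of \<open>gen\<close> are reached one after the other: first
  \<open>l\<close> is moved with \<open>m\<close> fixed, then the reflection of \<open>m\<close> is
  moved with the new \<open>l1\<close> fixed.\<close>

lemma gen_dense_Xset:
  assumes N: "i = 2 \<or> i = 4 \<Longrightarrow> even N" and i: "i \<in> {1,2,3,4}" and LK: "L \<noteq> K"
  shows "zdense (Xset i L \<times> Xset i K) (gen L K \<inter> (Xset i L \<times> Xset i K))"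
  unfolding zdense_iff
proof (intro conjI ballI impI)
  fix p g assume p: "p \<in> Xset i L \<times> Xset i K" and g: "g \<in> polyfun" "g p \<noteq> 0"
  obtain l m where lm: "p = (l, m)" by fastforce
  have l: "l \<in> Xset i L" and m: "m \<in> Xset i K" using p lm by auto
  have mB: "m \<in> BD N K" using m Xset_BD by blast
  obtain lt where lt: "\<And>k. ((\<lambda>t. lt t k) \<longlongrightarrow> l k) (at 0)"
      "\<forall>\<^sub>F t in at (0::complex). lt t \<in> Xset i L \<and> good (vm K m (1 / L) (v (lt t)))"
    by (rule generic_approximation[OF N i LK l m], assumption) (rule that)
  have "\<forall>\<^sub>F t in at 0. g (lt t, m) \<noteq> 0"
    by (rule polyfun_eventually_nonzero[OF g]) (simp_all add: lm lt(1))
  with lt(2) have "\<forall>\<^sub>F t in at 0. (lt t \<in> Xset i L \<and> good (vm K m (1 / L) (v (lt t)))) \<and> g (lt t, m) \<noteq> 0"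
    by (rule eventually_conj)
  then obtain t where t: "lt t \<in> Xset i L" "good (vm K m (1 / L) (v (lt t)))" "g (lt t, m) \<noteq> 0"
    using eventually_happens'[of "at (0::complex)"] by auto
  define l1 where "l1 = lt t"
  have l1: "l1 \<in> Xset i L" "l1 \<in> BD N L" using t Xset_BD by (auto simp: l1_def)
  have "(l1, m) \<in> {p \<in> BB L K. good (vm K (snd p) (1 / L) (v (fst p)))}" using t l1 mB by (simp add: l1_def)
  \<comment> \<open>The first condition is open; keeping \<open>k\<close> nonzero along with
    \<open>g\<close> preserves it during the second move.\<close>
  then obtain k where k: "k \<in> polyfun" "k (l1, m) \<noteq> 0"
      "\<forall>q\<in>BB L K. k q \<noteq> 0 \<longrightarrow> q \<in> {p \<in> BB L K. good (vm K (snd p) (1 / L) (v (fst p)))}"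
    by (rule zopenE[OF zopen_gen(1)])
  obtain mt where mt: "\<And>k. ((\<lambda>t. mt t k) \<longlongrightarrow> dual m k) (at 0)"
      "\<forall>\<^sub>F t in at (0::complex). mt t \<in> Xset i K \<and> good (vm L (dual l1) (1 / K) (v (mt t)))"
    by (rule generic_approximation[OF N i LK[symmetric] Xset_dual[OF N i m] Xset_dual[OF N i l1(1)]], assumption, assumption, assumption) (rule that)
  have "((\<lambda>t. dual (mt t) j) \<longlongrightarrow> dual (dual m) j) (at 0)" for j
  proof (cases "j \<in> {1..2*N-1}")
    case True
    have nz: "dual m N \<noteq> 0" using BD_nonzero[OF dual_BD[OF mB], of N] N4 by simp
    show ?thesis
      unfolding dual_def[of "dual m"] dual_def[of "mt _"] mk_pt_def restrict_apply if_P[OF True] fun_upd_apply bar_def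
      by (cases "j \<le> N"; cases "j = N"; cases "j = N - 1"; cases "2 * N - j = N - 1")
        (use N4 in \<open>auto intro!: tendsto_intros mt(1) nz\<close>)
  next
    case False
    show ?thesis unfolding dual_def[of "dual m"] dual_def[of "mt _"] mk_pt_def restrict_apply if_not_P[OF False] by simp
  qed
  then have lim: "((\<lambda>t. dual (mt t) j) \<longlongrightarrow> m j) (at 0)" for j by (simp add: dual_dual[OF mB])
  have "(\<lambda>q. g q * k q) \<in> polyfun" by (intro polyfun.mult g k)
  moreover have "g (l1, m) * k (l1, m) \<noteq> 0" using t k by (simp add: l1_def)
  ultimately have "\<forall>\<^sub>F t in at 0. g (l1, dual (mt t)) * k (l1, dual (mt t)) \<noteq> 0"
    by (rule polyfun_eventually_nonzero[where f = "\<lambda>q. g q * k q"]) (simp_all add: lim)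
  with mt(2) have "\<forall>\<^sub>F t in at 0. (mt t \<in> Xset i K \<and> good (vm L (dual l1) (1 / K) (v (mt t))))
      \<and> g (l1, dual (mt t)) * k (l1, dual (mt t)) \<noteq> 0"
    by (rule eventually_conj)
  then obtain t where t: "mt t \<in> Xset i K" "good (vm L (dual l1) (1 / K) (v (mt t)))"
      "g (l1, dual (mt t)) * k (l1, dual (mt t)) \<noteq> 0"
    using eventually_happens'[of "at (0::complex)"] by auto
  have d: "dual (mt t) \<in> Xset i K" by (rule Xset_dual[OF N i t(1)])
  have dB: "dual (mt t) \<in> BD N K" "dual (dual (mt t)) = mt t"
    using subsetD[OF Xset_BD d] dual_dual[OF subsetD[OF Xset_BD t(1)]] by auto
  have "(l1, dual (mt t)) \<in> gen L K"
    using bspec[OF k(3), of "(l1, dual (mt t))"] t l1 dB by (simp add: gen_def)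
  then show "\<exists>q\<in>gen L K \<inter> (Xset i L \<times> Xset i K). g q \<noteq> 0"
    using l1 d t(3) by (intro bexI[of _ "(l1, dual (mt t))"]) auto
qed auto

lemma ptv_Xset:
  assumes w: "lin i c w" "iso w" "good w" and c: "c\<^sup>2 = L" and L: "L \<noteq> 0"
  shows "ptv L w \<in> Xset i L"
proof -
  have "lin i c (v (ptv L w))"
    by (rule lin_cong[OF _ lin_scale[OF w(1), of "L / w 1"]]) (simp add: v_ptv[OF w(3,2) L])
  then show ?thesis using ptv_BD[OF w(3,2) L] c by (auto simp: Xset_def)
qed

lemma F_Xset:
  assumes N: "i = 2 \<or> i = 4 \<Longrightarrow> even N" and i: "i \<in> {1,2,3,4}"
    and p: "p \<in> gen L K" "p \<in> Xset i L \<times> Xset i K"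
  shows "F L K p \<in> Xset i K \<times> Xset i L"
proof -
  have *: "ptv L (vm K m (1 / L) (v l)) \<in> Xset i L"
    if l: "l \<in> Xset i L" and m: "m \<in> Xset i K" and g: "good (vm K m (1 / L) (v l))" for l m L K
  proof -
    obtain c d where lB: "l \<in> BD N L" and mB: "m \<in> BD N K" and c: "c\<^sup>2 = L" "lin i c (v l)" and d: "d\<^sup>2 = K" "lin i d (v m)"
      using l m by (auto simp: Xset_def)
    show ?thesis
      by (rule ptv_Xset[OF lin_vm[OF N i mB d c(1) L0[OF lB] c(2)] iso_vm[OF mB iso_v[OF lB]] g c(1) L0[OF lB]])
  qed
  obtain l m where lm: "p = (l, m)" by fastforce
  have l: "l \<in> Xset i L" and m: "m \<in> Xset i K" and g: "good (vm K m (1 / L) (v l))" "good (vm L (dual l) (1 / K) (v (dual m)))"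
    using p by (auto simp: lm gen_def)
  show ?thesis
    using *[OF l m g(1)] Xset_dual[OF N i *[OF Xset_dual[OF N i m] Xset_dual[OF N i l] g(2)]]
    by (simp add: F_def lm)
qed

section \<open>Closedness, and the restricted map\<close>

lemma lin_witness:
  assumes "\<not> lin i c w0"
  shows "\<exists>a\<in>R. \<exists>b\<in>R. \<exists>\<kappa>. w0 a \<noteq> \<kappa> * w0 b \<and> (\<forall>w. lin i c w \<longrightarrow> w a = \<kappa> * w b)"
proof -
  have *: ?thesis if "a \<in> R" "b \<in> R" "w0 a \<noteq> \<kappa> * w0 b" "\<And>w. lin i c w \<Longrightarrow> w a = \<kappa> * w b" for a b \<kappa>
    using that by blast
  have R: "1 \<in> R" "N \<in> R" "N + 1 \<in> R" "2 * N \<in> R" "\<And>j. j \<in> {1..N} \<Longrightarrow> j \<in> R \<and> N + j \<in> R" using N4 by auto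
  consider "i = 1" | "i = 3" | "i = 2" | "i \<noteq> 1" "i \<noteq> 3" "i \<noteq> 2" by blast
  then show ?thesis
  proof cases
    case 1
    then show ?thesis using assms *[OF R(2,3), of 1] by (simp add: lin_def)
  next
    case 2
    then show ?thesis using assms *[OF R(2,3), of 1] *[OF R(1,4), of "c\<^sup>2"] by (auto simp: lin_def)
  next
    case 3
    then obtain j where j: "j \<in> {1..N}" "w0 j \<noteq> c * w0 (N + j)" using assms by (auto simp: lin_def)
    then show ?thesis using 3 R(5)[OF j(1)] *[of j "N + j" c] by (simp add: lin_def)
  next
    case 4
    then consider "w0 1 \<noteq> c * w0 N" | "w0 (N + 1) \<noteq> c * w0 (2 * N)" | j where "j \<in> {2..<N}" "w0 j \<noteq> c * w0 (N + j)"
      using assms by (auto simp: lin_def)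
    then show ?thesis
    proof cases
      case 1
      then show ?thesis using 4 *[OF R(1,2), of c] by (simp add: lin_def)
    next
      case 2
      then show ?thesis using 4 *[OF R(3,4), of c] by (simp add: lin_def)
    next
      case 3
      then have "j \<in> {1..N}" by auto
      then show ?thesis using 3 4 R(5) *[of j "N + j" c] by (simp add: lin_def)
    qed
  qed
qed

text \<open>For each of the two square roots of \<open>L\<close> one violated equation is chosen
  with \<open>lin_witness\<close>. The product \<open>h\<close> of the two defects is nonzero at
  \<open>p\<close> and vanishes wherever \<open>f\<close> takes values in
  \<open>Xset i L\<close>.\<close>

lemma Xset_closed:
  assumes W: "zopen X W" and f: "\<And>k. regular_fun X W (\<lambda>p. f p k)" "\<And>p. p \<in> W \<Longrightarrow> f p \<in> BD N L"
    and p: "p \<in> W" "f p \<notin> Xset i L"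
  obtains U where "zopen X U" "p \<in> U" "U \<subseteq> W" "\<And>q. q \<in> U \<Longrightarrow> f q \<notin> Xset i L"
proof -
  define c where "c = csqrt L"
  have c: "c\<^sup>2 = L" "(- c)\<^sup>2 = L" by (simp_all add: c_def)
  have "\<not> lin i c (v (f p))" "\<not> lin i (- c) (v (f p))" using p f(2)[OF p(1)] c unfolding Xset_def by blast+
  then obtain a b \<kappa> a' b' \<kappa>' where ab: "a \<in> R" "b \<in> R" "v (f p) a \<noteq> \<kappa> * v (f p) b" "\<forall>w. lin i c w \<longrightarrow> w a = \<kappa> * w b"
    and ab': "a' \<in> R" "b' \<in> R" "v (f p) a' \<noteq> \<kappa>' * v (f p) b'" "\<forall>w. lin i (- c) w \<longrightarrow> w a' = \<kappa>' * w b'"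
    using lin_witness[of i c "v (f p)"] lin_witness[of i "- c" "v (f p)"] by blast
  define h where "h q = (v (f q) a - \<kappa> * v (f q) b) * (v (f q) a' - \<kappa>' * v (f q) b')" for q
  have r: "regular_fun X W h"
    unfolding h_def by (intro reg[OF W] reg_diff[OF W] reg_v[OF W f] ab ab')
  have z: "h q = 0" if "f q \<in> Xset i L" for q
  proof -
    obtain e where e: "e\<^sup>2 = L" "lin i e (v (f q))" using \<open>f q \<in> Xset i L\<close> by (auto simp: Xset_def)
    then have "e = c \<or> e = - c" using c(1) power2_eq_iff by metis
    then show ?thesis using e(2) ab(4) ab'(4) by (auto simp: h_def)
  qed
  show thesis
  proof (rule that[of "{q \<in> W. h q \<noteq> 0}"])
    show "zopen X {q \<in> W. h q \<noteq> 0}" by (rule zopen_regular_nonzero[OF r zopen_subset[OF W]])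
    show "p \<in> {q \<in> W. h q \<noteq> 0}" using p(1) ab(3) ab'(3) by (simp add: h_def)
  qed (use z in auto)
qed

text \<open>If a value on the domain left the target, then by \<open>Xset_closed\<close> it would do
  so on a whole neighbourhood. This neighbourhood meets the dense set \<open>D0\<close>, where the
  values are known to be right.\<close>

lemma tropical_restrict_rational:
  assumes D: "zdense (Xset i L \<times> Xset i K) D0"
    and Y: "\<And>q. q \<in> D0 \<Longrightarrow> \<exists>y\<in>Xset i K \<times> Xset i L. tropical_R N L K q = Some y"
  shows "rational_map (Xset i L \<times> Xset i K) (Xset i K \<times> Xset i L) (tropical_R N L K |` (Xset i L \<times> Xset i K))"
proof -
  let ?X = "Xset i L \<times> Xset i K" and ?Y = "Xset i K \<times> Xset i L" and ?t = "tropical_R N L K"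
  have XB: "?X \<subseteq> BB L K" using Xset_BD by blast
  have DX: "D0 \<subseteq> ?X" by (rule zdense_subset[OF D])
  have loc: "\<exists>W F. zopen (BB L K) W \<and> p \<in> W \<and> regular_map (BB L K) W F \<and> F ` W \<subseteq> BB K L \<and> (\<forall>q\<in>W. ?t q = Some (F q))"
    if "p \<in> dom ?t" for p
  proof -
    obtain y where "?t p = Some y" using \<open>p \<in> dom ?t\<close> by blast
    then show ?thesis unfolding tropical_R_def by (rule rational_closure_cases) blast
  qed
  have dom: "dom (?t |` ?X) = dom ?t \<inter> ?X" by simp
  have "zopen (BB L K) (dom ?t)"
    unfolding zopen_iff
  proof (intro conjI ballI)
    show "dom ?t \<subseteq> BB L K" using loc zopen_subset by blast
    fix p assume "p \<in> dom ?t"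
    then obtain W F where W: "zopen (BB L K) W" "p \<in> W" "\<forall>q\<in>W. ?t q = Some (F q)" using loc by blast
    obtain g where "g \<in> polyfun" "g p \<noteq> 0" "\<forall>q\<in>BB L K. g q \<noteq> 0 \<longrightarrow> q \<in> W" by (rule zopenE[OF W(1,2)])
    then show "\<exists>g\<in>polyfun. g p \<noteq> 0 \<and> (\<forall>q\<in>BB L K. g q \<noteq> 0 \<longrightarrow> q \<in> dom ?t)" using W(3) by blast
  qed
  then have o: "zopen ?X (dom (?t |` ?X))" unfolding dom by (rule zopen_restrict[OF _ XB])
  have "D0 \<subseteq> dom (?t |` ?X)" unfolding dom using Y DX by blast
  then have d: "zdense ?X (dom (?t |` ?X))" using zdense_mono[OF D] dom by blast
  have r: "ran (?t |` ?X) \<subseteq> ?Y"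
  proof
    fix y assume "y \<in> ran (?t |` ?X)"
    then obtain p where "(?t |` ?X) p = Some y" unfolding ran_def by blast
    then have p: "p \<in> ?X" "?t p = Some y" by (auto simp: restrict_map_def split: if_splits)
    obtain W F where W: "zopen (BB L K) W" "p \<in> W" "regular_map (BB L K) W F" "F ` W \<subseteq> BB K L" "\<forall>q\<in>W. ?t q = Some (F q)"
      using loc[of p] p by blast
    have Fr: "regular_fun (BB L K) W (\<lambda>p. fst (F p) k)" "regular_fun (BB L K) W (\<lambda>p. snd (F p) k)" for k
      using W(3) by (auto simp: regular_map_def)
    have FB: "fst (F q) \<in> BD N K" "snd (F q) \<in> BD N L" if "q \<in> W" for q
      using W(4) that by (auto simp: image_subset_iff mem_Times_iff)
    have no: False if U: "zopen (BB L K) U" "p \<in> U" "U \<subseteq> W" "\<And>q. q \<in> U \<Longrightarrow> F q \<notin> ?Y" for U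
    proof -
      obtain g where g: "g \<in> polyfun" "g p \<noteq> 0" "\<forall>q\<in>BB L K. g q \<noteq> 0 \<longrightarrow> q \<in> U" by (rule zopenE[OF U(1,2)])
      obtain q where q: "q \<in> D0" "g q \<noteq> 0" by (rule zdenseE[OF D g(1) p(1) g(2)])
      then have qU: "q \<in> U" using g(3) DX XB by blast
      obtain y where y: "y \<in> ?Y" "?t q = Some y" using Y[OF q(1)] by (rule bexE)
      have "?t q = Some (F q)" using W(5) by (rule bspec) (rule subsetD[OF U(3) qU])
      then show False using U(4)[OF qU] y by simp
    qed
    have "fst (F p) \<in> Xset i K"
    proof (rule ccontr)
      assume n: "fst (F p) \<notin> Xset i K"
      obtain U where U: "zopen (BB L K) U" "p \<in> U" "U \<subseteq> W" "\<And>q. q \<in> U \<Longrightarrow> fst (F q) \<notin> Xset i K"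
        using Xset_closed[OF W(1) Fr(1) FB(1) W(2) n] by blast
      show False by (rule no[OF U(1-3)]) (use U(4) in \<open>simp add: mem_Times_iff\<close>)
    qed
    moreover have "snd (F p) \<in> Xset i L"
    proof (rule ccontr)
      assume n: "snd (F p) \<notin> Xset i L"
      obtain U where U: "zopen (BB L K) U" "p \<in> U" "U \<subseteq> W" "\<And>q. q \<in> U \<Longrightarrow> snd (F q) \<notin> Xset i L"
        using Xset_closed[OF W(1) Fr(2) FB(2) W(2) n] by blast
      show False by (rule no[OF U(1-3)]) (use U(4) in \<open>simp add: mem_Times_iff\<close>)
    qed
    ultimately show "y \<in> ?Y" using W(2,5) p(2) by (auto simp: mem_Times_iff)
  qed
  have m: "regular_map ?X (dom (?t |` ?X)) (\<lambda>p. the ((?t |` ?X) p))"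
    unfolding regular_map_def
  proof (intro allI conjI regular_fun_localI)
    fix k p assume p: "p \<in> dom (?t |` ?X)"
    then obtain W F where W: "zopen (BB L K) W" "p \<in> W" "regular_map (BB L K) W F" "\<forall>q\<in>W. ?t q = Some (F q)"
      using loc[of p] unfolding dom by blast
    have Fr: "regular_fun ?X (W \<inter> ?X) (\<lambda>p. fst (F p) k)" "regular_fun ?X (W \<inter> ?X) (\<lambda>p. snd (F p) k)"
      using W(3) regular_restrict[OF _ zopen_subset[OF W(1)] XB] by (auto simp: regular_map_def)
    have sub: "p \<in> W \<inter> ?X" "W \<inter> ?X \<subseteq> dom (?t |` ?X)" using p W(2,4) unfolding dom by auto
    have e: "\<forall>q\<in>W \<inter> ?X. the ((?t |` ?X) q) = F q" using W(4) by simp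
    show "\<exists>U h. p \<in> U \<and> U \<subseteq> dom (?t |` ?X) \<and> regular_fun ?X U h \<and> (\<forall>q\<in>U. fst (the ((?t |` ?X) q)) k = h q)"
      using Fr(1) sub e by (intro exI[of _ "W \<inter> ?X"] exI[of _ "\<lambda>q. fst (F q) k"]) simp
    show "\<exists>U h. p \<in> U \<and> U \<subseteq> dom (?t |` ?X) \<and> regular_fun ?X U h \<and> (\<forall>q\<in>U. snd (the ((?t |` ?X) q)) k = h q)"
      using Fr(2) sub e by (intro exI[of _ "W \<inter> ?X"] exI[of _ "\<lambda>q. snd (F q) k"]) simp
  qed
  show ?thesis unfolding rational_map_def using o d r m by blast
qed

lemma birational_Xset:
  assumes N: "i = 2 \<or> i = 4 \<Longrightarrow> even N" and i: "i \<in> {1,2,3,4}"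
  shows "birational_map (Xset i L \<times> Xset i K) (Xset i K \<times> Xset i L) (tropical_R N L K |` (Xset i L \<times> Xset i K))"
proof (cases "L = K")
  case True
  \<comment> \<open>Here the set \<open>gen\<close> is avoided, since its density is established
    only in the ambient product. The map is the identity on all of \<open>?X\<close> and is its own
    inverse.\<close>
  let ?X = "Xset i L \<times> Xset i L"
  have t: "tropical_R N L L p = Some p" if "p \<in> ?X" for p
    using tropical_R_diagonal that Xset_BD by blast
  have rat: "rational_map ?X ?X (tropical_R N L L |` ?X)"
    by (rule tropical_restrict_rational[OF zdense_self]) (use t in blast)
  have "\<forall>p\<in>?X. ((tropical_R N L L |` ?X) \<circ>\<^sub>m (tropical_R N L L |` ?X)) p = Some p"
    using t by (simp add: map_comp_def)
  then show ?thesis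
    using True rat unfolding birational_map_def by (metis zopen_self zdense_self)
next
  case False
  have rat: "rational_map (Xset i L \<times> Xset i K) (Xset i K \<times> Xset i L) (tropical_R N L K |` (Xset i L \<times> Xset i K))"
    if "L \<noteq> K" for L K
    by (rule tropical_restrict_rational[OF gen_dense_Xset[OF N i that]])
      (use F_Xset[OF N i] tropical_R_gen[OF that] in blast)+
  \<comment> \<open>Stated for arbitrary distinct parameters, because it is used in both orders: the
    two instances provide the open dense sets in the source and in the target.\<close>
  have inv: "zopen (Xset i L \<times> Xset i K) (gen L K \<inter> (Xset i L \<times> Xset i K)) \<and>
      zdense (Xset i L \<times> Xset i K) (gen L K \<inter> (Xset i L \<times> Xset i K)) \<and>
      (\<forall>p\<in>gen L K \<inter> (Xset i L \<times> Xset i K).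
        ((tropical_R N K L |` (Xset i K \<times> Xset i L)) \<circ>\<^sub>m (tropical_R N L K |` (Xset i L \<times> Xset i K))) p = Some p)"
    if LK: "L \<noteq> K" for L K
  proof (intro conjI ballI)
    have "Xset i L \<times> Xset i K \<subseteq> BB L K" using Xset_BD by blast
    then show "zopen (Xset i L \<times> Xset i K) (gen L K \<inter> (Xset i L \<times> Xset i K))"
      by (rule zopen_restrict[OF zopen_gen(2)])
    show "zdense (Xset i L \<times> Xset i K) (gen L K \<inter> (Xset i L \<times> Xset i K))"
      by (rule gen_dense_Xset[OF N i LK])
    fix p assume p: "p \<in> gen L K \<inter> (Xset i L \<times> Xset i K)"
    then have "F L K p \<in> Xset i K \<times> Xset i L" "F L K p \<in> gen K L" "F K L (F L K p) = p"
      using F_Xset[OF N i] F_inverse[OF _ LK] by blast+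
    then show "((tropical_R N K L |` (Xset i K \<times> Xset i L)) \<circ>\<^sub>m (tropical_R N L K |` (Xset i L \<times> Xset i K))) p = Some p"
      using p tropical_R_gen[OF LK] tropical_R_gen[OF LK[symmetric]] by (simp add: map_comp_def restrict_map_def)
  qed
  show ?thesis
    unfolding birational_map_def
    using rat[OF False] rat[OF False[symmetric]] inv[OF False] inv[OF False[symmetric]] by blast
qed

end

theorem theorem8p4:
  fixes i n N :: nat and L K :: complex
  assumes "i \<in> {1, 2, 3, 4}"
    and "N = rankN i n"
    and "N \<ge> 4"
    and "L \<noteq> 0" and "K \<noteq> 0"
  shows "birational_map (X_var i n L \<times> X_var i n K) (X_var i n K \<times> X_var i n L)
           (tropical_R N L K |` (X_var i n L \<times> X_var i n K))"
proof -
  interpret D_rank N by unfold_locales (rule assms(3))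
  have "even N" if "i = 2 \<or> i = 4" using that assms(2) by (auto simp: rankN_def)
  then show ?thesis
    unfolding X_var_eq[OF assms(1,2)] by (rule birational_Xset[OF _ assms(1)])
qed

end
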